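(* Let $a=\frac{16}{3\sqrt3}$. Let $f:(0,a)\to\mathbb{R}$ satisfy, on $(0,a)$, $$(27x^4-256x^2)f'''(x)+(162x^3-768x)f''(x)+(177x^2-192)f'(x)+15xf(x)=0,$$ together with $\int_0^a f(x)\,dx=1$ and the conditions 1. $f$ is three times continuously differentiable on $(0,a)$ and $\lim_{x\to a^-}f(x)=0$; 2. $\lim_{x\to a^-}(x-a)f'(x)=0$; 3. $\lim_{x\to a^-}\left(2(x-a)f''(x)+f'(x)\right)=0$; 4. $\lim_{x\to0^+}xf(x)=0$, $\lim_{x\to0^+}x^2f'(x)=0$, and $\lim_{x\to0^+}x^3f''(x)=0$. Let $g(x)=f(x)$ for $x\in(0,a)$ and $g(x)=0$ for $x\ge a$. Let $\{G_n\}$ be a sequence of random graphs with $G_n\sim G(n,\frac12)$ and let $M_n=\frac{1}{n^{3/2}}M_{\alpha_{Z(3)}}(G_n)$. Then, with probability $1$, the spectrum $D_{M_n}$ of the singular values of $M_n$ converges weakly, as $n\to\infty$, to the distribution on $(0,\infty)$ with density $g$.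
   Context: Graph matrix: for a graph $G$ on $[n]$ and distinct $s,t\in[n]$ let $\chi_{st}(G)=1$ if $\{s,t\}\in E(G)$ and $-1$ otherwise. $M_{\alpha_{Z(3)}}(G)$ is the square matrix with rows and columns indexed by ordered triples of distinct elements of $[n]$ (so of size $n(n-1)(n-2)$). Its entry at $((a_1,a_2,a_3),(b_1,b_2,b_3))$ is $\prod_{j=1}^3\chi_{a_jb_j}(G)\prod_{j=1}^{2}\chi_{a_{j+1}b_j}(G)$ if $\{a_1,a_2,a_3\}\cap\{b_1,b_2,b_3\}=\emptyset$, and $0$ otherwise. For an $N\times N$ real matrix $M$, $D_M$ denotes the uniform distribution on its $N$ singular values, counted with multiplicity and including zero singular values. $G(n,\frac12)$ is the uniformly random graph on $[n]$. Weak convergence means convergence of cumulative distribution functions at every continuity point of the limit. *)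

theory Defs
  imports
    "HOL-Probability.Probability"
    "HOL-Computational_Algebra.Polynomial"
    "Jordan_Normal_Form.Char_Poly"
begin

section \<open>Graphs on \<open>[n]\<close>\<close>

text \<open>A simple graph on \<open>[n] = {1..n}\<close> is represented by its edge set, a set of
  two-element subsets of \<open>[n]\<close>.\<close>

definition graphs_on :: "nat \<Rightarrow> nat set set set" where
  "graphs_on n = Pow {e. e \<subseteq> {1..n} \<and> card e = 2}"

definition edge_sign :: "nat set set \<Rightarrow> nat \<Rightarrow> nat \<Rightarrow> real" where
  "edge_sign E s t = (if {s, t} \<in> E then 1 else -1)"

text \<open>\<open>X\<close> is a random variable with law \<open>G(n, 1/2)\<close>.\<close>

definition uniform_random_graph :: "'w measure \<Rightarrow> nat \<Rightarrow> ('w \<Rightarrow> nat set set) \<Rightarrow> bool" where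
  "uniform_random_graph P n X \<longleftrightarrow>
     X \<in> measurable P (count_space (graphs_on n)) \<and>
     distr P (count_space (graphs_on n)) X = uniform_count_measure (graphs_on n)"

section \<open>The graph matrix of the shape \<open>Z(3)\<close>\<close>

text \<open>The triples \<open>(a\<^sub>1, a\<^sub>2, a\<^sub>3)\<close> are lists of length 3, so that \<open>a\<^sub>j\<close> is \<open>as ! (j - 1)\<close>.
  Matrices are indexed by natural numbers, so rows and columns are
  labelled through one fixed enumeration of the triples; singular values do not depend on it.\<close>

definition triples :: "nat \<Rightarrow> nat list list" where
  "triples n = filter distinct (List.n_lists 3 [1..<Suc n])"

lemma set_triples:
  "set (triples n) = {as. length as = 3 \<and> distinct as \<and> set as \<subseteq> {1..n}}"
  by (auto simp: triples_def set_n_lists)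

lemma distinct_triples: "distinct (triples n)"
  by (auto simp: triples_def intro!: distinct_filter distinct_n_lists)

definition Z3_entry :: "nat set set \<Rightarrow> nat list \<Rightarrow> nat list \<Rightarrow> real" where
  "Z3_entry E as bs =
     (if set as \<inter> set bs = {}
      then (\<Prod>j<3. edge_sign E (as ! j) (bs ! j)) * (\<Prod>j<2. edge_sign E (as ! Suc j) (bs ! j))
      else 0)"

definition Z3_matrix :: "nat \<Rightarrow> nat set set \<Rightarrow> real mat" where
  "Z3_matrix n E =
     mat (length (triples n)) (length (triples n))
       (\<lambda>(i, j). Z3_entry E (triples n ! i) (triples n ! j))"

section \<open>Singular values and their uniform distribution\<close>

text \<open>The singular values of \<open>M\<close> are the square roots of the eigenvalues of
  \<open>M\<^sup>T M\<close>, with multiplicity. As \<open>M\<^sup>T M\<close> is real symmetric and positive semidefinite,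
  its characteristic polynomial splits over the reals with nonnegative roots, so for an
  \<open>N \<times> N\<close> matrix the multiset has exactly \<open>N\<close> elements.\<close>

definition singular_values :: "real mat \<Rightarrow> real multiset" where
  "singular_values M = image_mset sqrt (proots (char_poly (transpose_mat M * M)))"

text \<open>For the empty matrix there are no singular values, and the value is unspecified.\<close>

definition singular_value_distribution :: "real mat \<Rightarrow> real measure" where
  "singular_value_distribution M =
     distr (measure_pmf (pmf_of_multiset (singular_values M))) borel (\<lambda>x. x)"

end

theory Submission
  imports Defs "Jordan_Normal_Form.Schur_Decomposition" "HOL-Computational_Algebra.Formal_Power_Series"
begin

text \<open>
  The even moments of the singular values of \<open>M\<close> are the normalised traces of \<open>(M\<^sup>T M) ^ k\<close>. Such a
  trace is a sum over closed walks \<open>c 0, \<dots>, c (2 k - 1)\<close> of triples, each weighted by a product of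
  \<open>10 k\<close> edge signs. Its mean is the number of balanced walks, those that use every edge an even
  number of times. The proof finds the order \<open>p k * n ^ (3 k + 3)\<close> of this number, where \<open>p k\<close> is the
  Fuss--Catalan number given by \<open>A = 1 + z A ^ 4\<close>, shows that the traces concentrate, and identifies
  \<open>p k\<close> with the moment of order \<open>2 k\<close> of \<open>f\<close>.

  Refine a walk so that one coordinate of the triple changes at a time, in the order \<open>2, 1, 0\<close> and
  \<open>0, 1, 2\<close> alternately. Then the two ends of every cross edge meet in an intermediate triple. As
  each edge is repeated, no refined step can both introduce a new vertex and lose an old one for
  good, so a balanced walk has at most \<open>3 k + 3\<close> vertices (\<open>card_verts_le\<close>). In a walk that attains
  the bound every step does exactly one of the two, for every choice of the starting point. Hence
  each step is undone by a partner step (\<open>partner_exists\<close>), and partners in one row are nested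
  (\<open>partner_nested\<close>). That partners in different rows do not cross either (\<open>noncrossing\<close>) uses the
  cross edges: changing the sign of suitable edges in the balance condition shows that the lower rows
  have returned to their old state when a step is undone. So the walk is the run of a stack, which
  replaces a vertex by a fresh one or restores the last replaced one (\<open>tight_walk_in_runs\<close>).
  Conversely every run is balanced (\<open>run_code_is_walk_code\<close>). Therefore \<open>p k\<close> counts the noncrossing
  pairings of equal letters of the word \<open>(2 1 0 0 1 2) ^ k\<close> (\<open>card_balanced_walks\<close>). Their generating
  functions for the six possible initial letters satisfy a system of equations that collapses to the
  quartic one (\<open>phase_series_quartic\<close>).

  The variance of the trace counts pairs of walks that are balanced together but not separately. Such
  walks share an edge, which costs two vertices (\<open>card_triple_walk_pair\<close>). So the variances of the
  moments are of order \<open>1 / n ^ 2\<close>, they are summable, and the moments converge almost surely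
  (\<open>moment_tendsto_AE\<close>).

  Multiplying the differential equation by \<open>x ^ (2 k + 1)\<close> and integrating by parts gives a two-term
  recursion for the moments of \<open>f\<close>; the boundary conditions are just what makes the boundary terms
  vanish, in view of \<open>27 * a ^ 2 = 256\<close> (\<open>moments_from_ode\<close>). It is the recursion of the
  Fuss--Catalan numbers (\<open>pairings_recurrence\<close>), and both sequences start with 1.

  The method of moments remains (\<open>moment_convergence\<close>). The function \<open>f\<close> is not known to be
  nonnegative, so the limit is described by the primitive \<open>F\<close> of \<open>f\<close>. Continuous steps are approximated
  by even polynomials, which shows that the distribution functions converge to \<open>F\<close>. As a limit of
  distribution functions \<open>F\<close> is monotone, and \<open>f\<close> is nonnegative after all.
\<close>

section \<open>Vertices of a cyclic walk of states\<close>

lemma card_Un_by_first_occurrence: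
  fixes T :: "nat \<Rightarrow> 'v set"
  assumes "\<And>m. finite (T m)"
  shows "card (\<Union>m\<le>M. T m) = card (T 0) + (\<Sum>m<M. card (T (Suc m) - (\<Union>i\<le>m. T i)))"
proof (induction M)
  case (Suc M)
  have "(\<Union>m\<le>Suc M. T m) = (\<Union>m\<le>M. T m) \<union> (T (Suc M) - (\<Union>i\<le>M. T i))"
    by (auto simp: atMost_Suc)
  also have "card \<dots> = card (\<Union>m\<le>M. T m) + card (T (Suc M) - (\<Union>i\<le>M. T i))"
    by (rule card_Un_disjoint) (use assms in auto)
  finally show ?case using Suc by simp
qed auto

lemma card_Un_by_last_occurrence:
  fixes T :: "nat \<Rightarrow> 'v set"
  assumes "\<And>m. finite (T m)"
  shows "card (\<Union>m\<le>M. T m) = card (T M) + (\<Sum>m<M. card (T m - (\<Union>i\<in>{m<..M}. T i)))"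
proof -
  define T' where "T' m = T (M - m)" for m
  have im: "(\<lambda>m. M - m) ` {..M} = {..M}"
    by (auto simp: image_iff) (metis atMost_iff diff_diff_cancel diff_le_self)
  have "(\<Union>m\<le>M. T' m) = (\<Union>m\<in>(\<lambda>m. M - m) ` {..M}. T m)" by (auto simp: T'_def)
  then have U: "(\<Union>m\<le>M. T' m) = (\<Union>m\<le>M. T m)" unfolding im .
  have "card (\<Union>m\<le>M. T' m) = card (T' 0) + (\<Sum>m<M. card (T' (Suc m) - (\<Union>i\<le>m. T' i)))"
    by (rule card_Un_by_first_occurrence) (use assms in \<open>auto simp: T'_def\<close>)
  also have "(\<Sum>m<M. card (T' (Suc m) - (\<Union>i\<le>m. T' i)))
     = (\<Sum>m<M. card (T' (Suc (M - Suc m)) - (\<Union>i\<le>M - Suc m. T' i)))"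
    by (rule sum.nat_diff_reindex[symmetric])
  also have "\<dots> = (\<Sum>m<M. card (T m - (\<Union>i\<in>{m<..M}. T i)))"
  proof (rule sum.cong)
    fix m assume "m \<in> {..<M}"
    then have m: "m < M" by simp
    have "(\<lambda>i. M - i) ` {..M - Suc m} = {m<..M}"
    proof safe
      fix x assume "x \<in> {m<..M}"
      then show "x \<in> (\<lambda>i. M - i) ` {..M - Suc m}"
        by (intro image_eqI[of _ _ "M - x"]) auto
    qed (use m in auto)
    then have "(\<Union>i\<le>M - Suc m. T' i) = (\<Union>i\<in>{m<..M}. T i)"
      by (metis (no_types, lifting) SUP_cong T'_def image_image)
    moreover have "T' (Suc (M - Suc m)) = T m" using m by (simp add: T'_def Suc_diff_Suc)
    ultimately show "card (T' (Suc (M - Suc m)) - (\<Union>i\<le>M - Suc m. T' i)) = card (T m - (\<Union>i\<in>{m<..M}. T i))"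
      by simp
  qed auto
  finally show ?thesis using U by (simp add: T'_def)
qed

text \<open>A cyclic walk of states: a state assigns a vertex to each of \<open>R\<close> rows, and step \<open>l\<close> changes
  row \<open>\<sigma> l\<close> only. Time runs over all natural numbers with period \<open>L\<close>, so that windows of length
  \<open>L\<close> can start anywhere.\<close>

locale closed_walk =
  fixes s :: "nat \<Rightarrow> nat \<Rightarrow> 'v" and \<sigma> :: "nat \<Rightarrow> nat" and R L :: nat
  assumes L_pos: "0 < L"
    and period: "s (l + L) = s l"
    and period_row: "\<sigma> (l + L) = \<sigma> l"
    and row_less: "\<sigma> l < R"
    and stay: "i < R \<Longrightarrow> i \<noteq> \<sigma> l \<Longrightarrow> s (Suc l) i = s l i"
    and inj_state: "inj_on (s l) {..<R}"
    and move: "s (Suc l) (\<sigma> l) \<noteq> s l (\<sigma> l)"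
begin

definition "old l = s l (\<sigma> l)"
definition "new l = s (Suc l) (\<sigma> l)"
definition "occ l = s l ` {..<R}"

lemma s_mod: "x mod L = y mod L \<Longrightarrow> s x = s y"
proof -
  have "s (a + n * L) = s a" for a n by (induction n) (auto simp: period add.assoc[symmetric] add.commute[of L])
  then have "s (a mod L) = s a" for a by (metis mod_div_mult_eq)
  then show "x mod L = y mod L \<Longrightarrow> s x = s y" by metis
qed

lemma \<sigma>_mod: "x mod L = y mod L \<Longrightarrow> \<sigma> x = \<sigma> y"
proof -
  have "\<sigma> (a + n * L) = \<sigma> a" for a n by (induction n) (auto simp: period_row add.assoc[symmetric] add.commute[of L])
  then have "\<sigma> (a mod L) = \<sigma> a" for a by (metis mod_div_mult_eq)
  then show "x mod L = y mod L \<Longrightarrow> \<sigma> x = \<sigma> y" by metis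
qed

lemma occ_mod: "x mod L = y mod L \<Longrightarrow> occ x = occ y"
  unfolding occ_def using s_mod by metis

lemma old_mod: "x mod L = y mod L \<Longrightarrow> old x = old y"
  unfolding old_def using s_mod \<sigma>_mod by metis

lemma new_mod: "x mod L = y mod L \<Longrightarrow> new x = new y"
  unfolding new_def using s_mod[of "Suc x" "Suc y"] \<sigma>_mod[of x y] by (metis mod_Suc_eq)

lemma occ_period [simp]: "occ (l + L) = occ l" by (rule occ_mod) simp
lemma old_period [simp]: "old (l + L) = old l" by (rule old_mod) simp
lemma new_period [simp]: "new (l + L) = new l" by (rule new_mod) simp

lemma window_repr: obtains x' where "b \<le> x'" "x' < b + L" "x' mod L = x mod L"
proof
  let ?x = "b + (x + b * L - b) mod L"
  have le: "b \<le> x + b * L" using L_pos by (metis add_leD2 le_add2 mult_le_mono2 nat_mult_1_right One_nat_def Suc_leI order_trans)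
  show "b \<le> ?x" "?x < b + L" using L_pos by auto
  have "?x mod L = (b + (x + b * L - b)) mod L" by (simp add: mod_add_right_eq)
  also have "\<dots> = (x + b * L) mod L" using le by simp
  finally show "?x mod L = x mod L" by simp
qed

lemma finite_occ [simp]: "finite (occ l)" by (simp add: occ_def)
lemma card_occ: "card (occ l) = R" using inj_state by (simp add: occ_def card_image)
lemma old_in: "old l \<in> occ l" using row_less by (auto simp: old_def occ_def)
lemma new_in: "new l \<in> occ (Suc l)" using row_less by (auto simp: new_def occ_def)

lemma old_notin: "old l \<notin> occ (Suc l)"
proof
  assume "old l \<in> occ (Suc l)"
  then obtain i where i: "i < R" "s (Suc l) i = old l" by (auto simp: occ_def)
  then have "i \<noteq> \<sigma> l" using move[of l] by (metis old_def)
  then have "s l i = s l (\<sigma> l)" using i stay by (simp add: old_def)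
  then show False using inj_state[of "l"] i \<open>i \<noteq> \<sigma> l\<close> row_less by (auto simp: inj_on_def)
qed
lemma occ_Suc: "occ (Suc l) = insert (new l) (occ l - {old l})"
proof (intro equalityI subsetI)
  fix x assume "x \<in> occ (Suc l)"
  then obtain i where i: "i < R" "x = s (Suc l) i" by (auto simp: occ_def)
  show "x \<in> insert (new l) (occ l - {old l})"
  proof (cases "i = \<sigma> l")
    case False
    then have "x = s l i" using i stay by simp
    moreover have "x \<noteq> old l" using i old_notin \<open>x \<in> occ (Suc l)\<close> by auto
    ultimately show ?thesis using i by (auto simp: occ_def)
  qed (use i in \<open>auto simp: new_def\<close>)
next
  fix x assume "x \<in> insert (new l) (occ l - {old l})"
  then consider "x = new l" | "x \<in> occ l" "x \<noteq> old l" by auto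
  then show "x \<in> occ (Suc l)"
  proof cases
    case 2
    then obtain i where i: "i < R" "x = s l i" by (auto simp: occ_def)
    then have "i \<noteq> \<sigma> l" using 2 by (auto simp: old_def)
    then show ?thesis using i stay[of i l] by (auto simp: occ_def image_iff intro!: bexI[of _ i])
  qed (simp add: new_in)
qed

definition verts where "verts = (\<Union>l. occ l)"

lemma verts_window: "verts = (\<Union>m\<le>L. occ (b + m))"
proof (intro equalityI subsetI)
  fix x assume "x \<in> verts"
  then obtain l where "x \<in> occ l" by (auto simp: verts_def)
  moreover obtain l' where "b \<le> l'" "l' < b + L" "l' mod L = l mod L" by (rule window_repr)
  ultimately show "x \<in> (\<Union>m\<le>L. occ (b + m))"
    by (intro UN_I[of "l' - b"]) (auto dest: occ_mod)
qed (auto simp: verts_def)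

text \<open>Inside the window of times from \<open>b\<close> to \<open>b + L\<close>, step \<open>l\<close> opens its new vertex, or
  closes its old one. Every vertex outside the first state is opened once, and every vertex outside
  the last state is closed once, which gives two formulas for the number of vertices.\<close>

definition first_at where "first_at b l \<longleftrightarrow> (\<forall>x. b \<le> x \<and> x \<le> l \<longrightarrow> new l \<notin> occ x)"
definition last_at where "last_at b l \<longleftrightarrow> (\<forall>x. l < x \<and> x \<le> b + L \<longrightarrow> old l \<notin> occ x)"

lemma card_verts_first: "card verts = R + (\<Sum>m<L. if first_at b (b + m) then 1 else 0)"
proof -
  have "card (occ (b + Suc m) - (\<Union>i\<le>m. occ (b + i))) = (if first_at b (b + m) then 1 else 0)" for m
  proof -
    have "occ (b + Suc m) - (\<Union>i\<le>m. occ (b + i)) = {new (b + m)} - (\<Union>i\<le>m. occ (b + i))"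
      using occ_Suc[of "b + m"] by auto
    moreover have "new (b + m) \<in> (\<Union>i\<le>m. occ (b + i)) \<longleftrightarrow> \<not> first_at b (b + m)"
      unfolding first_at_def by (auto simp: le_iff_add)
    ultimately show ?thesis by (cases "first_at b (b + m)") (simp_all add: insert_Diff_if)
  qed
  then show ?thesis unfolding verts_window[of b]
    by (subst card_Un_by_first_occurrence) (auto simp: card_occ)
qed

lemma card_verts_last: "card verts = R + (\<Sum>m<L. if last_at b (b + m) then 1 else 0)"
proof -
  have "card (occ (b + m) - (\<Union>i\<in>{m<..L}. occ (b + i))) = (if last_at b (b + m) then 1 else 0)" if "m < L" for m
  proof -
    have "occ (b + m) - (\<Union>i\<in>{m<..L}. occ (b + i)) = {old (b + m)} - (\<Union>i\<in>{m<..L}. occ (b + i))"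
    proof -
      have "x \<in> (\<Union>i\<in>{m<..L}. occ (b + i))" if "x \<in> occ (b + m)" "x \<noteq> old (b + m)" for x
        using that occ_Suc[of "b + m"] \<open>m < L\<close> by (intro UN_I[of "Suc m"]) auto
      then show ?thesis using old_in[of "b + m"] by auto
    qed
    moreover have "old (b + m) \<in> (\<Union>i\<in>{m<..L}. occ (b + i)) \<longleftrightarrow> \<not> last_at b (b + m)"
    proof -
      have "(\<exists>i\<in>{m<..L}. old (b + m) \<in> occ (b + i)) \<longleftrightarrow> (\<exists>x. b + m < x \<and> x \<le> b + L \<and> old (b + m) \<in> occ x)"
      proof
        assume "\<exists>x. b + m < x \<and> x \<le> b + L \<and> old (b + m) \<in> occ x"
        then obtain x where "b + m < x" "x \<le> b + L" "old (b + m) \<in> occ x" by blast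
        then show "\<exists>i\<in>{m<..L}. old (b + m) \<in> occ (b + i)" by (intro bexI[of _ "x - b"]) auto
      next
        assume "\<exists>i\<in>{m<..L}. old (b + m) \<in> occ (b + i)"
        then obtain i where "i \<in> {m<..L}" "old (b + m) \<in> occ (b + i)" by blast
        then show "\<exists>x. b + m < x \<and> x \<le> b + L \<and> old (b + m) \<in> occ x" by (intro exI[of _ "b + i"]) auto
      qed
      then show ?thesis by (auto simp: last_at_def)
    qed
    ultimately show ?thesis by (cases "last_at b (b + m)") (simp_all add: insert_Diff_if)
  qed
  then show ?thesis unfolding verts_window[of b]
    by (subst card_Un_by_last_occurrence) (auto simp: card_occ)
qed

end

text \<open>The property of a walk whose edges are all traversed at least twice: the pair of vertices
  exchanged in a step occurs again, inside a single state or as the pair of another step.\<close>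

locale repeating_walk = closed_walk +
  assumes repeat: "\<exists>l'. {old l, new l} \<subseteq> occ l' \<or> (l' mod L \<noteq> l mod L \<and> {old l', new l'} = {old l, new l})"
begin

text \<open>If a step opened its new vertex and closed its old one, the new vertex would occur only after the
  step and the old one only before it, so that nothing else in the window could contain both.\<close>

lemma not_first_and_last:
  assumes "b \<le> l" "l < b + L" shows "\<not> (first_at b l \<and> last_at b l)"
proof
  assume fl: "first_at b l \<and> last_at b l"
  have F: "new l \<notin> occ x" if "b \<le> x" "x \<le> l" for x using fl that by (auto simp: first_at_def)
  have La: "old l \<notin> occ x" if "l < x" "x \<le> b + L" for x using fl that by (auto simp: last_at_def)
  obtain l0 where l0: "{old l, new l} \<subseteq> occ l0 \<or> (l0 mod L \<noteq> l mod L \<and> {old l0, new l0} = {old l, new l})"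
    using repeat by blast
  obtain l' where l': "b \<le> l'" "l' < b + L" "l' mod L = l0 mod L" by (rule window_repr)
  have *: "{old l, new l} \<subseteq> occ l' \<or> (l' \<noteq> l \<and> {old l', new l'} = {old l, new l})"
    using l0 l'(3) occ_mod[of l' l0] old_mod[of l' l0] new_mod[of l' l0] by auto
  then show False
  proof
    assume "{old l, new l} \<subseteq> occ l'"
    then show False using F[of l'] La[of l'] l' by (cases "l' \<le> l") auto
  next
    assume A: "l' \<noteq> l \<and> {old l', new l'} = {old l, new l}"
    have B: "old l' \<in> occ l'" "new l' \<in> occ (Suc l')" using old_in new_in by auto
    show False
    proof (cases "l' < l")
      case True
      then have "new l \<notin> occ l'" "new l \<notin> occ (Suc l')" using F l' by auto
      then show False using A B by (auto simp: doubleton_eq_iff)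
    next
      case False
      then have "l < l'" using A by auto
      then have "old l \<notin> occ l'" "old l \<notin> occ (Suc l')" using La l' by auto
      then show False using A B by (auto simp: doubleton_eq_iff)
    qed
  qed
qed

text \<open>Each step contributes to at most one of the two counts of the vertices.\<close>

lemma card_verts_le: "2 * card verts \<le> 2 * R + L"
proof -
  have "2 * card verts = 2 * R + (\<Sum>m<L. (if first_at 0 m then 1 else 0) + (if last_at 0 m then 1 else 0))"
    using card_verts_first[of 0] card_verts_last[of 0] by (simp add: sum.distrib)
  also have "\<dots> \<le> 2 * R + (\<Sum>m<L. 1)"
    by (intro add_left_mono sum_mono) (use not_first_and_last[of 0] in auto)
  finally show ?thesis by simp
qed

end

section \<open>Walks with the maximal number of vertices\<close>

text \<open>The walks that attain the bound. They alone contribute to the leading order of the moments.\<close>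

locale tight_walk = repeating_walk +
  assumes tight: "2 * card verts = 2 * R + L"
begin

lemma first_or_last:
  assumes "b \<le> l" "l < b + L" shows "first_at b l \<longleftrightarrow> \<not> last_at b l"
proof -
  let ?h = "\<lambda>m. (if first_at b (b+m) then 1 else 0) + (if last_at b (b+m) then 1 else (0::nat))"
  have le: "?h m \<le> 1" if "m < L" for m using not_first_and_last[of b "b+m"] that by auto
  have "2 * card verts = 2 * R + (\<Sum>m<L. ?h m)"
    using card_verts_first[of b] card_verts_last[of b] by (simp add: sum.distrib)
  then have eq: "(\<Sum>m<L. ?h m) = (\<Sum>m<L. 1)" using tight by simp
  have "?h (l - b) = 1"
  proof (rule ccontr)
    assume "?h (l - b) \<noteq> 1"
    then have "?h (l - b) < 1" using le[of "l - b"] assms by linarith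
    then have "(\<Sum>m<L. ?h m) < (\<Sum>m<L. 1)" using assms le
      by (intro sum_strict_mono_strong[where a = "l - b"]) auto
    then show False using eq by simp
  qed
  then show ?thesis using assms by (auto split: if_splits)
qed

text \<open>Step \<open>m\<close> undoes step \<open>l\<close>: the new vertex of \<open>l\<close> lives exactly until \<open>m\<close>, the old one is absent
  exactly between them, up to one full turn.\<close>

definition partner where
  "partner l m \<longleftrightarrow> l < m \<and> m < l + L \<and> old m = new l \<and> new m = old l \<and>
     (\<forall>x. l < x \<and> x \<le> m \<longrightarrow> old l \<notin> occ x) \<and> (\<forall>x. m < x \<and> x \<le> l + L \<longrightarrow> new l \<notin> occ x)"

text \<open>Slide the start \<open>b\<close> of the window over one period, keeping the step \<open>l + L\<close> at its end. By
  tightness this step always opens its new vertex or closes its old one, and never both. The old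
  vertex stops being closed at its first return \<open>p\<close>, so the new vertex must disappear for good at
  the same moment; hence step \<open>p - 1\<close> exchanges the same two vertices.\<close>

lemma partner_exists: "\<exists>m. partner l m"
proof -
  define p where "p = (LEAST x. l < x \<and> old l \<in> occ x)"
  have ex: "l < l + L \<and> old l \<in> occ (l + L)" using old_in L_pos by simp
  have p: "l < p" "old l \<in> occ p" using LeastI[of "\<lambda>x. l < x \<and> old l \<in> occ x", OF ex] by (auto simp: p_def)
  have p_le: "p \<le> l + L" unfolding p_def using ex by (rule Least_le)
  have before: "old l \<notin> occ x" if "l < x" "x < p" for x
    using not_less_Least[of x "\<lambda>x. l < x \<and> old l \<in> occ x"] that by (auto simp: p_def)
  have "p \<noteq> Suc l" using p old_notin by auto
  define m where "m = p - 1"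
  have m: "l < m" "m < l + L" "p = Suc m" using p p_le \<open>p \<noteq> Suc l\<close> by (auto simp: m_def)
  have A: "first_at x (l + L) \<longleftrightarrow> (\<forall>y. x \<le> y \<and> y \<le> l + L \<longrightarrow> new l \<notin> occ y)" for x
    by (auto simp: first_at_def)
  have B: "last_at x (l + L) \<longleftrightarrow> (\<forall>y. l < y \<and> y \<le> x \<longrightarrow> old l \<notin> occ y)" for x
  proof
    assume H: "last_at x (l + L)"
    show "\<forall>y. l < y \<and> y \<le> x \<longrightarrow> old l \<notin> occ y"
    proof (intro allI impI)
      fix y assume "l < y \<and> y \<le> x"
      then have "l + L < y + L \<and> y + L \<le> x + L" by simp
      then have "old (l + L) \<notin> occ (y + L)" using H unfolding last_at_def by blast
      then show "old l \<notin> occ y" by simp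
    qed
  next
    assume H: "\<forall>y. l < y \<and> y \<le> x \<longrightarrow> old l \<notin> occ y"
    show "last_at x (l + L)" unfolding last_at_def
    proof (intro allI impI)
      fix y assume y: "l + L < y \<and> y \<le> x + L"
      then have "l < y - L \<and> y - L \<le> x" by auto
      then have "old l \<notin> occ (y - L)" using H by blast
      moreover have "occ (y - L) = occ y" using y occ_period[of "y - L"] by simp
      ultimately show "old (l + L) \<notin> occ y" by simp
    qed
  qed
  have X: "first_at x (l + L) \<longleftrightarrow> \<not> last_at x (l + L)" if "l < x" "x \<le> l + L" for x
    using first_or_last[of x "l+L"] that by auto
  have "\<not> last_at p (l + L)" using B p by auto
  then have a1: "first_at p (l + L)" using X p p_le by auto
  have "last_at m (l + L)" unfolding B using before m by auto
  then have "\<not> first_at m (l + L)" using X m by auto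
  then obtain y where y: "m \<le> y" "y \<le> l + L" "new l \<in> occ y" unfolding A by blast
  have "\<not> p \<le> y" using a1 y unfolding A by blast
  then have "y = m" using y m by simp
  then have nm: "new l \<in> occ m" using y by simp
  have np: "new l \<notin> occ (Suc m)" using a1 p_le m unfolding A by auto
  have om: "old l \<notin> occ m" "old l \<in> occ (Suc m)" using before p m by auto
  have "old m = new l" using nm np unfolding occ_Suc by auto
  moreover have "new m = old l" using om unfolding occ_Suc by auto
  moreover have "\<forall>x. m < x \<and> x \<le> l + L \<longrightarrow> new l \<notin> occ x" using a1 m unfolding A by auto
  ultimately have "partner l m" unfolding partner_def using m before by auto
  then show ?thesis ..
qed

lemma partner_unique: "partner l m \<Longrightarrow> partner l m' \<Longrightarrow> m = m'"
proof -
  have "\<not> m < m'" if "partner l m" "partner l m'" for m m'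
  proof
    assume "m < m'"
    moreover have "old l \<in> occ (Suc m)" using that(1) new_in[of m] by (auto simp: partner_def)
    moreover have "l < Suc m" "Suc m \<le> m'" using \<open>m < m'\<close> that(1) by (auto simp: partner_def)
    ultimately show False using that(2) unfolding partner_def by blast
  qed
  then show "partner l m \<Longrightarrow> partner l m' \<Longrightarrow> m = m'" by (metis linorder_neqE_nat)
qed

lemma partner_swap: assumes "partner l m" shows "partner m (l + L)"
proof -
  have "old l \<notin> occ x" if "l + L < x" "x \<le> m + L" for x
  proof -
    define y where "y = x - L"
    have y: "x = y + L" using that by (simp add: y_def)
    then have "l < y" "y \<le> m" using that by auto
    then show ?thesis using assms y by (auto simp: partner_def)
  qed
  then show ?thesis using assms unfolding partner_def by auto
qed

text \<open>All three claims are proved by one induction on the distance of the partners, because a departure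
  of \<open>new l\<close> from its row before time \<open>m\<close> is itself undone by a partner inside the interval.\<close>

lemma partner_nested:
  assumes "partner l m"
  shows "\<sigma> m = \<sigma> l"
    and "l < x \<Longrightarrow> x \<le> m \<Longrightarrow> new l \<in> occ x \<Longrightarrow> s x (\<sigma> l) = new l"
    and "l < c \<Longrightarrow> c < m \<Longrightarrow> \<sigma> c = \<sigma> l \<Longrightarrow> \<exists>d. l < d \<and> d < m \<and> (partner c d \<or> partner d c)"
proof -
  have "\<sigma> m = \<sigma> l \<and> (\<forall>x. l < x \<longrightarrow> x \<le> m \<longrightarrow> new l \<in> occ x \<longrightarrow> s x (\<sigma> l) = new l) \<and>
     (\<forall>c. l < c \<longrightarrow> c < m \<longrightarrow> \<sigma> c = \<sigma> l \<longrightarrow> (\<exists>d. l < d \<and> d < m \<and> (partner c d \<or> partner d c)))"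
    using assms
  proof (induction "m - l" arbitrary: l m rule: less_induct)
    case less
    note pm = less.prems
    note IH = less.hyps
    define i v where "i = \<sigma> l" and "v = new l"
    have iR: "i < R" using row_less i_def by auto
    have lm: "l < m" "m < l + L" and oldm: "old m = v" using pm by (auto simp: partner_def v_def)
    have v_m: "v \<in> occ m" using oldm old_in[of m] by auto
    \<comment> \<open>Whenever row \<open>i\<close> does not hold \<open>v\<close>, it left \<open>v\<close> at some step \<open>c\<close> and is waiting for the
      partner of \<open>c\<close> to bring \<open>v\<close> back: take \<open>c\<close> to be the last time at which the row held \<open>v\<close>.\<close>
    have bracket: "s x i = v \<or> (\<exists>c c'. l < c \<and> c < x \<and> x \<le> c' \<and> c' < m \<and> partner c c' \<and> \<sigma> c = i \<and> \<sigma> c' = i \<and> old c = v)"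
      if x: "l < x" "x \<le> m" for x
    proof -
      define c where "c = Max {y. l < y \<and> y \<le> x \<and> s y i = v}"
      have fin: "finite {y. l < y \<and> y \<le> x \<and> s y i = v}" by auto
      have "Suc l \<in> {y. l < y \<and> y \<le> x \<and> s y i = v}" using x by (auto simp: v_def new_def i_def)
      then have "c \<in> {y. l < y \<and> y \<le> x \<and> s y i = v}" unfolding c_def using fin by (intro Max_in) auto
      then have c: "l < c" "c \<le> x" "s c i = v" by auto
      have cmax: "y \<le> c" if "l < y" "y \<le> x" "s y i = v" for y unfolding c_def using fin that by auto
      show ?thesis
      proof (cases "c = x")
        case False
        then have cx: "c < x" using c by auto
        have "s (Suc c) i \<noteq> v" using cmax[of "Suc c"] cx c by auto
        then have sc: "\<sigma> c = i" using stay[of i c] c iR by auto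
        have oc: "old c = v" using c sc by (simp add: old_def)
        obtain c' where c': "partner c c'" using partner_exists by auto
        have "c < m" using cx x by simp
        then have "\<not> m \<le> c'" using c' v_m oc unfolding partner_def by blast
        then have cm: "c' < m" by simp
        have "c < c'" using c' by (simp add: partner_def)
        then have sc': "\<sigma> c' = i" using IH[of c' c] c' cm c sc lm by auto
        have "new c' = v" using c' oc by (simp add: partner_def)
        then have "s (Suc c') i = v" using sc' by (simp add: new_def)
        then have "\<not> Suc c' \<le> x" using cmax[of "Suc c'"] \<open>c < c'\<close> c by auto
        then have "x \<le> c'" by simp
        then show ?thesis using c cx c' cm sc sc' oc by blast
      qed (use c in auto)
    qed
    have in_row: "s x i = v" if x: "l < x" "x \<le> m" "v \<in> occ x" for x
      using bracket[OF x(1,2)]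
    proof
      assume "\<exists>c c'. l < c \<and> c < x \<and> x \<le> c' \<and> c' < m \<and> partner c c' \<and> \<sigma> c = i \<and> \<sigma> c' = i \<and> old c = v"
      then obtain c c' where "c < x" "x \<le> c'" "partner c c'" "old c = v" by blast
      then show ?thesis using x unfolding partner_def by auto
    qed
    have sm: "\<sigma> m = i"
    proof -
      have "s m i = s m (\<sigma> m)" using in_row[of m] lm v_m oldm by (simp add: old_def)
      then show ?thesis using inj_state[of m] iR row_less[of m] by (auto simp: inj_on_def)
    qed
    have "\<exists>d. l < d \<and> d < m \<and> (partner c d \<or> partner d c)" if c: "l < c" "c < m" "\<sigma> c = i" for c
    proof (cases "s c i = v")
      case True
      then have oc: "old c = v" using c by (simp add: old_def)
      obtain d where d: "partner c d" using partner_exists by auto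
      have "\<not> m \<le> d" using d v_m c oc unfolding partner_def by blast
      then show ?thesis using d c unfolding partner_def by (intro exI[of _ d]) auto
    next
      case False
      then obtain a a' where a: "l < a" "a < c" "c \<le> a'" "a' < m" "partner a a'" "\<sigma> a = i" "\<sigma> a' = i"
        using bracket[of c] c by auto
      show ?thesis
      proof (cases "c = a'")
        case True then show ?thesis using a by (intro exI[of _ a]) auto
      next
        case False
        then have "c < a'" using a by auto
        then have "\<exists>d. a < d \<and> d < a' \<and> (partner c d \<or> partner d c)"
          using IH[of a' a] a c by auto
        then show ?thesis using a by (meson less_trans)
      qed
    qed
    then show ?case using sm in_row unfolding i_def v_def by auto
  qed
  then show "\<sigma> m = \<sigma> l"
    and "l < x \<Longrightarrow> x \<le> m \<Longrightarrow> new l \<in> occ x \<Longrightarrow> s x (\<sigma> l) = new l"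
    and "l < c \<Longrightarrow> c < m \<Longrightarrow> \<sigma> c = \<sigma> l \<Longrightarrow> \<exists>d. l < d \<and> d < m \<and> (partner c d \<or> partner d c)" by auto
qed

lemma new_stays_in_row: assumes "new l \<in> occ x" shows "s x (\<sigma> l) = new l"
proof -
  obtain m where m: "partner l m" using partner_exists by auto
  obtain y where y: "Suc l \<le> y" "y < Suc l + L" "y mod L = x mod L" by (rule window_repr)
  have yn: "new l \<in> occ y" using assms occ_mod[OF y(3)] by simp
  have "y \<le> m"
  proof (rule ccontr)
    assume "\<not> y \<le> m"
    then have "m < y" "y \<le> l + L" using y by auto
    then show False using m yn unfolding partner_def by blast
  qed
  then show ?thesis using partner_nested(2)[OF m, of y] y yn s_mod[OF y(3)] by auto
qed

text \<open>A further vertex entering the row between the partner steps is brought in by a step whose own partner also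
  lies between them, and after that partner it does not occur before one full turn is over.\<close>

lemma partner_separates:
  assumes m: "partner l m" and x: "l < x" "x \<le> m" and y: "m < y" "y \<le> l + L"
  shows "s x (\<sigma> l) \<notin> occ y"
proof (cases "s x (\<sigma> l) = new l")
  case True then show ?thesis using m y by (auto simp: partner_def)
next
  case False
  define i w where "i = \<sigma> l" and "w = s x i"
  define z where "z = (LEAST z. l < z \<and> s z i = w)"
  have ex: "l < x \<and> s x i = w" using x by (simp add: w_def)
  have z: "l < z" "s z i = w" using LeastI[of "\<lambda>z. l < z \<and> s z i = w", OF ex] by (auto simp: z_def)
  have zx: "z \<le> x" unfolding z_def using ex by (rule Least_le)
  have zmin: "s q i \<noteq> w" if "l < q" "q < z" for q
    using not_less_Least[of q "\<lambda>z. l < z \<and> s z i = w"] that by (auto simp: z_def)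
  have "s (Suc l) i = new l" by (simp add: i_def new_def)
  then have "z \<noteq> Suc l" using z False by (auto simp: w_def i_def)
  then obtain c where c: "z = Suc c" "l < c" using z by (metis Suc_lessI Suc_lessE less_Suc_eq)
  have iR: "i < R" using row_less by (simp add: i_def)
  have sc: "\<sigma> c = i" using zmin[of c] c z stay[of i c] iR by auto
  have nc: "new c = w" using sc c z by (simp add: new_def)
  have cm: "c < m" using c zx x by auto
  obtain d where d: "l < d" "d < m" "partner c d \<or> partner d c"
    using partner_nested(3)[OF m, of c] c cm sc by (auto simp: i_def)
  have "\<not> partner d c"
  proof
    assume p: "partner d c"
    then have "old d = w" "d < c" using nc by (auto simp: partner_def)
    moreover have "\<sigma> d = i" using partner_nested(1)[OF p] sc by simp
    ultimately have "s d i = w" by (simp add: old_def)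
    then show False using zmin[of d] d \<open>d < c\<close> c by auto
  qed
  then have "partner c d" using d by auto
  moreover have "d < y" "y \<le> c + L" using y d c by auto
  ultimately have "w \<notin> occ y" using nc unfolding partner_def by blast
  then show ?thesis by (simp add: w_def i_def)
qed

end

section \<open>Sign conditions and noncrossing partners\<close>

text \<open>The sign of one step: the edge from the old to the new vertex, together with the edges to the
  row below before and after the step. Along a whole walk of triples the latter telescope to the
  cross edges of the walk, see \<open>gauge_product\<close> below.\<close>

definition gauge_weight :: "('v \<Rightarrow> 'v \<Rightarrow> real) \<Rightarrow> nat \<Rightarrow> (nat \<Rightarrow> 'v) \<Rightarrow> (nat \<Rightarrow> 'v) \<Rightarrow> real" where
  "gauge_weight \<theta> i x x' = \<theta> (x i) (x' i) * (if i = 0 then 1 else \<theta> (x (i - 1)) (x i) * \<theta> (x' (i - 1)) (x' i))"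

definition sign_kernel :: "('v \<Rightarrow> 'v \<Rightarrow> real) \<Rightarrow> bool" where
  "sign_kernel \<theta> \<longleftrightarrow> (\<forall>a b. \<theta> a b = \<theta> b a \<and> (\<theta> a b = 1 \<or> \<theta> a b = -1))"

lemma sign_kernelD: "sign_kernel \<theta> \<Longrightarrow> \<theta> a b = \<theta> b a" "sign_kernel \<theta> \<Longrightarrow> \<theta> a b * \<theta> a b = 1"
  "sign_kernel \<theta> \<Longrightarrow> \<theta> a b = 1 \<or> \<theta> a b = -1"
  unfolding sign_kernel_def by (metis mult_1 mult_minus1 minus_minus | metis)+

locale balanced_walk = tight_walk +
  assumes all_rows_move: "j < R \<Longrightarrow> \<exists>c. \<sigma> c = j"
    and balanced: "sign_kernel \<theta> \<Longrightarrow> (\<Prod>l<L. gauge_weight \<theta> (\<sigma> l) (s l) (s (Suc l))) = 1"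
begin

text \<open>A vertex introduced by a step stays in the row of that step, and each row holds an introduced
  vertex because all rows move.\<close>

lemma rows_disjoint:
  assumes "j < R" "j' < R" "s x j = s y j'" shows "j = j'"
proof -
  obtain c0 where "\<sigma> c0 = j" using all_rows_move assms by blast
  moreover obtain c1 where c1: "x \<le> c1" "c1 < x + L" "c1 mod L = c0 mod L" by (rule window_repr)
  ultimately have sc1: "\<sigma> c1 = j" using \<sigma>_mod by metis
  define c where "c = Max {c. c < x + L \<and> \<sigma> c = j}"
  have fin: "finite {c. c < x + L \<and> \<sigma> c = j}" by auto
  have "c \<in> {c. c < x + L \<and> \<sigma> c = j}" unfolding c_def using fin c1 sc1 by (intro Max_in) auto
  then have c: "c < x + L" "\<sigma> c = j" by auto
  have cmax: "c' \<le> c" if "c' < x + L" "\<sigma> c' = j" for c' unfolding c_def using fin that by auto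
  have const: "s (Suc c + n) j = new c" if "Suc c + n \<le> x + L" for n
    using that
  proof (induction n)
    case (Suc n)
    have "\<sigma> (Suc c + n) \<noteq> j" using cmax[of "Suc c + n"] Suc.prems by auto
    then show ?case using Suc stay[of j "Suc c + n"] assms by auto
  qed (use c in \<open>simp add: new_def\<close>)
  have "Suc c + (x + L - Suc c) = x + L" using c by simp
  then have "s (x + L) j = new c" using const[of "x + L - Suc c"] by (metis order_refl)
  then have n: "new c = s x j" by (simp add: period)
  then have "new c \<in> occ y" using assms by (auto simp: occ_def)
  then have "s y j = s y j'" using new_stays_in_row[of c y] c n assms by auto
  then show ?thesis using inj_state[of y] assms by (auto simp: inj_on_def)
qed

text \<open>The sign condition says that the edges from \<open>y = s l j\<close> to the vertices of row \<open>Suc j\<close> that live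
  between the partners are used evenly. Such an edge is used at \<open>l\<close>, so it is used again at \<open>m\<close>.\<close>

lemma partner_closes_row_below:
  assumes m: "partner l m" "m < L" and i: "\<sigma> l = Suc j"
  shows "s l j = s m j"
proof -
  \<comment> \<open>The kernel below is \<open>-1\<close> exactly between \<open>y\<close> and the vertices held by row \<open>Suc j\<close> while
    the move of step \<open>l\<close> is in force. Its gauge weight is \<open>-1\<close> at step \<open>l\<close>, and elsewhere it can
    be \<open>-1\<close> only at step \<open>m\<close>, which happens when row \<open>j\<close> holds \<open>y\<close> at that time.\<close>
  define S where "S = {s x (Suc j) | x. l < x \<and> x \<le> m}"
  define y where "y = s l j"
  define \<theta> where "\<theta> a b = (if a \<in> S \<and> b = y \<or> b \<in> S \<and> a = y then -1 else 1::real)" for a b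
  have lm: "l < m" "m < l + L" using m by (auto simp: partner_def)
  have sm: "\<sigma> m = Suc j" using partner_nested(1)[OF m(1)] i by simp
  have jR: "Suc j < R" using i row_less[of l] by simp
  have S_iff: "s x (Suc j) \<in> S \<longleftrightarrow> l < x \<and> x \<le> m" if x: "x \<le> L" for x
  proof
    assume "s x (Suc j) \<in> S"
    then obtain z where z: "l < z" "z \<le> m" "s x (Suc j) = s z (Suc j)" by (auto simp: S_def)
    show "l < x \<and> x \<le> m"
    proof (rule ccontr)
      assume "\<not> (l < x \<and> x \<le> m)"
      then consider "x \<le> l" | "m < x" by linarith
      then obtain x' where x': "m < x'" "x' \<le> l + L" "x' mod L = x mod L"
      proof cases
        case 1 then show ?thesis using that[of "x + L"] m by auto
      next
        case 2 then show ?thesis using that[of x] x by auto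
      qed
      have "s z (Suc j) \<notin> occ x'" using partner_separates[OF m(1) z(1,2) x'(1,2)] i by simp
      moreover have "s z (Suc j) \<in> occ x'" unfolding occ_def using z s_mod[OF x'(3)] jR by (auto intro!: image_eqI[of _ _ "Suc j"])
      ultimately show False by simp
    qed
  qed (auto simp: S_def)
  have not_S: "s x j' \<notin> S" if "j' < R" "j' \<noteq> Suc j" for x j'
    using rows_disjoint[of j' "Suc j" x] that jR by (auto simp: S_def)
  have not_y: "s x j' \<noteq> y" if "j' < R" "j' \<noteq> j" for x j'
    using rows_disjoint[of j' "j" x l] that jR by (auto simp: y_def)
  have one: "\<theta> (s x a) (s z b) = 1" if "a < R" "b < R" "\<not> (a = j \<and> b = Suc j)" "\<not> (b = j \<and> a = Suc j)" for x z a b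
    using that not_S not_y by (auto simp: \<theta>_def)
  have chi_j: "\<theta> (s x j) (s x (Suc j)) = (if l < x \<and> x \<le> m \<and> s x j = y then -1 else 1)" if "x \<le> L" for x
    using S_iff[OF that] not_S[of j x] not_y[of "Suc j" x] jR by (auto simp: \<theta>_def)
  have sk: "sign_kernel \<theta>" by (auto simp: sign_kernel_def \<theta>_def)
  have w: "gauge_weight \<theta> (\<sigma> c) (s c) (s (Suc c)) =
      (if c = l then -1 else 1) * (if c = m then (if s m j = y then -1 else 1) else 1)" if c: "c < L" for c
  proof (cases "\<sigma> c = Suc j")
    case False
    have "gauge_weight \<theta> (\<sigma> c) (s c) (s (Suc c)) = 1"
      using False row_less[of c] unfolding gauge_weight_def by (subst one, auto, subst one, auto, subst one, auto)
    moreover have "c \<noteq> l" "c \<noteq> m" using False i sm by auto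
    ultimately show ?thesis by simp
  next
    case True
    have st: "s (Suc c) j = s c j" using stay[of j c] True jR by simp
    have "\<theta> (s c (Suc j)) (s (Suc c) (Suc j)) = 1" using one jR by auto
    then have "gauge_weight \<theta> (\<sigma> c) (s c) (s (Suc c)) = \<theta> (s c j) (s c (Suc j)) * \<theta> (s (Suc c) j) (s (Suc c) (Suc j))"
      using True by (simp add: gauge_weight_def)
    also have "\<dots> = (if l < c \<and> c \<le> m \<and> s c j = y then -1 else 1) * (if l < Suc c \<and> Suc c \<le> m \<and> s c j = y then -1 else 1)"
      using chi_j[of c] chi_j[of "Suc c"] c st by simp
    also have "\<dots> = (if c = l then -1 else 1) * (if c = m then (if s m j = y then -1 else 1) else 1)"
      using lm by (auto simp: y_def)
    finally show ?thesis .
  qed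
  have "(\<Prod>c<L. gauge_weight \<theta> (\<sigma> c) (s c) (s (Suc c))) =
     (\<Prod>c<L. if c = l then -1 else 1) * (\<Prod>c<L. if c = m then (if s m j = y then -1 else 1) else 1)"
    by (simp add: w prod.distrib)
  also have "\<dots> = (-1) * (if s m j = y then -1 else 1)"
    using lm m by (simp add: prod.delta)
  finally have "(-1) * (if s m j = y then -1 else 1) = (1::real)" using balanced[OF sk] by simp
  then show ?thesis by (simp add: y_def split: if_splits)
qed

end

section \<open>The zigzag order of the rows\<close>

definition zigzag_row :: "nat \<Rightarrow> nat" where
  "zigzag_row l = (if even (l div 3) then 2 - l mod 3 else l mod 3)"

lemma zigzag_row_mod6: "zigzag_row l = [2,1,0,0,1,2] ! (l mod 6)"
proof -
  obtain q r where l: "l = 6 * q + r" "r < 6" "r = l mod 6" by (metis mult_div_mod_eq mod_less_divisor zero_less_numeral)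
  have d: "l div 3 = 2 * q + r div 3" "l mod 3 = r mod 3" using l(1) by presburger+
  have "r \<in> {0,1,2,3,4,5}" using l(2) by auto
  then show ?thesis unfolding zigzag_row_def d l(3)[symmetric] by auto
qed

locale zigzag_walk = balanced_walk s zigzag_row 3 L for s :: "nat \<Rightarrow> nat \<Rightarrow> 'v" and L
begin

lemma mod6_cases:
  obtains "l mod 6 = 0" "zigzag_row l = 2" | "l mod 6 = 1" "zigzag_row l = 1" | "l mod 6 = 2" "zigzag_row l = 0" |
   "l mod 6 = 3" "zigzag_row l = 0" | "l mod 6 = 4" "zigzag_row l = 1" | "l mod 6 = 5" "zigzag_row l = 2"
proof -
  have "l mod 6 \<in> {0,1,2,3,4,5}" by auto
  then show thesis using that by (auto simp: zigzag_row_mod6)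
qed

text \<open>Each block of three steps moves every row once, so the previous step in the same row lies in the
  previous block.\<close>

lemma previous_step:
  assumes "l < c" "zigzag_row l = zigzag_row c"
  obtains c' where "l \<le> c'" "c' < c" "zigzag_row c' = zigzag_row c" "c div 3 = Suc (c' div 3)"
    "s (Suc c') (zigzag_row c) = s c (zigzag_row c)"
proof -
  define c' where "c' = 3 * (c div 3 - 1) + (2 - c mod 3)"
  have inj3: "a = b" if "a div 3 = b div 3" "zigzag_row a = zigzag_row b" for a b :: nat
  proof -
    have "a mod 3 < 3" "b mod 3 < 3" by auto
    then have "a mod 3 = b mod 3" using that unfolding zigzag_row_def by (auto split: if_splits)
    then show ?thesis using that(1) by (metis div_mult_mod_eq)
  qed
  have "l div 3 \<noteq> c div 3" using inj3[of l c] assms by auto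
  then have lc: "l div 3 < c div 3" using assms(1) by (meson div_le_mono le_neq_implies_less less_imp_le)
  have m3: "c mod 3 < 3" by simp
  have c'd: "c' div 3 = c div 3 - 1" "c' mod 3 = 2 - c mod 3"
  proof -
    have "(3 * q + r) div 3 = q \<and> (3 * q + r) mod 3 = r" if "r < 3" for q r :: nat using that by simp
    from this[of "2 - c mod 3" "c div 3 - 1"]
    show "c' div 3 = c div 3 - 1" "c' mod 3 = 2 - c mod 3" unfolding c'_def by simp_all
  qed
  have dc: "c div 3 = Suc (c' div 3)" using lc c'd by simp
  have rc: "zigzag_row c' = zigzag_row c" using m3 unfolding zigzag_row_def dc c'd(2) by auto
  have c'c: "c' < c" using dc by (metis div_le_mono lessI linorder_not_less)
  have ge: "l \<le> c'"
  proof (rule ccontr)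
    assume "\<not> l \<le> c'"
    then have "c' div 3 \<le> l div 3" by (simp add: div_le_mono)
    then have "l div 3 = c' div 3" using dc lc by simp
    then show False using inj3[of l c'] rc assms \<open>\<not> l \<le> c'\<close> by simp
  qed
  have const: "s (Suc c' + n) (zigzag_row c) = s (Suc c') (zigzag_row c)" if "Suc c' + n \<le> c" for n
    using that
  proof (induction n)
    case (Suc n)
    have "zigzag_row (Suc c' + n) \<noteq> zigzag_row c"
    proof
      assume z: "zigzag_row (Suc c' + n) = zigzag_row c"
      have "c' div 3 \<le> (Suc c' + n) div 3" "(Suc c' + n) div 3 \<le> c div 3" using Suc.prems by (auto intro!: div_le_mono)
      then consider "(Suc c' + n) div 3 = c' div 3" | "(Suc c' + n) div 3 = c div 3" using dc by linarith
      then show False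
      proof cases
        case 1 then show False using inj3[of "Suc c' + n" c'] z rc by auto
      next
        case 2 then show False using inj3[of "Suc c' + n" c] z Suc.prems by auto
      qed
    qed
    then show ?case using Suc stay[of "zigzag_row c" "Suc c' + n"] row_less[of c] by auto
  qed auto
  have "s (Suc c') (zigzag_row c) = s c (zigzag_row c)"
    using const[of "c - Suc c'"] c'c by simp
  then show thesis using that ge c'c rc dc by blast
qed

text \<open>Partner steps run through the rows in opposite directions.\<close>

lemma partner_parity: "partner l m \<Longrightarrow> even (l div 3) \<longleftrightarrow> odd (m div 3)"
proof (induction "m - l" arbitrary: l m rule: less_induct)
  case less
  note pm = less.prems
  have lm: "l < m" "m < l + L" "old m = new l" using pm by (auto simp: partner_def)
  \<comment> \<open>Follow the row back from \<open>m\<close>: the step before \<open>c\<close> in this row lies one block earlier, and it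
    is \<open>l\<close> itself or brings \<open>new l\<close> back, so that its partner \<open>d\<close> is an earlier step removing
    \<open>new l\<close> from the row.\<close>
  have "even (l div 3) \<longleftrightarrow> odd (c div 3)"
    if "l < c" "c \<le> m" "zigzag_row c = zigzag_row l" "old c = new l" for c
    using that
  proof (induction c rule: less_induct)
    case (less c)
    obtain c' where c': "l \<le> c'" "c' < c" "zigzag_row c' = zigzag_row c" "c div 3 = Suc (c' div 3)"
      "s (Suc c') (zigzag_row c) = s c (zigzag_row c)"
      using previous_step[of l c] less.prems by metis
    show ?case
    proof (cases "c' = l")
      case False
      have nc: "new c' = new l" using c' less.prems(4) by (simp add: new_def old_def)
      have lc: "l < c'" "c' < m" using False c' less.prems by auto
      obtain d where d: "l < d" "d < m" "partner c' d \<or> partner d c'"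
        using partner_nested(3)[OF pm lc] c' less.prems by auto
      have "\<not> partner c' d"
      proof
        assume "partner c' d"
        then have "\<forall>x. d < x \<and> x \<le> c' + L \<longrightarrow> new l \<notin> occ x" using nc by (auto simp: partner_def)
        moreover have "m \<le> c' + L" using lc lm by simp
        moreover have "new l \<in> occ m" using lm old_in[of m] by simp
        ultimately show False using d by blast
      qed
      then have pd: "partner d c'" using d by simp
      then have dc: "d < c'" "old d = new l" using nc by (auto simp: partner_def)
      have "zigzag_row d = zigzag_row l" using partner_nested(1)[OF pd] c' less.prems by simp
      then have e1: "even (l div 3) \<longleftrightarrow> odd (d div 3)" using less.IH[of d] d dc c' by simp
      have "c' - d < m - l" using dc lc d by simp
      then have e2: "even (d div 3) \<longleftrightarrow> odd (c' div 3)" using \<open>\<And>m l. m - l < _ \<Longrightarrow> _ \<Longrightarrow> _\<close> pd by blast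
      then show ?thesis using e1 c'(4) by auto
    qed (use c' in auto)
  qed
  then show ?case using lm partner_nested(1)[OF pm] by auto
qed

text \<open>Row 2 is adjacent to row 1 only. Its effect on row 0 is found by following the row 1 steps inside
  the interval from one partner to the next.\<close>

lemma partner_closes_lower_rows:
  assumes m: "partner l m" "m < L" and j: "j < zigzag_row l"
  shows "s l j = s m j"
proof (cases "zigzag_row l = Suc j")
  case True then show ?thesis using partner_closes_row_below m by blast
next
  case False
  have "zigzag_row l < 3" by (rule row_less)
  then have r: "zigzag_row l = 2" and j0: "j = 0" using j False by auto
  have lm: "l < m" "m < l + L" using m by (auto simp: partner_def)
  have row1: "s l 1 = s m 1" using partner_closes_row_below[OF m, of 1] r by simp
  \<comment> \<open>In the phases \<open>5, 0, 1\<close> row 0 can only move after row 1 has moved. The last time in \<open>G\<close> is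
    \<open>m\<close>: from phases 5 and 0 the next step moves row 2 only, and from phase 1 one can jump to the
    end of the partner of the row 1 step, which returns to phase 5 by parity.\<close>
  define G where "G = {x. l < x \<and> x \<le> m \<and> s x 0 = s l 0 \<and> s x 1 = s l 1 \<and> x mod 6 \<in> {5,0,1}}"
  have finG: "finite G" by (rule finite_subset[of _ "{..m}"]) (auto simp: G_def)
  have rm: "zigzag_row m = 2" using partner_nested(1)[OF m(1)] r by simp
  have "Suc l \<in> G"
  proof -
    have "s (Suc l) 0 = s l 0" "s (Suc l) 1 = s l 1" using stay[of 0 l] stay[of 1 l] r by simp_all
    moreover have "Suc l mod 6 \<in> {5,0,1}" using r by (cases rule: mod6_cases[of l]) (auto simp: mod_Suc)
    ultimately show ?thesis using lm by (auto simp: G_def)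
  qed
  define x where "x = Max G"
  have xG: "x \<in> G" unfolding x_def using finG \<open>Suc l \<in> G\<close> by (intro Max_in) auto
  have xmax: "y \<le> x" if "y \<in> G" for y unfolding x_def using finG that by auto
  have "x = m"
  proof (rule ccontr)
    assume "x \<noteq> m"
    then have xm: "x < m" "l < x" "s x 0 = s l 0" "s x 1 = s l 1" using xG by (auto simp: G_def)
    show False
    proof (cases "x mod 6 = 1")
      case False
      then have x5: "x mod 6 = 5 \<or> x mod 6 = 0" using xG by (auto simp: G_def)
      then have "zigzag_row x = 2" by (auto simp: zigzag_row_mod6)
      then have "s (Suc x) 0 = s l 0" "s (Suc x) 1 = s l 1" using stay[of 0 x] stay[of 1 x] xm by simp_all
      moreover have "Suc x mod 6 \<in> {5,0,1}" using x5 by (auto simp: mod_Suc)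
      ultimately have "Suc x \<in> G" using xm by (auto simp: G_def)
      then show False using xmax[of "Suc x"] by simp
    next
      case True
      then have zx: "zigzag_row x = 1" by (auto simp: zigzag_row_mod6)
      obtain x' where x': "partner x x'" using partner_exists by blast
      have sx': "zigzag_row x' = 1" using partner_nested(1)[OF x'] zx by simp
      have xx': "x < x'" "x' < x + L" using x' by (auto simp: partner_def)
      have old1: "old x = s m 1" using xm zx row1 by (simp add: old_def)
      have x'm: "x' < m"
      proof (rule ccontr)
        assume "\<not> x' < m"
        then have "old x \<notin> occ m" using x' xm by (auto simp: partner_def)
        then show False using old1 by (auto simp: occ_def)
      qed
      have "even (x div 3)" using True by presburger
      then have "odd (x' div 3)" using partner_parity[OF x'] by simp
      then have x'4: "x' mod 6 = 4" using sx'
        by (cases rule: mod6_cases[of x']) (auto, presburger)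
      have "s x' 0 = s x 0" using partner_closes_row_below[OF x', of 0] zx x'm m by simp
      then have "s (Suc x') 0 = s l 0" using stay[of 0 x'] sx' xm by simp
      moreover have "s (Suc x') 1 = s l 1"
        using x' sx' old1 row1 by (simp add: partner_def new_def)
      moreover have "Suc x' mod 6 \<in> {5,0,1}" using x'4 by (auto simp: mod_Suc)
      ultimately have "Suc x' \<in> G" using xm xx' x'm by (auto simp: G_def)
      then show False using xmax[of "Suc x'"] xx' by simp
    qed
  qed
  then show ?thesis using xG j0 by (auto simp: G_def)
qed

lemma partner_shift: "partner (l + L) (m + L) \<Longrightarrow> partner l m"
proof -
  assume p: "partner (l + L) (m + L)"
  have "old l \<notin> occ x" if "l < x" "x \<le> m" for x
  proof -
    have "l + L < x + L \<and> x + L \<le> m + L" using that by simp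
    then have "old (l + L) \<notin> occ (x + L)" using p unfolding partner_def by blast
    then show ?thesis by simp
  qed
  moreover have "new l \<notin> occ x" if "m < x" "x \<le> l + L" for x
  proof -
    have "m + L < x + L \<and> x + L \<le> (l + L) + L" using that by simp
    then have "new (l + L) \<notin> occ (x + L)" using p unfolding partner_def by blast
    then show ?thesis by simp
  qed
  moreover have "l < m" "m < l + L" "old m = new l" "new m = old l" using p unfolding partner_def by auto
  ultimately show ?thesis unfolding partner_def by blast
qed

lemma partner_backward: assumes "partner a l" "partner b l" shows "a = b"
  using partner_unique[OF partner_swap[OF assms(1)] partner_swap[OF assms(2)]] by simp

text \<open>Of two crossing pairs in different rows, the one in the higher row would bring the lower row back
  to its value at the start, while the other one has changed it to a vertex that does not return in
  time.\<close>

lemma noncrossing: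
  assumes lm: "partner l m" and ab: "partner a b" "b < L" and cross: "l < a" "a < m" "m < b"
  shows False
proof -
  have mL: "m < L" using ab cross by simp
  have len: "m < l + L" "b < a + L" using lm ab by (auto simp: partner_def)
  have R3: "zigzag_row l < 3" "zigzag_row a < 3" using row_less by auto
  consider "zigzag_row a = zigzag_row l" | "zigzag_row a < zigzag_row l" | "zigzag_row l < zigzag_row a" by linarith
  then show False
  proof cases
    case 1
    obtain d where d: "l < d" "d < m" "partner a d \<or> partner d a"
      using partner_nested(3)[OF lm cross(1,2) 1] by blast
    then show False
    proof (elim disjE)
      assume "partner a d" then show False using partner_unique[OF ab(1)] d cross by auto
    next
      assume "partner d a"
      then have "b = d + L" using partner_unique[OF ab(1)] partner_swap by auto
      then show False using ab by simp
    qed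
  next
    case 2
    let ?j = "zigzag_row a"
    have eq: "s l ?j = s m ?j" using partner_closes_lower_rows[OF lm mL 2] .
    have "s m ?j \<notin> occ (l + L)" using partner_separates[OF ab(1), of m "l + L"] cross ab by simp
    moreover have "s l ?j \<in> occ (l + L)" using R3 by (auto simp: occ_def period)
    ultimately show False using eq by simp
  next
    case 3
    let ?j = "zigzag_row l"
    have eq: "s a ?j = s b ?j" using partner_closes_lower_rows[OF ab 3] .
    have "s a ?j \<notin> occ b" using partner_separates[OF lm, of a b] cross ab by simp
    moreover have "s b ?j \<in> occ b" using R3 by (auto simp: occ_def)
    ultimately show False using eq by simp
  qed
qed

end

section \<open>Tight walks as runs of a stack\<close>

text \<open>The ways to read the word \<open>w\<close> of rows with a stack. Each letter \<open>i\<close> either puts a fresh vertex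
  into row \<open>i\<close> and pushes the replaced one, or pops the stack, if its top belongs to row \<open>i\<close>, and
  restores the popped vertex. Here \<open>x\<close> is the current state, \<open>A\<close> the set of vertices used so far,
  and the stack must be empty at the end.\<close>

fun runs :: "'v set \<Rightarrow> nat list \<Rightarrow> (nat \<times> 'v) list \<Rightarrow> (nat \<Rightarrow> 'v) \<Rightarrow> 'v set \<Rightarrow> 'v list set" where
  "runs N [] st x A = (if st = [] then {[]} else {})"
| "runs N (i # w) st x A =
     (\<Union>v\<in>N - A. (#) v ` runs N w ((i, x i) # st) (x(i := v)) (insert v A)) \<union>
     (case st of [] \<Rightarrow> {}
      | (j, u) # st' \<Rightarrow> if i = j then (#) u ` runs N w st' (x(i := u)) A else {})"

context zigzag_walk
begin

text \<open>The stack contents at time \<open>l\<close>: the past steps whose partner is still to come, latest first.\<close>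

definition open_steps :: "nat \<Rightarrow> nat list" where
  "open_steps l = rev (filter (\<lambda>a. \<exists>b. partner a b \<and> l \<le> b \<and> b < L) [0..<l])"

text \<open>A step whose partner comes later pushes: its new vertex is fresh. A step whose partner came before
  pops: since partner pairs do not cross, all pairs opened in between are closed, so that its
  partner is on top of the stack.\<close>

lemma tight_walk_in_runs:
  assumes upd: "\<And>l. s (Suc l) = (s l)(zigzag_row l := new l)" and N: "verts \<subseteq> N" and "l \<le> L"
  shows "map new [l..<L] \<in> runs N (map zigzag_row [l..<L])
     (map (\<lambda>a. (zigzag_row a, old a)) (open_steps l)) (s l) (\<Union>x\<le>l. occ x)"
  using \<open>l \<le> L\<close>
proof (induction "L - l" arbitrary: l)
  case 0
  then have "l = L" by simp
  moreover have "open_steps L = []" by (auto simp: open_steps_def)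
  ultimately show ?case by simp
next
  case (Suc n)
  then have lL: "l < L" by simp
  have IH: "map new [Suc l..<L] \<in> runs N (map zigzag_row [Suc l..<L])
     (map (\<lambda>a. (zigzag_row a, old a)) (open_steps (Suc l))) (s (Suc l)) (\<Union>x\<le>Suc l. occ x)"
    by (rule Suc.hyps(1)) (use Suc in auto)
  have upt: "[l..<L] = l # [Suc l..<L]" using lL by (rule upt_conv_Cons)
  have A: "(\<Union>x\<le>Suc l. occ x) = insert (new l) (\<Union>x\<le>l. occ x)"
    using occ_Suc[of l] old_in[of l] by (auto simp: atMost_Suc)
  obtain m where m: "partner l m" using partner_exists by blast
  then have lm: "l < m" "m < l + L" by (auto simp: partner_def)
  show ?case
  proof (cases "m < L")
    case True
    have cond: "(\<exists>b. partner a b \<and> Suc l \<le> b \<and> b < L) \<longleftrightarrow> (\<exists>b. partner a b \<and> l \<le> b \<and> b < L)" if "a < l" for a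
    proof -
      have "\<not> partner a l"
      proof
        assume "partner a l"
        then have "m = a + L" using partner_unique[OF m] partner_swap by auto
        then show False using True by simp
      qed
      then show ?thesis by (metis Suc_leD Suc_leI le_neq_implies_less)
    qed
    have "open_steps (Suc l) = l # open_steps l"
    proof -
      have "filter (\<lambda>a. \<exists>b. partner a b \<and> Suc l \<le> b \<and> b < L) [0..<l] = filter (\<lambda>a. \<exists>b. partner a b \<and> l \<le> b \<and> b < L) [0..<l]"
        by (rule filter_cong) (use cond in auto)
      moreover have "\<exists>b. partner l b \<and> Suc l \<le> b \<and> b < L" using m True lm by (auto intro!: exI[of _ m])
      ultimately show ?thesis by (simp add: open_steps_def)
    qed
    moreover have "new l \<notin> (\<Union>x\<le>l. occ x)"
    proof safe
      fix x assume "x \<le> l" "new l \<in> occ x"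
      moreover have "m < x + L" "x + L \<le> l + L" using True \<open>x \<le> l\<close> by auto
      ultimately show False using m occ_period[of x] unfolding partner_def by blast
    qed
    moreover have "new l \<in> N" using N new_in[of l] by (auto simp: verts_def)
    ultimately show ?thesis using IH unfolding upt A by (auto simp: upd[of l] old_def)
  next
    case False
    define a where "a = m - L"
    have a: "m = a + L" "a < l" using False lm by (auto simp: a_def)
    have al: "partner a l" using partner_swap[OF m] a partner_shift by simp
    have ra: "zigzag_row a = zigzag_row l" using partner_nested(1)[OF al] by simp
    have na: "new l = old a" using al by (simp add: partner_def)
    let ?P = "\<lambda>l a. \<exists>b. partner a b \<and> l \<le> b \<and> b < L"
    have between: "\<not> ?P l c" if "a < c" "c < l" for c
    proof
      assume "?P l c"
      then obtain b where b: "partner c b" "l \<le> b" "b < L" by blast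
      then have "b \<noteq> l" using partner_backward[OF al] that by auto
      then show False using noncrossing[OF al b(1,3)] that b by auto
    qed
    have below: "?P (Suc l) c \<longleftrightarrow> ?P l c" if "c < a" for c
    proof -
      have "\<not> partner c l" using partner_backward[OF al] that by auto
      then show ?thesis by (metis Suc_leD Suc_leI le_neq_implies_less)
    qed
    have Pa: "?P l a" using al lL by blast
    have Pa': "\<not> ?P (Suc l) a" using partner_unique[OF al] by auto
    have Pl: "\<not> ?P (Suc l) l" using partner_unique[OF m] False by auto
    have s1: "[0..<l] = [0..<a] @ a # [Suc a..<l]"
      using a upt_add_eq_append[of 0 a "l - a"] upt_conv_Cons[of a l] by simp
    have s2: "[0..<Suc l] = [0..<a] @ a # [Suc a..<l] @ [l]" using s1 by simp
    have f1: "filter (?P l) [Suc a..<l] = []" using between by (auto simp: filter_empty_conv Suc_le_eq)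
    have f2: "filter (?P (Suc l)) [Suc a..<l] = []" using between by (auto simp: filter_empty_conv Suc_le_eq dest: less_imp_le)
    have f3: "filter (?P (Suc l)) [0..<a] = filter (?P l) [0..<a]"
      by (rule filter_cong) (use below in auto)
    have "open_steps l = a # open_steps (Suc l)"
      unfolding open_steps_def s2 unfolding s1 filter_append filter.simps f1 f2 f3
      using Pa Pa' Pl by (simp add: f1 f2)
    moreover have "new l \<in> (\<Union>x\<le>l. occ x)" using na old_in[of a] a by (auto intro!: bexI[of _ a])
    ultimately show ?thesis using IH unfolding upt A by (auto simp: upd[of l] ra na insert_absorb)
  qed
qed

end

section \<open>Counting runs\<close>

text \<open>Counts the noncrossing pairings of equal letters, the letters in \<open>st\<close> being already open.\<close>

fun pairings :: "nat list \<Rightarrow> nat list \<Rightarrow> nat" where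
  "pairings [] st = (if st = [] then 1 else 0)"
| "pairings (i # w) st = pairings w (i # st) +
     (case st of [] \<Rightarrow> 0 | j # st' \<Rightarrow> if i = j then pairings w st' else 0)"

text \<open>The falling factorial \<open>m (m - 1) \<dots> (m - p + 1)\<close>.\<close>

definition falling :: "nat \<Rightarrow> nat \<Rightarrow> nat" where "falling m p = (\<Prod>i<p. m - i)"

lemma falling_0 [simp]: "falling m 0 = 1" by (simp add: falling_def)
lemma falling_Suc: "falling m (Suc p) = m * falling (m - 1) p"
  unfolding falling_def prod.lessThan_Suc_shift by simp

lemma runs_short: "length w < length st \<Longrightarrow> runs N w st x A = {} \<and> pairings w (map fst st) = 0"
proof (induction w arbitrary: st x A)
  case (Cons i w)
  then have l1: "length w < length ((i, x i) # st)" by simp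
  show ?case
  proof (cases st)
    case (Cons e st')
    then have "length w < length st'" using Cons.prems by simp
    then show ?thesis using Cons.IH[of "(i, _) # st"] Cons.IH[of st'] l1 Cons by (cases e) auto
  qed (use Cons in simp)
qed auto

lemma runs_Cons_cases:
  assumes "vs \<in> runs N (i # w) st x A"
  obtains (push) v vs' where "v \<in> N - A" "vs' \<in> runs N w ((i, x i) # st) (x(i := v)) (insert v A)" "vs = v # vs'"
    | (pop) u st' vs' where "st = (i, u) # st'" "vs' \<in> runs N w st' (x(i := u)) A" "vs = u # vs'"
proof (cases "vs \<in> (\<Union>v\<in>N - A. (#) v ` runs N w ((i, x i) # st) (x(i := v)) (insert v A))")
  case True
  then show thesis using push by blast
next
  case False
  then have "vs \<in> (case st of [] \<Rightarrow> {} | (j, u) # st' \<Rightarrow> if i = j then (#) u ` runs N w st' (x(i := u)) A else {})"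
    using assms unfolding runs.simps by blast
  then show thesis using pop by (cases st) (auto split: if_splits)
qed

lemma runs_length: "vs \<in> runs N w st x A \<Longrightarrow> length vs = length w"
proof (induction w arbitrary: st x A vs)
  case (Cons i w)
  from Cons.prems show ?case by (cases rule: runs_Cons_cases) (auto dest: Cons.IH)
qed (auto split: if_splits)

lemma runs_subset: "vs \<in> runs N w st x A \<Longrightarrow> snd ` set st \<subseteq> N \<Longrightarrow> (\<And>i. i \<in> set w \<Longrightarrow> x i \<in> N) \<Longrightarrow> set vs \<subseteq> N"
proof (induction w arbitrary: st x A vs)
  case (Cons i w)
  from Cons.prems(1) show ?case
  proof (cases rule: runs_Cons_cases)
    case (push v vs')
    note v = push
    have "set vs' \<subseteq> N" by (rule Cons.IH[OF v(2)]) (use Cons.prems v in auto)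
    then show ?thesis using v by simp
  next
    case (pop u st' vs')
    note v = pop
    have "set vs' \<subseteq> N" by (rule Cons.IH[OF v(2)]) (use Cons.prems v in auto)
    then show ?thesis using v Cons.prems by simp
  qed
qed (auto split: if_splits)

lemma finite_runs: "finite N \<Longrightarrow> finite (runs N w st x A)"
  by (induction w arbitrary: st x A) (auto split: list.splits)

text \<open>The shape of a run, which tells the pushes from the pops, and the fresh vertices of its \<open>p\<close> pushes
  are independent of each other.\<close>

lemma card_runs:
  assumes "finite N"
  shows "A \<subseteq> N \<Longrightarrow> snd ` set st \<subseteq> A \<Longrightarrow> (\<And>i. i \<in> set w \<Longrightarrow> x i \<in> A) \<Longrightarrow> length w = length st + 2 * p \<Longrightarrow>
    card (runs N w st x A) = pairings w (map fst st) * falling (card N - card A) p"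
proof (induction w arbitrary: st x A p)
  case (Cons i w)
  define P where "P v = runs N w ((i, x i) # st) (x(i := v)) (insert v A)" for v
  define Q where "Q = (case st of [] \<Rightarrow> {} | (j, u) # st' \<Rightarrow> if i = j then (#) u ` runs N w st' (x(i := u)) A else {})"
  have fA: "finite A" using Cons.prems assms finite_subset by blast
  have finP: "finite (P v)" for v using finite_runs[OF assms] by (simp add: P_def)
  have finQ: "finite Q" using finite_runs[OF assms] by (auto simp: Q_def split: list.splits)
  have cP: "card (\<Union>v\<in>N - A. (#) v ` P v) = pairings w (i # map fst st) * falling (card N - card A) p"
  proof (cases p)
    case 0
    then have "length w < length ((i, y) # st)" for y using Cons.prems(4) by simp
    then have "P v = {}" "pairings w (map fst ((i, x i) # st)) = 0" for v unfolding P_def using runs_short by blast+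
    then show ?thesis by simp
  next
    case (Suc q)
    have cPv: "card (P v) = pairings w (i # map fst st) * falling (card N - card A - 1) q" if v: "v \<in> N - A" for v
    proof -
      have "card (P v) = pairings w (map fst ((i, x i) # st)) * falling (card N - card (insert v A)) q"
        unfolding P_def by (rule Cons.IH) (use Cons.prems v Suc in auto)
      then show ?thesis using v fA by simp
    qed
    have "card (\<Union>v\<in>N - A. (#) v ` P v) = (\<Sum>v\<in>N - A. card ((#) v ` P v))"
      by (rule card_UN_disjoint) (use assms finP in auto)
    also have "\<dots> = (\<Sum>v\<in>N - A. pairings w (i # map fst st) * falling (card N - card A - 1) q)"
      by (rule sum.cong) (use cPv in \<open>auto simp: card_image\<close>)
    also have "\<dots> = pairings w (i # map fst st) * falling (card N - card A) p"
      using Cons.prems(1) fA by (simp add: card_Diff_subset Suc falling_Suc)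
    finally show ?thesis .
  qed
  have cQ: "card Q = (case map fst st of [] \<Rightarrow> 0 | j # st' \<Rightarrow> if i = j then pairings w st' else 0) * falling (card N - card A) p"
  proof (cases st)
    case Nil then show ?thesis by (simp add: Q_def)
  next
    case (Cons e st')
    obtain j u where e: "e = (j, u)" by (cases e)
    show ?thesis
    proof (cases "i = j")
      case True
      have "card (runs N w st' (x(i := u)) A) = pairings w (map fst st') * falling (card N - card A) p"
        by (rule Cons.IH) (use Cons.prems \<open>st = e # st'\<close> e in auto)
      then show ?thesis using \<open>st = e # st'\<close> e True by (simp add: Q_def card_image)
    qed (use \<open>st = e # st'\<close> e in \<open>simp add: Q_def\<close>)
  qed
  have disj: "(\<Union>v\<in>N - A. (#) v ` P v) \<inter> Q = {}"
    using Cons.prems(2) by (auto simp: Q_def split: list.splits if_splits)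
  have "runs N (i # w) st x A = (\<Union>v\<in>N - A. (#) v ` P v) \<union> Q" by (simp add: P_def Q_def)
  then have "card (runs N (i # w) st x A) = card (\<Union>v\<in>N - A. (#) v ` P v) + card Q"
    using card_Un_disjoint[OF _ finQ disj] assms finP by auto
  then show ?case unfolding cP cQ by (simp add: algebra_simps)
qed auto

section \<open>The weight of a run\<close>

fun unwind :: "(nat \<times> 'v) list \<Rightarrow> (nat \<Rightarrow> 'v) \<Rightarrow> nat \<Rightarrow> 'v" where
  "unwind [] x = x" | "unwind ((i, u) # st) x = unwind st (x(i := u))"

text \<open>The weight of the steps that pop the whole stack from state \<open>x\<close>.\<close>

fun unwind_weight :: "('v \<Rightarrow> 'v \<Rightarrow> real) \<Rightarrow> (nat \<times> 'v) list \<Rightarrow> (nat \<Rightarrow> 'v) \<Rightarrow> real" where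
  "unwind_weight \<theta> [] x = 1"
| "unwind_weight \<theta> ((i, u) # st) x = gauge_weight \<theta> i x (x(i := u)) * unwind_weight \<theta> st (x(i := u))"

lemma gauge_weight_sym: "sign_kernel \<theta> \<Longrightarrow> gauge_weight \<theta> i x y = gauge_weight \<theta> i y x"
  by (simp add: gauge_weight_def sign_kernelD(1)[of \<theta> "x i" "y i"])

lemma gauge_weight_square: assumes "sign_kernel \<theta>" shows "gauge_weight \<theta> i x y * gauge_weight \<theta> i x y = 1"
proof -
  have "gauge_weight \<theta> i x y = 1 \<or> gauge_weight \<theta> i x y = -1"
    using sign_kernelD(3)[OF assms, of "x i" "y i"] sign_kernelD(3)[OF assms, of "x (i - 1)" "x i"]
      sign_kernelD(3)[OF assms, of "y (i - 1)" "y i"] unfolding gauge_weight_def by auto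
  then show ?thesis by auto
qed

text \<open>A push and its pop exchange the same pair of vertices in states that agree elsewhere, so their
  weights cancel. What remains is the emptying of the initial stack.\<close>

lemma runs_weight:
  assumes \<theta>: "sign_kernel \<theta>"
  shows "vs \<in> runs N w st (s 0) A \<Longrightarrow> (\<And>l. l < length w \<Longrightarrow> s (Suc l) = (s l)(w ! l := vs ! l)) \<Longrightarrow>
    (\<Prod>l<length w. gauge_weight \<theta> (w ! l) (s l) (s (Suc l))) = unwind_weight \<theta> st (s 0) \<and> s (length w) = unwind st (s 0)"
proof (induction w arbitrary: st s A vs)
  case (Cons i w)
  define s' where "s' l = s (Suc l)" for l
  have shift: "(\<Prod>l<length (i # w). gauge_weight \<theta> ((i # w) ! l) (s l) (s (Suc l)))
     = gauge_weight \<theta> i (s 0) (s' 0) * (\<Prod>l<length w. gauge_weight \<theta> (w ! l) (s' l) (s' (Suc l)))"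
    unfolding length_Cons prod.lessThan_Suc_shift by (simp add: s'_def)
  from Cons.prems(1) show ?case
  proof (cases rule: runs_Cons_cases)
    case (push v vs')
    note v = push
    have s'0: "s' 0 = (s 0)(i := v)" using Cons.prems(2)[of 0] v by (auto simp: s'_def fun_eq_iff)
    have st': "\<And>l. l < length w \<Longrightarrow> s' (Suc l) = (s' l)(w ! l := vs' ! l)"
      using Cons.prems(2)[of "Suc l" for l] v by (auto simp: s'_def fun_eq_iff)
    have IH: "(\<Prod>l<length w. gauge_weight \<theta> (w ! l) (s' l) (s' (Suc l))) = unwind_weight \<theta> ((i, s 0 i) # st) (s' 0) \<and>
       s' (length w) = unwind ((i, s 0 i) # st) (s' 0)"
    proof (rule Cons.IH)
      show "vs' \<in> runs N w ((i, s 0 i) # st) (s' 0) (insert v A)" unfolding s'0 by (rule v(2))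
    qed (rule st')
    have undo: "(s' 0)(i := s 0 i) = s 0" by (simp add: s'0)
    show ?thesis unfolding shift using IH gauge_weight_sym[OF \<theta>, of i "s 0" "s' 0"] gauge_weight_square[OF \<theta>, of i "s 0" "s' 0"]
      by (simp add: undo mult.assoc[symmetric]) (simp add: s'_def)
  next
    case (pop u st1 vs')
    note v = pop
    have s'0: "s' 0 = (s 0)(i := u)" using Cons.prems(2)[of 0] v by (auto simp: s'_def fun_eq_iff)
    have st': "\<And>l. l < length w \<Longrightarrow> s' (Suc l) = (s' l)(w ! l := vs' ! l)"
      using Cons.prems(2)[of "Suc l" for l] v by (auto simp: s'_def fun_eq_iff)
    have IH: "(\<Prod>l<length w. gauge_weight \<theta> (w ! l) (s' l) (s' (Suc l))) = unwind_weight \<theta> st1 (s' 0) \<and>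
       s' (length w) = unwind st1 (s' 0)"
    proof (rule Cons.IH)
      show "vs' \<in> runs N w st1 (s' 0) A" unfolding s'0 by (rule v(2))
    qed (rule st')
    show ?thesis unfolding shift using IH by (simp add: v s'0) (simp add: s'_def)
  qed
qed (auto split: if_splits)

text \<open>A fresh vertex gets the row into which it is put, and popping returns a vertex to the row it came
  from. So one map \<open>r'\<close> describes the rows of all vertices throughout the run.\<close>

lemma runs_rows:
  fixes r :: "'v \<Rightarrow> nat"
  shows "vs \<in> runs N w st (s 0) A \<Longrightarrow> (\<And>l. l < length w \<Longrightarrow> s (Suc l) = (s l)(w ! l := vs ! l)) \<Longrightarrow> set w \<subseteq> {..<R} \<Longrightarrow>
   (\<And>i. i < R \<Longrightarrow> s 0 i \<in> A \<and> r (s 0 i) = i) \<Longrightarrow>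
   (\<And>i u. (i, u) \<in> set st \<Longrightarrow> u \<in> A \<and> r u = i \<and> u \<noteq> s 0 i) \<Longrightarrow> distinct (map snd st) \<Longrightarrow>
   \<exists>r'. (\<forall>v\<in>A. r' v = r v) \<and> (\<forall>l\<le>length w. \<forall>i<R. r' (s l i) = i) \<and> (\<forall>l<length w. s (Suc l) (w ! l) \<noteq> s l (w ! l))"
proof (induction w arbitrary: st s A vs r)
  case (Cons i w)
  note prem_run = Cons.prems(1) and prem_step = Cons.prems(2) and prem_w = Cons.prems(3)
    and prem_row = Cons.prems(4) and prem_st = Cons.prems(5) and prem_dist = Cons.prems(6)
  define s' where "s' l = s (Suc l)" for l
  have iR: "i < R" using prem_w by simp
  have conclude: ?case if "\<exists>r'. (\<forall>v\<in>B. r' v = q v) \<and> (\<forall>l\<le>length w. \<forall>i<R. r' (s' l i) = i) \<and> (\<forall>l<length w. s' (Suc l) (w ! l) \<noteq> s' l (w ! l))"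
    "A \<subseteq> B" "\<And>v. v \<in> A \<Longrightarrow> q v = r v" "s' 0 i \<noteq> s 0 i" for B q
  proof -
    from that(1) obtain r' where r': "\<And>v. v \<in> B \<Longrightarrow> r' v = q v" "\<And>l j. l \<le> length w \<Longrightarrow> j < R \<Longrightarrow> r' (s' l j) = j"
      "\<And>l. l < length w \<Longrightarrow> s' (Suc l) (w ! l) \<noteq> s' l (w ! l)" by blast
    have A: "r' v = r v" if "v \<in> A" for v using r'(1)[of v] \<open>A \<subseteq> B\<close> that \<open>\<And>v. v \<in> A \<Longrightarrow> q v = r v\<close>[OF that] by auto
    have B: "r' (s l j) = j" if "l \<le> length (i # w)" "j < R" for l j
    proof (cases l)
      case 0 then show ?thesis using A prem_row[OF that(2)] by simp
    next
      case (Suc l') then show ?thesis using r'(2)[of l' j] that by (simp add: s'_def)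
    qed
    have C: "s (Suc l) ((i # w) ! l) \<noteq> s l ((i # w) ! l)" if "l < length (i # w)" for l
    proof (cases l)
      case 0 then show ?thesis using \<open>s' 0 i \<noteq> s 0 i\<close> by (simp add: s'_def)
    next
      case (Suc l') then show ?thesis using r'(3)[of l'] that by (simp add: s'_def)
    qed
    show ?case using A B C by blast
  qed
  from prem_run show ?case
  proof (cases rule: runs_Cons_cases)
    case (push v vs')
    note v = push
    have s'0: "s' 0 = (s 0)(i := v)" using prem_step[of 0] v by (auto simp: s'_def fun_eq_iff)
    have st': "\<And>l. l < length w \<Longrightarrow> s' (Suc l) = (s' l)(w ! l := vs' ! l)"
      using prem_step[of "Suc l" for l] v by (auto simp: s'_def fun_eq_iff)
    have si: "s 0 i \<in> A" "r (s 0 i) = i" using prem_row iR by auto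
    have vA: "v \<notin> A" using v by simp
    have "\<exists>r'. (\<forall>v'\<in>insert v A. r' v' = (r(v := i)) v') \<and> (\<forall>l\<le>length w. \<forall>i<R. r' (s' l i) = i) \<and> (\<forall>l<length w. s' (Suc l) (w ! l) \<noteq> s' l (w ! l))"
    proof (rule Cons.IH)
      show "vs' \<in> runs N w ((i, s 0 i) # st) (s' 0) (insert v A)" unfolding s'0 by (rule v(2))
      show "s' (Suc l) = (s' l)(w ! l := vs' ! l)" if "l < length w" for l using st' that .
      show "set w \<subseteq> {..<R}" using prem_w by simp
      show "s' 0 j \<in> insert v A \<and> (r(v := i)) (s' 0 j) = j" if "j < R" for j
        using prem_row[OF that] vA by (auto simp: s'0)
      show "u \<in> insert v A \<and> (r(v := i)) u = j \<and> u \<noteq> s' 0 j" if "(j, u) \<in> set ((i, s 0 i) # st)" for j u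
      proof (cases "(j, u) = (i, s 0 i)")
        case True then show ?thesis using si vA by (auto simp: s'0)
      next
        case False
        then have "(j, u) \<in> set st" using that by auto
        then show ?thesis using prem_st[of j u] vA by (auto simp: s'0)
      qed
      have "s 0 i \<notin> snd ` set st"
      proof
        assume "s 0 i \<in> snd ` set st"
        then obtain j where "(j, s 0 i) \<in> set st" by auto
        then show False using prem_st[of j "s 0 i"] si by auto
      qed
      then show "distinct (map snd ((i, s 0 i) # st))" using prem_dist by simp
    qed
    then show ?thesis by (rule conclude) (use vA si s'0 in auto)
  next
    case (pop u st1 vs')
    note v = pop
    have s'0: "s' 0 = (s 0)(i := u)" using prem_step[of 0] v by (auto simp: s'_def fun_eq_iff)
    have st': "\<And>l. l < length w \<Longrightarrow> s' (Suc l) = (s' l)(w ! l := vs' ! l)"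
      using prem_step[of "Suc l" for l] v by (auto simp: s'_def fun_eq_iff)
    have u: "u \<in> A" "r u = i" "u \<noteq> s 0 i" using prem_st[of i u] v by auto
    have "\<exists>r'. (\<forall>v'\<in>A. r' v' = r v') \<and> (\<forall>l\<le>length w. \<forall>i<R. r' (s' l i) = i) \<and> (\<forall>l<length w. s' (Suc l) (w ! l) \<noteq> s' l (w ! l))"
    proof (rule Cons.IH)
      show "vs' \<in> runs N w st1 (s' 0) A" unfolding s'0 by (rule v(2))
      show "s' (Suc l) = (s' l)(w ! l := vs' ! l)" if "l < length w" for l using st' that .
      show "set w \<subseteq> {..<R}" using prem_w by simp
      show "s' 0 j \<in> A \<and> r (s' 0 j) = j" if "j < R" for j
        using prem_row[OF that] u by (auto simp: s'0)
      show "u' \<in> A \<and> r u' = j \<and> u' \<noteq> s' 0 j" if "(j, u') \<in> set st1" for j u'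
      proof -
        have "u' \<noteq> u" using that prem_dist v by (auto simp: image_iff)
        then show ?thesis using prem_st[of j u'] that v by (auto simp: s'0)
      qed
      show "distinct (map snd st1)" using prem_dist v by simp
    qed
    then show ?thesis by (rule conclude) (use u s'0 in auto)
  qed
qed auto

section \<open>Pairs of walks sharing an edge\<close>

text \<open>The counting argument for walks in a form that fits two walks run one after the other. Each step
  adds at most one vertex and drops at most one. A step that neither opens nor closes a vertex,
  counted in \<open>Z\<close>, improves the bound.\<close>

lemma card_Un_walk_le:
  fixes T :: "nat \<Rightarrow> 'v set"
  assumes fin: "\<And>m. finite (T m)"
    and grow: "\<And>m. m < M \<Longrightarrow> T (Suc m) \<subseteq> insert (v m) (T m)"
    and shrink: "\<And>m. m < M \<Longrightarrow> T m \<subseteq> insert (u m) (T (Suc m))"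
    and rep: "\<And>m. m < M \<Longrightarrow> (\<exists>i\<le>m. v m \<in> T i) \<or> (\<exists>i. m < i \<and> i \<le> M \<and> u m \<in> T i)"
    and Z: "Z \<subseteq> {..<M}" "\<And>m. m \<in> Z \<Longrightarrow> (\<exists>i\<le>m. v m \<in> T i) \<and> (\<exists>i. m < i \<and> i \<le> M \<and> u m \<in> T i)"
  shows "2 * card (\<Union>m\<le>M. T m) + card Z \<le> card (T 0) + card (T M) + M"
proof -
  define a where "a m = card (T (Suc m) - (\<Union>i\<le>m. T i))" for m
  define b where "b m = card (T m - (\<Union>i\<in>{m<..M}. T i))" for m
  have a: "a m \<le> (if \<exists>i\<le>m. v m \<in> T i then 0 else 1)" if "m < M" for m
  proof -
    have sub: "T (Suc m) - (\<Union>i\<le>m. T i) \<subseteq> {v m} - (\<Union>i\<le>m. T i)" using grow[OF that] by auto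
    show ?thesis
    proof (cases "\<exists>i\<le>m. v m \<in> T i")
      case True
      then have "T (Suc m) - (\<Union>i\<le>m. T i) = {}" using sub by auto
      then have "a m = 0" unfolding a_def by (metis card.empty)
      then show ?thesis by simp
    next
      case False
      have "a m \<le> card {v m}" unfolding a_def by (rule card_mono) (use sub in auto)
      then show ?thesis using False by auto
    qed
  qed
  have b: "b m \<le> (if \<exists>i. m < i \<and> i \<le> M \<and> u m \<in> T i then 0 else 1)" if "m < M" for m
  proof -
    have sub: "T m - (\<Union>i\<in>{m<..M}. T i) \<subseteq> {u m} - (\<Union>i\<in>{m<..M}. T i)"
    proof
      fix x assume x: "x \<in> T m - (\<Union>i\<in>{m<..M}. T i)"
      moreover have "Suc m \<in> {m<..M}" using that by simp
      ultimately show "x \<in> {u m} - (\<Union>i\<in>{m<..M}. T i)" using shrink[OF that] by blast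
    qed
    show ?thesis
    proof (cases "\<exists>i. m < i \<and> i \<le> M \<and> u m \<in> T i")
      case True
      then have "T m - (\<Union>i\<in>{m<..M}. T i) = {}" using sub by auto
      then have "b m = 0" unfolding b_def by (metis card.empty)
      then show ?thesis by simp
    next
      case False
      have "b m \<le> card {u m}" unfolding b_def by (rule card_mono) (use sub in auto)
      then show ?thesis using False by auto
    qed
  qed
  have "a m + b m + (if m \<in> Z then 1 else 0) \<le> 1" if "m < M" for m
    using a[OF that] b[OF that] rep[OF that] Z(2)[of m] by (auto split: if_splits)
  then have "(\<Sum>m<M. a m + b m + (if m \<in> Z then 1 else 0)) \<le> (\<Sum>m<M. 1)"
    by (intro sum_mono) auto
  moreover have "(\<Sum>m<M. if m \<in> Z then 1 else 0) = card Z"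
  proof -
    have "(\<Sum>m<M. if m \<in> Z then 1 else 0) = card ({..<M} \<inter> Z)" by (simp add: sum.inter_restrict[symmetric])
    then show ?thesis using Z(1) by (simp add: Int_absorb1)
  qed
  ultimately have "(\<Sum>m<M. a m) + (\<Sum>m<M. b m) + card Z \<le> M" by (simp add: sum.distrib)
  moreover have "card (\<Union>m\<le>M. T m) = card (T 0) + (\<Sum>m<M. a m)"
    unfolding a_def by (rule card_Un_by_first_occurrence[OF fin])
  moreover have "card (\<Union>m\<le>M. T m) = card (T M) + (\<Sum>m<M. b m)"
    unfolding b_def by (rule card_Un_by_last_occurrence[OF fin])
  ultimately show ?thesis by linarith
qed

text \<open>Two walks whose steps are repeated when both walks are taken together.\<close>

locale walk_pair =
  W1: closed_walk s1 \<sigma>1 R L + W2: closed_walk s2 \<sigma>2 R L for s1 s2 :: "nat \<Rightarrow> nat \<Rightarrow> 'v" and \<sigma>1 \<sigma>2 R L +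
  assumes repeat1: "\<exists>l'. {W1.old l, W1.new l} \<subseteq> W1.occ l' \<or> (l' mod L \<noteq> l mod L \<and> {W1.old l', W1.new l'} = {W1.old l, W1.new l})
      \<or> {W1.old l, W1.new l} \<subseteq> W2.occ l' \<or> {W2.old l', W2.new l'} = {W1.old l, W1.new l}"
    and repeat2: "\<exists>l'. {W2.old l, W2.new l} \<subseteq> W2.occ l' \<or> (l' mod L \<noteq> l mod L \<and> {W2.old l', W2.new l'} = {W2.old l, W2.new l})
      \<or> {W2.old l, W2.new l} \<subseteq> W1.occ l' \<or> {W1.old l', W1.new l'} = {W2.old l, W2.new l}"
begin

lemma pair_swap: "walk_pair s2 s1 \<sigma>2 \<sigma>1 R L"
  by unfold_locales (use repeat1 repeat2 in blast)+

text \<open>At the junction, where the first walk starts, the set \<open>Z\<close> allows one to gain from a first step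
  whose new vertex has been seen in the second walk.\<close>

lemma card_pair_verts:
  assumes Z: "Z \<subseteq> {L}" "L \<in> Z \<Longrightarrow> W1.new b1 \<in> W2.verts"
  shows "2 * card (W1.verts \<union> W2.verts) + card Z \<le> 2 * card (W1.occ b1 \<union> W2.occ b2) + 2 * L"
proof -
  \<comment> \<open>First let the second walk run once around while the first one rests, then the first one.\<close>
  define T where "T m = (if m \<le> L then W1.occ b1 \<union> W2.occ (b2 + m) else W1.occ (b1 + (m - L)) \<union> W2.occ b2)" for m
  define u where "u m = (if m < L then W2.old (b2 + m) else W1.old (b1 + (m - L)))" for m
  define v where "v m = (if m < L then W2.new (b2 + m) else W1.new (b1 + (m - L)))" for m
  have T2: "T m = W1.occ (b1 + (m - L)) \<union> W2.occ b2" if "L \<le> m" for m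
    using that by (cases "m = L") (auto simp: T_def)
  have T1: "T m = W1.occ b1 \<union> W2.occ (b2 + m)" if "m \<le> L" for m using that by (simp add: T_def)
  have fin: "finite (T m)" for m by (simp add: T_def)
  have U: "(\<Union>m\<le>2*L. T m) = W1.verts \<union> W2.verts"
  proof
    show "(\<Union>m\<le>2*L. T m) \<subseteq> W1.verts \<union> W2.verts" by (auto simp: T_def W1.verts_def W2.verts_def split: if_splits)
    show "W1.verts \<union> W2.verts \<subseteq> (\<Union>m\<le>2*L. T m)"
    proof
      fix x assume "x \<in> W1.verts \<union> W2.verts"
      then consider m where "m \<le> L" "x \<in> W1.occ (b1 + m)" | m where "m \<le> L" "x \<in> W2.occ (b2 + m)"
        using W1.verts_window[of b1] W2.verts_window[of b2] by auto
      then show "x \<in> (\<Union>m\<le>2*L. T m)"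
      proof cases
        case 1 then show ?thesis by (intro UN_I[of "L + m"]) (auto simp: T2)
      next
        case 2 then show ?thesis by (intro UN_I[of m]) (auto simp: T1)
      qed
    qed
  qed
  have grow: "T (Suc m) \<subseteq> insert (v m) (T m)" for m
  proof (cases "m < L")
    case True
    then show ?thesis using W2.occ_Suc[of "b2 + m"] by (auto simp: T1 v_def)
  next
    case False
    then have "Suc m - L = Suc (m - L)" by simp
    then show ?thesis using False W1.occ_Suc[of "b1 + (m - L)"] by (auto simp: T2 v_def)
  qed
  have shrink: "T m \<subseteq> insert (u m) (T (Suc m))" for m
  proof (cases "m < L")
    case True
    then show ?thesis using W2.occ_Suc[of "b2 + m"] by (auto simp: T1 u_def)
  next
    case False
    then have "Suc m - L = Suc (m - L)" by simp
    then show ?thesis using False W1.occ_Suc[of "b1 + (m - L)"] by (auto simp: T2 u_def)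
  qed
  have sep: "(\<exists>i\<le>m. v m \<in> T i) \<or> (\<exists>i. m < i \<and> i \<le> 2*L \<and> u m \<in> T i)"
    if "{u m, v m} \<subseteq> T i \<union> T i'" "i \<le> 2*L" "i' \<le> 2*L" "(i \<le> m \<and> i' \<le> m) \<or> (m < i \<and> m < i')" for m i i'
    using that by auto
  have rep: "(\<exists>i\<le>m. v m \<in> T i) \<or> (\<exists>i. m < i \<and> i \<le> 2*L \<and> u m \<in> T i)" if m: "m < 2*L" for m
  proof -
    have occ1: ?thesis if "{u m, v m} \<subseteq> W1.occ l'" for l'
    proof -
      obtain l where l: "b1 \<le> l" "l < b1 + L" "l mod L = l' mod L" by (rule W1.window_repr)
      have "{u m, v m} \<subseteq> T (L + (l - b1))" using that l W1.occ_mod[OF l(3)] by (auto simp: T2)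
      then show ?thesis using sep[of m "L + (l - b1)" "L + (l - b1)"] l by fastforce
    qed
    have occ2: ?thesis if "{u m, v m} \<subseteq> W2.occ l'" for l'
    proof -
      obtain l where l: "b2 \<le> l" "l < b2 + L" "l mod L = l' mod L" by (rule W2.window_repr)
      have "{u m, v m} \<subseteq> T (l - b2)" using that l W2.occ_mod[OF l(3)] by (auto simp: T1)
      then show ?thesis using sep[of m "l - b2" "l - b2"] l by fastforce
    qed
    have stp1: ?thesis if h: "{W1.old l', W1.new l'} = {u m, v m}" "m < L \<or> l' mod L \<noteq> (b1 + (m - L)) mod L" for l'
    proof -
      obtain l where l: "b1 \<le> l" "l < b1 + L" "l mod L = l' mod L" by (rule W1.window_repr)
      define i where "i = L + (l - b1)"
      have "W1.old l' \<in> T i" "W1.new l' \<in> T (Suc i)"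
        using W1.old_in[of l] W1.new_in[of l] l W1.old_mod[OF l(3)] W1.new_mod[OF l(3)]
        by (auto simp: T2 i_def Suc_diff_le)
      then have "{u m, v m} \<subseteq> T i \<union> T (Suc i)" unfolding h(1)[symmetric] by auto
      moreover have "i \<noteq> m" using h(2) l by (auto simp: i_def)
      moreover have "Suc i \<le> 2 * L" using l by (simp add: i_def)
      ultimately show ?thesis by (intro sep[of m i "Suc i"]) auto
    qed
    have stp2: ?thesis if h: "{W2.old l', W2.new l'} = {u m, v m}" "L \<le> m \<or> l' mod L \<noteq> (b2 + m) mod L" for l'
    proof -
      obtain l where l: "b2 \<le> l" "l < b2 + L" "l mod L = l' mod L" by (rule W2.window_repr)
      define i where "i = l - b2"
      have "W2.old l' \<in> T i" "W2.new l' \<in> T (Suc i)"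
        using W2.old_in[of l] W2.new_in[of l] l W2.old_mod[OF l(3)] W2.new_mod[OF l(3)]
        by (auto simp: T1 i_def Suc_diff_le)
      then have "{u m, v m} \<subseteq> T i \<union> T (Suc i)" unfolding h(1)[symmetric] by auto
      moreover have "i \<noteq> m" using h(2) l by (auto simp: i_def)
      moreover have "Suc i \<le> 2 * L" using l by (simp add: i_def)
      ultimately show ?thesis by (intro sep[of m i "Suc i"]) auto
    qed
    show ?thesis
    proof (cases "m < L")
      case True
      then have uv: "u m = W2.old (b2 + m)" "v m = W2.new (b2 + m)" by (auto simp: u_def v_def)
      show ?thesis using repeat2[of "b2 + m"] occ1 occ2 stp1 stp2 True unfolding uv[symmetric] by blast
    next
      case False
      then have uv: "u m = W1.old (b1 + (m - L))" "v m = W1.new (b1 + (m - L))" by (auto simp: u_def v_def)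
      have "L \<le> m" using False by simp
      then show ?thesis using repeat1[of "b1 + (m - L)"] occ1 occ2 stp1 stp2 unfolding uv[symmetric] by blast
    qed
  qed
  have "2 * card (\<Union>m\<le>2*L. T m) + card Z \<le> card (T 0) + card (T (2*L)) + 2*L"
  proof (rule card_Un_walk_le[OF fin grow shrink rep])
    show "Z \<subseteq> {..<2*L}" using Z W1.L_pos by auto
    fix m assume mZ: "m \<in> Z"
    then have m: "m = L" using Z by auto
    have vL: "v m \<in> W2.verts" using Z mZ m by (simp add: v_def)
    then obtain i where "i \<le> L" "v m \<in> W2.occ (b2 + i)" using W2.verts_window[of b2] by auto
    then have "\<exists>i\<le>m. v m \<in> T i" using m by (auto simp: T1)
    moreover have "u m \<in> T (2 * L)"
      using W1.old_in[of b1] m by (simp add: T2 u_def)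
    moreover have "m < 2 * L" using m W1.L_pos by simp
    ultimately show "(\<exists>i\<le>m. v m \<in> T i) \<and> (\<exists>i. m < i \<and> i \<le> 2*L \<and> u m \<in> T i)" by blast
  qed auto
  moreover have "T 0 = W1.occ b1 \<union> W2.occ b2" "T (2*L) = W1.occ b1 \<union> W2.occ b2" by (auto simp: T1 T2)
  ultimately show ?thesis unfolding U by simp
qed

text \<open>Starting both walks at a shared vertex saves one vertex of the two initial states, and starting
  the first walk with the shared step saves another half.\<close>

lemma card_pair_verts_sharing_step:
  assumes "{W1.old l, W1.new l} \<subseteq> W2.verts"
  shows "card (W1.verts \<union> W2.verts) \<le> 2 * R + L - 2"
proof -
  obtain b where b: "W1.old l \<in> W2.occ b" using assms by (auto simp: W2.verts_def)
  have R: "0 < R" using W1.row_less[of 0] by simp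
  have "card (W1.occ l \<union> W2.occ b) + card (W1.occ l \<inter> W2.occ b) = R + R"
    using card_Un_Int[of "W1.occ l" "W2.occ b"] by (simp add: W1.card_occ W2.card_occ)
  moreover have "card (W1.occ l \<inter> W2.occ b) \<ge> 1"
    using b W1.old_in[of l] by (simp add: Suc_le_eq card_gt_0_iff) blast
  moreover have "2 * card (W1.verts \<union> W2.verts) + card {L} \<le> 2 * card (W1.occ l \<union> W2.occ b) + 2 * L"
    by (rule card_pair_verts) (use assms in auto)
  ultimately show ?thesis by simp
qed

lemma card_pair_verts_sharing_states:
  assumes "x \<noteq> y" "{x, y} \<subseteq> W1.occ b1" "{x, y} \<subseteq> W2.occ b2"
  shows "card (W1.verts \<union> W2.verts) \<le> 2 * R + L - 2"
proof -
  have "card (W1.occ b1 \<union> W2.occ b2) + card (W1.occ b1 \<inter> W2.occ b2) = R + R"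
    using card_Un_Int[of "W1.occ b1" "W2.occ b2"] by (simp add: W1.card_occ W2.card_occ)
  moreover have "card (W1.occ b1 \<inter> W2.occ b2) \<ge> card {x, y}" by (rule card_mono) (use assms in auto)
  moreover have "2 * card (W1.verts \<union> W2.verts) \<le> 2 * card (W1.occ b1 \<union> W2.occ b2) + 2 * L"
    using card_pair_verts[of "{}" b1 b2] by simp
  ultimately show ?thesis using assms by simp
qed

end

section \<open>Closed walks of triples\<close>

text \<open>The walk \<open>t\<close> of triples, refined so that one coordinate changes at a time. The step from
  \<open>t j\<close> to \<open>t (Suc j)\<close> changes the rows in the order \<open>2, 1, 0\<close> for even \<open>j\<close> and \<open>0, 1, 2\<close> for odd
  \<open>j\<close>; then the two vertices of each cross edge are together in one intermediate state. Rows from 3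
  on hold a dummy value, so that states are functions on the natural numbers.\<close>

definition fine_state :: "(nat \<Rightarrow> nat \<Rightarrow> nat) \<Rightarrow> nat \<Rightarrow> nat \<Rightarrow> nat" where
  "fine_state t l i = (if i < 3 then
     (if (if even (l div 3) then 3 \<le> i + l mod 3 else i < l mod 3) then t (Suc (l div 3)) i else t (l div 3) i) else 0)"

lemma zigzag_row_less: "zigzag_row l < 3"
  by (auto simp: zigzag_row_def intro: le_less_trans[OF diff_le_self])

text \<open>A closed walk of triples alternating between columns (even \<open>j\<close>) and rows (odd \<open>j\<close>) of the graph
  matrix, extended periodically.\<close>

locale triple_walk =
  fixes k :: nat and t :: "nat \<Rightarrow> nat \<Rightarrow> nat"
  assumes k_pos: "0 < k"
    and t_period: "t (j + 2 * k) = t j"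
    and t_inj: "inj_on (t j) {..<3}"
    and t_disjoint: "t j ` {..<3} \<inter> t (Suc j) ` {..<3} = {}"
begin

lemma t_neq: "i < 3 \<Longrightarrow> i' < 3 \<Longrightarrow> t j i \<noteq> t (Suc j) i'"
  using t_disjoint[of j] by blast

lemma fine_block: "q < 3 \<Longrightarrow> i < 3 \<Longrightarrow> fine_state t (3 * j + q) i =
   (if (if even j then 3 \<le> i + q else i < q) then t (Suc j) i else t j i)"
  by (simp add: fine_state_def)

lemma zigzag_row_block: "q < 3 \<Longrightarrow> zigzag_row (3 * j + q) = (if even j then 2 - q else q)"
  by (simp add: zigzag_row_def)

lemma fine_next_block: "i < 3 \<Longrightarrow> fine_state t (3 * j + 3) i = t (Suc j) i"
proof -
  assume i: "i < 3"
  have eq: "3 * j + 3 = 3 * Suc j + 0" by simp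
  show "fine_state t (3 * j + 3) i = t (Suc j) i" unfolding eq by (subst fine_block) (use i in auto)
qed

lemma block_cases: obtains j q where "l = 3 * j + q" "q < (3::nat)"
  using that[of "l div 3" "l mod 3"] by simp

lemma fine_old: "fine_state t l (zigzag_row l) = t (l div 3) (zigzag_row l)"
proof -
  obtain j q where l: "l = 3 * j + q" "q < 3" by (rule block_cases)
  show ?thesis unfolding l(1) zigzag_row_block[OF l(2)] using l(2) by (subst fine_block) auto
qed

lemma fine_new: "fine_state t (Suc l) (zigzag_row l) = t (Suc (l div 3)) (zigzag_row l)"
proof -
  obtain j q where l: "l = 3 * j + q" "q < 3" by (rule block_cases)
  show ?thesis
  proof (cases "q = 2")
    case True
    then have "Suc l = 3 * j + 3" "l div 3 = j" using l by auto
    moreover have "zigzag_row l < 3" by (rule zigzag_row_less)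
    ultimately show ?thesis using fine_next_block[of "zigzag_row l" j] by metis
  next
    case False
    then have "Suc l = 3 * j + Suc q" "Suc q < 3" using l by auto
    moreover have "zigzag_row l = (if even j then 2 - q else q)" "l div 3 = j" using zigzag_row_block l by auto
    ultimately show ?thesis
      using fine_block[of "Suc q" "zigzag_row l" j] l by (cases "even j") auto
  qed
qed

lemma fine_stay: assumes "i < 3" "i \<noteq> zigzag_row l" shows "fine_state t (Suc l) i = fine_state t l i"
proof -
  obtain j q where l: "l = 3 * j + q" "q < 3" by (rule block_cases)
  have z: "zigzag_row l = (if even j then 2 - q else q)" using zigzag_row_block l by simp
  show ?thesis
  proof (cases "q = 2")
    case True
    then have "Suc l = 3 * j + 3" using l by simp
    then have "fine_state t (Suc l) i = t (Suc j) i" using fine_next_block[of i j] assms by metis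
    moreover have "fine_state t l i = t (Suc j) i" using fine_block[of q i j] l z True assms by (auto split: if_splits)
    ultimately show ?thesis by simp
  next
    case False
    then have "Suc l = 3 * j + Suc q" "Suc q < 3" using l by auto
    then show ?thesis using fine_block[of "Suc q" i j] fine_block[of q i j] l z assms
      by (cases "even j") (auto split: if_splits)
  qed
qed

lemma fine_upd: "fine_state t (Suc l) = (fine_state t l)(zigzag_row l := fine_state t (Suc l) (zigzag_row l))"
proof
  fix i
  show "fine_state t (Suc l) i = ((fine_state t l)(zigzag_row l := fine_state t (Suc l) (zigzag_row l))) i"
  proof (cases "i < 3")
    case True then show ?thesis using fine_stay[of i l] by simp
  next
    case False then show ?thesis by (simp add: fine_state_def)
  qed
qed

sublocale W: closed_walk "fine_state t" zigzag_row 3 "6 * k"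
proof
  show "0 < 6 * k" using k_pos by simp
  have d: "(l + 6 * k) div 3 = l div 3 + 2 * k" "(l + 6 * k) mod 3 = l mod 3" for l by presburger+
  show "fine_state t (l + 6 * k) = fine_state t l" for l
    using t_period[of "l div 3"] t_period[of "Suc (l div 3)"] by (auto simp: fine_state_def d fun_eq_iff)
  show "zigzag_row (l + 6 * k) = zigzag_row l" for l by (simp add: zigzag_row_def d)
  show z3: "zigzag_row l < 3" for l by (rule zigzag_row_less)
  show "fine_state t (Suc l) i = fine_state t l i" if "i < 3" "i \<noteq> zigzag_row l" for i l using fine_stay that .
  show "inj_on (fine_state t l) {..<3}" for l
  proof
    fix i i' assume ii: "i \<in> {..<3}" "i' \<in> {..<3}" and eq: "fine_state t l i = fine_state t l i'"
    have n1: "t (l div 3) a \<noteq> t (Suc (l div 3)) b" if "a < 3" "b < 3" for a b using t_neq that .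
    have val: "fine_state t l a = t (l div 3) a \<or> fine_state t l a = t (Suc (l div 3)) a" if "a < 3" for a
      using that by (simp add: fine_state_def)
    have "i < 3" "i' < 3" using ii by auto
    then consider "t (l div 3) i = t (l div 3) i'" | "t (Suc (l div 3)) i = t (Suc (l div 3)) i'"
      using val[of i] val[of i'] eq n1[of i i'] n1[of i' i] by metis
    then show "i = i'" using ii t_inj[of "l div 3"] t_inj[of "Suc (l div 3)"] by cases (auto dest: inj_onD)
  qed

  show "fine_state t (Suc l) (zigzag_row l) \<noteq> fine_state t l (zigzag_row l)" for l
    unfolding fine_old fine_new using t_neq z3 by metis
qed

text \<open>The five edges of the graph that enter the matrix entry of step \<open>j\<close>: numbers 0, 1, 2 join
  coordinates of equal index, numbers 3 and 4 are the cross edges.\<close>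

definition walk_edge :: "nat \<times> nat \<Rightarrow> nat set" where
  "walk_edge q = (case q of (j, c) \<Rightarrow> if c < 3 then {t j c, t (Suc j) c}
     else if even j then {t j (c - 3), t (Suc j) (Suc (c - 3))} else {t j (Suc (c - 3)), t (Suc j) (c - 3)})"

definition edge_mult :: "nat set \<Rightarrow> nat" where
  "edge_mult e = card {q \<in> {..<2 * k} \<times> {..<5}. walk_edge q = e}"

text \<open>The condition for the product of the matrix entries along the walk to have mean one.\<close>

definition balanced_edges where "balanced_edges \<longleftrightarrow> (\<forall>e. even (edge_mult e))"

lemma step_of_row_edge:
  assumes "j < 2 * k" "c < 3"
  obtains l where "l < 6 * k" "l div 3 = j" "zigzag_row l = c" "{W.old l, W.new l} = walk_edge (j, c)"
proof -
  define l where "l = 3 * j + (if even j then 2 - c else c)"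
  have l: "l div 3 = j" "zigzag_row l = c"
    using assms zigzag_row_block[of "if even j then 2 - c else c" j] by (auto simp: l_def)
  moreover have "l < 6 * k" using assms l(1) by (auto simp: l_def)
  moreover have "{W.old l, W.new l} = walk_edge (j, c)"
    using fine_old[of l] fine_new[of l] l assms by (simp add: W.old_def W.new_def walk_edge_def)
  ultimately show thesis using that by blast
qed

lemma row_edge_of_step: "{W.old l, W.new l} = walk_edge (l mod (6 * k) div 3, zigzag_row l)"
proof -
  let ?l = "l mod (6 * k)"
  have "W.old l = W.old ?l" "W.new l = W.new ?l" by (auto intro!: W.old_mod W.new_mod)
  moreover have "zigzag_row l = zigzag_row ?l" by (rule W.\<sigma>_mod) simp
  ultimately show ?thesis
    using W.row_less[of ?l] by (simp add: W.old_def W.new_def fine_old fine_new walk_edge_def)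
qed

lemma state_of_cross_edge:
  assumes "3 \<le> c" "c < 5"
  obtains l where "walk_edge (j, c) \<subseteq> W.occ l"
proof -
  define i where "i = c - 3"
  have i: "i < 2" "c = i + 3" using assms by (auto simp: i_def)
  define q where "q = (if even j then 2 - i else Suc i)"
  have q: "q < 3" using i by (auto simp: q_def)
  have "fine_state t (3 * j + q) i = (if even j then t j i else t (Suc j) i)"
    using i q by (subst fine_block) (auto simp: q_def)
  moreover have "fine_state t (3 * j + q) (Suc i) = (if even j then t (Suc j) (Suc i) else t j (Suc i))"
    using i q by (subst fine_block) (auto simp: q_def)
  moreover have "fine_state t (3 * j + q) i \<in> W.occ (3 * j + q)" "fine_state t (3 * j + q) (Suc i) \<in> W.occ (3 * j + q)"
    using i by (auto simp: W.occ_def)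
  ultimately have "walk_edge (j, c) \<subseteq> W.occ (3 * j + q)" using i by (auto simp: walk_edge_def split: if_splits)
  then show thesis using that by blast
qed

lemma edge_pos:
  assumes "0 < edge_mult e"
  obtains l where "e \<subseteq> W.occ l" | l where "{W.old l, W.new l} = e"
proof -
  obtain j c where q: "j < 2 * k" "c < 5" "walk_edge (j, c) = e"
    using assms unfolding edge_mult_def by (auto simp: card_gt_0_iff)
  show thesis
  proof (cases "c < 3")
    case True
    then show ?thesis using step_of_row_edge[OF q(1)] q that by metis
  next
    case False
    then show ?thesis using state_of_cross_edge[of c j] q that by force
  qed
qed

lemma edge_subset_verts: assumes "0 < edge_mult e" shows "e \<subseteq> W.verts"
  using assms
proof (cases rule: edge_pos)
  case (1 l) then show ?thesis by (auto simp: W.verts_def)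
next
  case (2 l)
  have "W.old l \<in> W.verts" "W.new l \<in> W.verts" using W.old_in[of l] W.new_in[of l] unfolding W.verts_def by blast+
  then show ?thesis using 2 by auto
qed

lemma edge_pos_of_step: "0 < edge_mult {W.old l, W.new l}"
proof -
  let ?q = "(l mod (6 * k) div 3, zigzag_row l)"
  have "l mod (6 * k) < 6 * k" using k_pos by simp
  then have "l mod (6 * k) div 3 < 2 * k" by (simp add: less_mult_imp_div_less)
  then have "?q \<in> {q \<in> {..<2 * k} \<times> {..<5}. walk_edge q = {W.old l, W.new l}}"
    using row_edge_of_step[of l] W.row_less[of l] by auto
  then show ?thesis unfolding edge_mult_def by (subst card_gt_0_iff) (auto intro: finite_subset[of _ "{..<2 * k} \<times> {..<5}"])
qed

text \<open>A repetition on a row edge is another step of the refined walk, a repetition on a cross edge lies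
  inside one of its states.\<close>

lemma edge_repeats:
  assumes "2 \<le> edge_mult {W.old l, W.new l}"
  shows "\<exists>l'. {W.old l, W.new l} \<subseteq> W.occ l' \<or>
    (l' mod (6 * k) \<noteq> l mod (6 * k) \<and> {W.old l', W.new l'} = {W.old l, W.new l})"
proof -
  let ?q = "(l mod (6 * k) div 3, zigzag_row l)" and ?e = "{W.old l, W.new l}"
  let ?S = "{q \<in> {..<2 * k} \<times> {..<5}. walk_edge q = ?e}"
  have "\<not> ?S \<subseteq> {?q}"
  proof
    assume "?S \<subseteq> {?q}"
    then have "card ?S \<le> card {?q}" by (intro card_mono) auto
    then show False using assms by (simp add: edge_mult_def)
  qed
  then obtain j c where q: "j < 2 * k" "c < 5" "walk_edge (j, c) = ?e" "(j, c) \<noteq> ?q" by auto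
  show ?thesis
  proof (cases "c < 3")
    case True
    obtain l' where l': "l' < 6 * k" "l' div 3 = j" "zigzag_row l' = c" "{W.old l', W.new l'} = walk_edge (j, c)"
      using step_of_row_edge[OF q(1) True] by blast
    have "l' mod (6 * k) \<noteq> l mod (6 * k)"
    proof
      assume h: "l' mod (6 * k) = l mod (6 * k)"
      then have "zigzag_row l' = zigzag_row l" by (rule W.\<sigma>_mod)
      then show False using h l' q by simp
    qed
    then show ?thesis by (metis l'(4) q(3))
  next
    case False
    then obtain l' where "walk_edge (j, c) \<subseteq> W.occ l'" using state_of_cross_edge[of c j] q by auto
    then show ?thesis using q by auto
  qed
qed

lemma repeating: assumes balanced_edges shows "repeating_walk (fine_state t) zigzag_row 3 (6 * k)"
proof
  fix l
  have "even (edge_mult {W.old l, W.new l})" using assms by (simp add: balanced_edges_def)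
  then have "2 \<le> edge_mult {W.old l, W.new l}" using edge_pos_of_step[of l] by (auto elim!: evenE)
  then show "\<exists>l'. {W.old l, W.new l} \<subseteq> W.occ l' \<or>
    (l' mod (6 * k) \<noteq> l mod (6 * k) \<and> {W.old l', W.new l'} = {W.old l, W.new l})" by (rule edge_repeats)
qed

lemma walk_edge_distinct: "j < 2 * k \<Longrightarrow> c < 5 \<Longrightarrow> \<exists>x y. x \<noteq> y \<and> walk_edge (j, c) = {x, y}"
proof -
  assume c: "c < 5"
  show ?thesis
  proof (cases "c < 3")
    case True then show ?thesis using t_neq[of c c j] by (auto simp: walk_edge_def)
  next
    case False
    then have "c - 3 < 3" "Suc (c - 3) < 3" using c by auto
    then have "t j (c - 3) \<noteq> t (Suc j) (Suc (c - 3))" "t j (Suc (c - 3)) \<noteq> t (Suc j) (c - 3)" using t_neq by auto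
    then show ?thesis using False by (cases "even j") (simp_all add: walk_edge_def, blast+)
  qed
qed

text \<open>The matrix entry of step \<open>j\<close> when \<open>\<theta>\<close> gives the signs of the edges.\<close>

definition step_weight :: "(nat \<Rightarrow> nat \<Rightarrow> real) \<Rightarrow> nat \<Rightarrow> real" where
  "step_weight \<theta> j = (\<Prod>c<3. \<theta> (t j c) (t (Suc j) c)) *
     (\<Prod>i<2. if even j then \<theta> (t j i) (t (Suc j) (Suc i)) else \<theta> (t j (Suc i)) (t (Suc j) i))"

text \<open>Within a block, the vertical factors of the two intermediate states are exactly the cross edges;
  those of the full triples appear twice and cancel.\<close>

lemma gauge_product:
  assumes \<theta>: "sign_kernel \<theta>"
  shows "(\<Prod>l<6 * k. gauge_weight \<theta> (zigzag_row l) (fine_state t l) (fine_state t (Suc l))) = (\<Prod>j<2 * k. step_weight \<theta> j)"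
proof -
  let ?g = "\<lambda>l. gauge_weight \<theta> (zigzag_row l) (fine_state t l) (fine_state t (Suc l))"
  \<comment> \<open>The vertical factors of the full triples; each occurs twice around the cycle.\<close>
  define V where "V j = \<theta> (t j 0) (t j 1) * \<theta> (t j 1) (t j 2)" for j
  have V2: "V j * V j = 1" for j
    using sign_kernelD(3)[OF \<theta>, of "t j 0" "t j 1"] sign_kernelD(3)[OF \<theta>, of "t j 1" "t j 2"] by (auto simp: V_def)
  have step: "?g (3 * j) * ?g (3 * j + 1) * ?g (3 * j + 2) = step_weight \<theta> j * (if even j then V j else V (Suc j))" for j
  proof -
    have z: "zigzag_row (3 * j) = (if even j then 2 else 0)" "zigzag_row (3 * j + 1) = 1" "zigzag_row (3 * j + 2) = (if even j then 0 else 2)"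
      using zigzag_row_block[of 0 j] zigzag_row_block[of 1 j] zigzag_row_block[of 2 j] by auto
    define F0 F1 F2 F3 where "F0 = fine_state t (3 * j)" and "F1 = fine_state t (3 * j + 1)" and "F2 = fine_state t (3 * j + 2)" and "F3 = fine_state t (3 * j + 3)"
    have f: "F0 i = t j i" "F1 i = (if if even j then i = 2 else i = 0 then t (Suc j) i else t j i)"
       "F2 i = (if if even j then 1 \<le> i else i < 2 then t (Suc j) i else t j i)" "F3 i = t (Suc j) i" if "i < 3" for i
      unfolding F0_def F1_def F2_def F3_def
      using that fine_block[of 0 i j] fine_block[of 1 i j] fine_block[of 2 i j] fine_next_block[of i j]
      by (cases "even j"; force)+
    have S: "Suc (3 * j) = 3 * j + 1" "Suc (3 * j + 1) = 3 * j + 2" "Suc (3 * j + 2) = 3 * j + 3" by auto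
    have g: "?g (3 * j) = gauge_weight \<theta> (if even j then 2 else 0) F0 F1" "?g (3 * j + 1) = gauge_weight \<theta> 1 F1 F2"
      "?g (3 * j + 2) = gauge_weight \<theta> (if even j then 0 else 2) F2 F3"
      unfolding S z F0_def F1_def F2_def F3_def by simp_all
    have i3: "{..<3} = {0, 1, 2::nat}" "{..<2} = {0, 1::nat}" by auto
    show ?thesis
    proof (cases "even j")
      case True
      have f': "F0 0 = t j 0" "F0 1 = t j 1" "F0 2 = t j 2" "F1 0 = t j 0" "F1 1 = t j 1" "F1 2 = t (Suc j) 2"
        "F2 0 = t j 0" "F2 1 = t (Suc j) 1" "F2 2 = t (Suc j) 2" "F3 0 = t (Suc j) 0" "F3 1 = t (Suc j) 1" "F3 2 = t (Suc j) 2"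
        using True by (simp_all add: f)
      show ?thesis unfolding g using True
        by (simp add: gauge_weight_def step_weight_def V_def i3 f'[unfolded One_nat_def] numeral_2_eq_2[symmetric] mult_ac)
    next
      case False
      have f': "F0 0 = t j 0" "F0 1 = t j 1" "F0 2 = t j 2" "F1 0 = t (Suc j) 0" "F1 1 = t j 1" "F1 2 = t j 2"
        "F2 0 = t (Suc j) 0" "F2 1 = t (Suc j) 1" "F2 2 = t j 2" "F3 0 = t (Suc j) 0" "F3 1 = t (Suc j) 1" "F3 2 = t (Suc j) 2"
        using False by (simp_all add: f)
      show ?thesis unfolding g using False
          sign_kernelD(1)[OF \<theta>, of "t (Suc j) 0" "t j 1"] sign_kernelD(1)[OF \<theta>, of "t (Suc j) 1" "t j 2"]
        by (simp add: gauge_weight_def step_weight_def V_def i3 f'[unfolded One_nat_def] numeral_2_eq_2[symmetric] mult_ac)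
    qed
  qed
  have "(\<Prod>l<6 * k. ?g l) = (\<Prod>j<2 * k. ?g (3 * j) * ?g (3 * j + 1) * ?g (3 * j + 2))"
  proof -
    have "(\<Prod>l<3 * m. ?g l) = (\<Prod>j<m. ?g (3 * j) * ?g (3 * j + 1) * ?g (3 * j + 2))" for m
    proof (induction m)
      case (Suc m)
      have "3 * Suc m = Suc (Suc (Suc (3 * m)))" by simp
      then have "(\<Prod>l<3 * Suc m. ?g l) = (\<Prod>l<3 * m. ?g l) * ?g (3 * m) * ?g (3 * m + 1) * ?g (3 * m + 2)"
        unfolding prod.lessThan_Suc \<open>3 * Suc m = _\<close> by (simp add: numeral_2_eq_2)
      then show ?case unfolding Suc by (simp add: mult.assoc)
    qed simp
    from this[of "2 * k"] show ?thesis by simp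
  qed
  also have "\<dots> = (\<Prod>j<2 * k. step_weight \<theta> j) * (\<Prod>j<2 * k. if even j then V j else V (Suc j))"
    unfolding step by (simp add: prod.distrib)
  also have "(\<Prod>j<2 * k. if even j then V j else V (Suc j)) = 1"
  proof -
    have "(\<Prod>j<2 * m. if even j then V j else V (Suc j)) = V 0 * V (2 * m)" for m
    proof (induction m)
      case (Suc m)
      have "(\<Prod>j<2 * Suc m. if even j then V j else V (Suc j)) = (V 0 * V (2 * m)) * V (2 * m) * V (2 * Suc m)"
        using Suc by simp
      then show ?case using V2[of "2 * m"] by (simp add: mult.assoc)
    qed (simp add: V2)
    moreover have "V (2 * k) = V 0" using t_period[of 0] by (simp add: V_def)
    ultimately show ?thesis using V2 by simp
  qed
  finally show ?thesis by simp
qed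

lemma step_weight_product_edges:
  assumes h: "\<And>a b. h {a, b} = \<theta> a b"
  shows "(\<Prod>j<2 * k. step_weight \<theta> j) = (\<Prod>q\<in>{..<2 * k} \<times> {..<5}. h (walk_edge q))"
proof -
  have "(\<Prod>q\<in>{..<2 * k} \<times> {..<5}. h (walk_edge q)) = (\<Prod>j<2 * k. \<Prod>c<5. h (walk_edge (j, c)))"
    by (simp add: prod.cartesian_product)
  also have "\<dots> = (\<Prod>j<2 * k. step_weight \<theta> j)"
  proof (rule prod.cong)
    fix j assume "j \<in> {..<2 * k}"
    have "{..<5::nat} = {0, 1, 2, 3, 4}" by auto
    then show "(\<Prod>c<5. h (walk_edge (j, c))) = step_weight \<theta> j"
      by (simp add: walk_edge_def h step_weight_def numeral_3_eq_3 numeral_2_eq_2 lessThan_Suc mult_ac)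
  qed simp
  finally show ?thesis by simp
qed

lemma edge_product_by_multiplicity:
  fixes h :: "nat set \<Rightarrow> real"
  shows "(\<Prod>q\<in>{..<2 * k} \<times> {..<5}. h (walk_edge q)) = (\<Prod>e\<in>walk_edge ` ({..<2 * k} \<times> {..<5}). h e ^ edge_mult e)"
proof -
  have "(\<Prod>q\<in>{..<2 * k} \<times> {..<5}. h (walk_edge q)) =
    (\<Prod>e\<in>walk_edge ` ({..<2 * k} \<times> {..<5}). \<Prod>q\<in>{q \<in> {..<2 * k} \<times> {..<5}. walk_edge q = e}. h (walk_edge q))"
    by (rule prod.image_gen) auto
  also have "\<dots> = (\<Prod>e\<in>walk_edge ` ({..<2 * k} \<times> {..<5}). h e ^ edge_mult e)"
    by (rule prod.cong) (auto simp: edge_mult_def)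
  finally show ?thesis .
qed

lemma balanced_product:
  assumes b: balanced_edges and \<theta>: "sign_kernel \<theta>"
  shows "(\<Prod>j<2 * k. step_weight \<theta> j) = 1"
proof -
  define h where "h e = \<theta> (Min e) (Max e)" for e
  have h: "h {a, b} = \<theta> a b" for a b using sign_kernelD(1)[OF \<theta>, of a b]
    by (cases "a \<le> b") (auto simp: h_def min_def max_def)
  have h1: "h e = 1 \<or> h e = -1" for e using sign_kernelD(3)[OF \<theta>] by (simp add: h_def)
  have "h e ^ edge_mult e = 1" for e
  proof -
    have "even (edge_mult e)" using b by (simp add: balanced_edges_def)
    then show ?thesis using h1[of e] by auto
  qed
  then show ?thesis unfolding step_weight_product_edges[of h \<theta>, OF h] edge_product_by_multiplicity by simp
qed

lemma balanced_edgesI: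
  assumes "\<And>\<theta>. sign_kernel \<theta> \<Longrightarrow> (\<Prod>j<2 * k. step_weight \<theta> j) = 1"
  shows balanced_edges
  unfolding balanced_edges_def
proof
  fix e
  show "even (edge_mult e)"
  proof (cases "e \<in> walk_edge ` ({..<2 * k} \<times> {..<5})")
    case False
    then have "{q \<in> {..<2 * k} \<times> {..<5}. walk_edge q = e} = {}" by auto
    then show ?thesis by (simp only: edge_mult_def card.empty) simp
  next
    case True
    \<comment> \<open>The kernel that changes sign on \<open>e\<close> alone detects the parity of the multiplicity of \<open>e\<close>.\<close>
    define \<theta> where "\<theta> a b = (if {a, b} = e then -1 else 1 :: real)" for a b
    have sk: "sign_kernel \<theta>" by (auto simp: sign_kernel_def \<theta>_def insert_commute)
    define h where "h e' = (if e' = e then -1 else 1 :: real)" for e'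
    have "(\<Prod>j<2 * k. step_weight \<theta> j) = (\<Prod>e'\<in>walk_edge ` ({..<2 * k} \<times> {..<5}). h e' ^ edge_mult e')"
      using step_weight_product_edges[of h \<theta>] edge_product_by_multiplicity[of h] by (simp add: h_def \<theta>_def)
    also have "\<dots> = (\<Prod>e'\<in>walk_edge ` ({..<2 * k} \<times> {..<5}). if e' = e then (-1) ^ edge_mult e else 1)"
      by (rule prod.cong) (auto simp: h_def)
    also have "\<dots> = (-1) ^ edge_mult e" using True by (simp add: prod.delta)
    finally have "(-1) ^ edge_mult e = (1::real)" using assms[OF sk] by simp
    then show ?thesis by (metis minus_one_power_iff one_neq_neg_one)
  qed
qed

lemma zigzag_rows_move: "j < 3 \<Longrightarrow> \<exists>c. zigzag_row c = j"
  using zigzag_row_block[of j 1] by (intro exI[of _ "3 * 1 + j"]) simp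

lemma zigzag_walkI:
  assumes b: balanced_edges and tight: "card W.verts = 3 * k + 3"
  shows "zigzag_walk (fine_state t) (6 * k)"
proof -
  interpret RW: repeating_walk "fine_state t" zigzag_row 3 "6 * k" by (rule repeating[OF b])
  show ?thesis
  proof
    show "2 * card W.verts = 2 * 3 + 6 * k" using tight by simp
    show "\<exists>c. zigzag_row c = j" if "j < 3" for j using zigzag_rows_move that .
    show "(\<Prod>l<6 * k. gauge_weight \<theta> (zigzag_row l) (fine_state t l) (fine_state t (Suc l))) = 1" if "sign_kernel \<theta>" for \<theta> :: "nat \<Rightarrow> nat \<Rightarrow> real"
      using gauge_product[OF that] balanced_product[OF b that] by simp
  qed
qed

lemma card_verts_le: assumes balanced_edges shows "card W.verts \<le> 3 * k + 3"
proof -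
  interpret RW: repeating_walk "fine_state t" zigzag_row 3 "6 * k" by (rule repeating[OF assms])
  show ?thesis using RW.card_verts_le by simp
qed

end

text \<open>If one walk is unbalanced, some edge has odd multiplicity in both walks. Either it is a step of one
  of them, or it lies in a state of each; in both cases the walks overlap enough to lose two
  vertices against \<open>2 * (3 * k + 3)\<close>.\<close>

lemma card_triple_walk_pair:
  assumes c1: "triple_walk k t1" and c2: "triple_walk k t2"
    and even: "\<And>e. even (triple_walk.edge_mult k t1 e + triple_walk.edge_mult k t2 e)"
    and nb: "\<not> triple_walk.balanced_edges k t1"
  shows "card (closed_walk.verts (fine_state t1) 3 \<union> closed_walk.verts (fine_state t2) 3) \<le> 6 * k + 4"
proof -
  interpret C1: triple_walk k t1 by fact
  interpret C2: triple_walk k t2 by fact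
  have rep: "\<exists>l'. {C1.W.old l, C1.W.new l} \<subseteq> C1.W.occ l' \<or> (l' mod (6*k) \<noteq> l mod (6*k) \<and> {C1.W.old l', C1.W.new l'} = {C1.W.old l, C1.W.new l})
      \<or> {C1.W.old l, C1.W.new l} \<subseteq> C2.W.occ l' \<or> {C2.W.old l', C2.W.new l'} = {C1.W.old l, C1.W.new l}"
    for l
  proof (cases "2 \<le> C1.edge_mult {C1.W.old l, C1.W.new l}")
    case True then show ?thesis using C1.edge_repeats by blast
  next
    case False
    then have "C1.edge_mult {C1.W.old l, C1.W.new l} = 1" using C1.edge_pos_of_step[of l] by simp
    then have "0 < C2.edge_mult {C1.W.old l, C1.W.new l}" using even[of "{C1.W.old l, C1.W.new l}"] by (auto intro: gr0I)
    then show ?thesis using C2.edge_pos by metis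
  qed
  have rep2: "\<exists>l'. {C2.W.old l, C2.W.new l} \<subseteq> C2.W.occ l' \<or> (l' mod (6*k) \<noteq> l mod (6*k) \<and> {C2.W.old l', C2.W.new l'} = {C2.W.old l, C2.W.new l})
      \<or> {C2.W.old l, C2.W.new l} \<subseteq> C1.W.occ l' \<or> {C1.W.old l', C1.W.new l'} = {C2.W.old l, C2.W.new l}"
    for l
  proof (cases "2 \<le> C2.edge_mult {C2.W.old l, C2.W.new l}")
    case True then show ?thesis using C2.edge_repeats by blast
  next
    case False
    then have "C2.edge_mult {C2.W.old l, C2.W.new l} = 1" using C2.edge_pos_of_step[of l] by simp
    then have "0 < C1.edge_mult {C2.W.old l, C2.W.new l}" using even[of "{C2.W.old l, C2.W.new l}"] by (auto intro: gr0I)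
    then show ?thesis using C1.edge_pos by metis
  qed
  interpret P: walk_pair "fine_state t1" "fine_state t2" zigzag_row zigzag_row 3 "6 * k"
    by unfold_locales (fact rep, fact rep2)
  interpret Q: walk_pair "fine_state t2" "fine_state t1" zigzag_row zigzag_row 3 "6 * k"
    by (rule P.pair_swap)
  obtain e where e: "odd (C1.edge_mult e)" using nb by (auto simp: C1.balanced_edges_def)
  then have p: "0 < C1.edge_mult e" "0 < C2.edge_mult e" using even[of e] by (auto intro: gr0I)
  have sub: "e \<subseteq> C1.W.verts" "e \<subseteq> C2.W.verts"
    using C1.edge_subset_verts[OF p(1)] C2.edge_subset_verts[OF p(2)] by auto
  obtain j c where jc: "j < 2 * k" "c < 5" "C1.walk_edge (j, c) = e"
    using p(1) unfolding C1.edge_mult_def by (auto simp: card_gt_0_iff)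
  obtain x y where xy: "x \<noteq> y" "e = {x, y}" using C1.walk_edge_distinct[OF jc(1,2)] jc(3) by blast
  consider l where "{C1.W.old l, C1.W.new l} = e" | l where "{C2.W.old l, C2.W.new l} = e"
    | l l' where "e \<subseteq> C1.W.occ l" "e \<subseteq> C2.W.occ l'"
    using C1.edge_pos[OF p(1)] C2.edge_pos[OF p(2)] by metis
  then show ?thesis
  proof cases
    case 1 then show ?thesis using P.card_pair_verts_sharing_step[of l] sub by simp
  next
    case 2 then show ?thesis using Q.card_pair_verts_sharing_step[of l] sub by (simp add: Un_commute)
  next
    case 3 then show ?thesis using P.card_pair_verts_sharing_states[of x y l l'] xy by simp
  qed
qed

section \<open>Counting balanced walks\<close>

text \<open>Such a function factors through \<open>p\<close> labels.\<close>

lemma card_small_range: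
  assumes I: "finite I" and N: "finite N" "N \<noteq> {}"
  shows "card {f \<in> I \<rightarrow>\<^sub>E N. card (f ` I) \<le> p} \<le> p ^ card I * card N ^ p"
proof -
  define F where "F = (\<lambda>(g, h). restrict (h \<circ> g) I) ` ((I \<rightarrow>\<^sub>E {..<p}) \<times> ({..<p} \<rightarrow>\<^sub>E N))"
  obtain n0 where n0: "n0 \<in> N" using N by auto
  have "{f \<in> I \<rightarrow>\<^sub>E N. card (f ` I) \<le> p} \<subseteq> F"
  proof
    fix f assume "f \<in> {f \<in> I \<rightarrow>\<^sub>E N. card (f ` I) \<le> p}"
    then have f: "f \<in> I \<rightarrow>\<^sub>E N" "card (f ` I) \<le> card {..<p}" by auto
    obtain e where e: "e ` (f ` I) \<subseteq> {..<p}" "inj_on e (f ` I)"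
      using card_le_inj[of "f ` I" "{..<p}"] f(2) I by auto
    define g where "g = restrict (e \<circ> f) I"
    define h where "h = restrict (\<lambda>m. if m \<in> e ` f ` I then inv_into (f ` I) e m else n0) {..<p}"
    have g: "g \<in> I \<rightarrow>\<^sub>E {..<p}" using e(1) by (auto simp: g_def image_subset_iff)
    have h: "h \<in> {..<p} \<rightarrow>\<^sub>E N"
    proof -
      have "inv_into (f ` I) e m \<in> N" if "m \<in> e ` f ` I" for m
        using inv_into_into[OF that] f by auto
      then show ?thesis using n0 by (auto simp: h_def)
    qed
    have "f = restrict (h \<circ> g) I"
    proof
      fix x
      show "f x = restrict (h \<circ> g) I x"
      proof (cases "x \<in> I")
        case True
        then have "e (f x) \<in> e ` f ` I" "e (f x) < p" using e by auto
        then have "h (e (f x)) = f x" using inv_into_f_f[OF e(2), of "f x"] True by (simp add: h_def)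
        then show ?thesis using True by (simp add: g_def)
      next
        case False then show ?thesis using f by (auto simp: PiE_def extensional_def)
      qed
    qed
    then show "f \<in> F" unfolding F_def using g h by (intro image_eqI[of _ _ "(g, h)"]) auto
  qed
  moreover have fin: "finite ((I \<rightarrow>\<^sub>E {..<p}) \<times> ({..<p} \<rightarrow>\<^sub>E N))" using I N by (intro finite_cartesian_product finite_PiE) auto
  ultimately have "card {f \<in> I \<rightarrow>\<^sub>E N. card (f ` I) \<le> p} \<le> card F"
    by (intro card_mono) (auto simp: F_def)
  also have "\<dots> \<le> card ((I \<rightarrow>\<^sub>E {..<p}) \<times> ({..<p} \<rightarrow>\<^sub>E N))" unfolding F_def by (rule card_image_le[OF fin])
  also have "\<dots> = p ^ card I * card N ^ p" using I N by (simp add: card_cartesian_product card_PiE)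
  finally show ?thesis .
qed

definition triples_of :: "nat set \<Rightarrow> nat list set" where
  "triples_of N = {as. length as = 3 \<and> distinct as \<and> set as \<subseteq> N}"

lemma finite_triples_of: "finite N \<Longrightarrow> finite (triples_of N)"
  by (rule finite_subset[OF _ finite_lists_length_eq[of N 3]]) (auto simp: triples_of_def)

definition walk_of :: "nat \<Rightarrow> (nat \<Rightarrow> nat list) \<Rightarrow> nat \<Rightarrow> nat \<Rightarrow> nat" where
  "walk_of k c j i = c (j mod (2 * k)) ! i"

definition closed_walks :: "nat set \<Rightarrow> nat \<Rightarrow> (nat \<Rightarrow> nat list) set" where
  "closed_walks N k = {c \<in> {..<2 * k} \<rightarrow>\<^sub>E triples_of N. \<forall>j<2 * k. set (c j) \<inter> set (c (Suc j mod (2 * k))) = {}}"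

definition walk_verts :: "nat \<Rightarrow> (nat \<Rightarrow> nat list) \<Rightarrow> nat set" where
  "walk_verts k c = (\<Union>j<2 * k. set (c j))"

definition balanced_walks :: "nat set \<Rightarrow> nat \<Rightarrow> (nat \<Rightarrow> nat list) set" where
  "balanced_walks N k = {c \<in> closed_walks N k. triple_walk.balanced_edges k (walk_of k c)}"

lemma finite_closed_walks: "finite N \<Longrightarrow> finite (closed_walks N k)"
  by (rule finite_subset[of _ "{..<2 * k} \<rightarrow>\<^sub>E triples_of N"])
     (auto simp: closed_walks_def intro!: finite_PiE finite_triples_of)

lemma set_length3: "length as = 3 \<Longrightarrow> set as = (!) as ` {..<3}"
  by (auto simp: set_conv_nth)

lemma closed_walkD:
  assumes "c \<in> closed_walks N k" "j < 2 * k"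
  shows "length (c j) = 3" "distinct (c j)" "set (c j) \<subseteq> N" "set (c j) \<inter> set (c (Suc j mod (2 * k))) = {}"
  using assms by (auto simp: closed_walks_def triples_of_def PiE_def Pi_def)

lemma closed_walks_eqI:
  assumes c: "c \<in> closed_walks N k" "c' \<in> closed_walks N k"
    and eq: "\<And>j i. j < 2 * k \<Longrightarrow> i < 3 \<Longrightarrow> c j ! i = c' j ! i"
  shows "c = c'"
proof -
  have "c j = c' j" if "j < 2 * k" for j
    using eq[OF that] closed_walkD(1)[OF c(1) that] closed_walkD(1)[OF c(2) that] by (intro nth_equalityI) auto
  then show ?thesis using c by (intro PiE_ext[of c "{..<2*k}" "\<lambda>_. triples_of N" c']) (auto simp: closed_walks_def)
qed

lemma triple_walk_walk_of:
  assumes c: "c \<in> closed_walks N k" and k: "0 < k"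
  shows "triple_walk k (walk_of k c)"
proof
  have l: "j mod (2 * k) < 2 * k" for j using k by simp
  have im: "walk_of k c j ` {..<3} = set (c (j mod (2 * k)))" for j
    unfolding set_length3[OF closed_walkD(1)[OF c l]] by (simp add: walk_of_def)
  show "0 < k" by fact
  show "walk_of k c (j + 2 * k) = walk_of k c j" for j by (simp add: walk_of_def fun_eq_iff)
  show "inj_on (walk_of k c j) {..<3}" for j
    using closed_walkD(1,2)[OF c l, of j] by (auto simp: walk_of_def inj_on_def nth_eq_iff_index_eq)
  show "walk_of k c j ` {..<3} \<inter> walk_of k c (Suc j) ` {..<3} = {}" for j
    unfolding im using closed_walkD(4)[OF c l, of j] by (simp add: mod_Suc_eq)
qed

lemma triple_walk_verts:
  assumes c: "c \<in> closed_walks N k" and k: "0 < k"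
  shows "closed_walk.verts (fine_state (walk_of k c)) 3 = walk_verts k c"
proof -
  interpret C: triple_walk k "walk_of k c" by (rule triple_walk_walk_of[OF c k])
  have l: "j mod (2 * k) < 2 * k" for j using k by simp
  have im: "walk_of k c j ` {..<3} = set (c (j mod (2 * k)))" for j
    unfolding set_length3[OF closed_walkD(1)[OF c l]] by (simp add: walk_of_def)
  show ?thesis
  proof
    show "C.W.verts \<subseteq> walk_verts k c"
    proof
      fix x assume "x \<in> C.W.verts"
      then obtain l i where i: "i < 3" "x = fine_state (walk_of k c) l i" by (auto simp: C.W.verts_def C.W.occ_def)
      then obtain j where "x = walk_of k c j i" by (auto simp: fine_state_def split: if_splits)
      then have "x \<in> set (c (j mod (2 * k)))" using im[of j] i by auto
      then show "x \<in> walk_verts k c" using l by (auto simp: walk_verts_def)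
    qed
    show "walk_verts k c \<subseteq> C.W.verts"
    proof
      fix x assume "x \<in> walk_verts k c"
      then obtain j where j: "j < 2 * k" "x \<in> set (c j)" by (auto simp: walk_verts_def)
      then obtain i where i: "i < 3" "x = walk_of k c j i" using im[of j] by auto
      then have "x = fine_state (walk_of k c) (3 * j + 0) i" using C.fine_block[of 0 i j] by (simp split: if_splits)
      then show "x \<in> C.W.verts" using i by (auto simp: C.W.verts_def C.W.occ_def)
    qed
  qed
qed

text \<open>The first triple as a state, with the same dummy value as in \<open>fine_state\<close>.\<close>

definition row_state :: "nat list \<Rightarrow> nat \<Rightarrow> nat" where
  "row_state b i = (if i < 3 then b ! i else 0)"

text \<open>A walk is determined by its first triple and the sequence of vertices put in by its refined steps.\<close>

definition walk_code :: "nat \<Rightarrow> (nat \<Rightarrow> nat list) \<Rightarrow> nat list \<times> nat list" where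
  "walk_code k c = (c 0, map (\<lambda>l. fine_state (walk_of k c) (Suc l) (zigzag_row l)) [0..<6 * k])"

definition zigzag_word :: "nat \<Rightarrow> nat list" where "zigzag_word k = map zigzag_row [0..<6 * k]"

definition run_codes :: "nat set \<Rightarrow> nat \<Rightarrow> (nat list \<times> nat list) set" where
  "run_codes N k = (SIGMA b : triples_of N. runs N (zigzag_word k) [] (row_state b) (set b))"

lemma fine_0: "c \<in> closed_walks N k \<Longrightarrow> 0 < k \<Longrightarrow> fine_state (walk_of k c) 0 = row_state (c 0)"
  by (auto simp: fine_state_def row_state_def walk_of_def fun_eq_iff)

lemma row_of_block:
  assumes "i < 3" obtains l where "l div 3 = j" "zigzag_row l = i"
proof -
  define q where "q = (if even j then 2 - i else i)"
  have q: "q < 3" using assms by (auto simp: q_def)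
  then have dm: "(3 * j + q) div 3 = j" "(3 * j + q) mod 3 = q" by auto
  have "zigzag_row (3 * j + q) = (if even j then 2 - q else q)" unfolding zigzag_row_def dm ..
  then have "zigzag_row (3 * j + q) = i" using assms by (simp add: q_def)
  then show thesis using that dm by blast
qed

lemma inj_walk_code: assumes k: "0 < k" shows "inj_on (walk_code k) (closed_walks N k)"
proof
  fix c c' assume c: "c \<in> closed_walks N k" and c': "c' \<in> closed_walks N k" and eq: "walk_code k c = walk_code k c'"
  interpret C: triple_walk k "walk_of k c" by (rule triple_walk_walk_of[OF c k])
  interpret C': triple_walk k "walk_of k c'" by (rule triple_walk_walk_of[OF c' k])
  have e0: "c 0 = c' 0" and
    e1: "map (\<lambda>l. fine_state (walk_of k c) (Suc l) (zigzag_row l)) [0..<6 * k] = map (\<lambda>l. fine_state (walk_of k c') (Suc l) (zigzag_row l)) [0..<6 * k]"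
    using eq by (auto simp: walk_code_def)
  show "c = c'"
  proof (rule closed_walks_eqI[OF c c'])
    fix j i assume j: "j < 2 * k" and i: "i < (3::nat)"
    show "c j ! i = c' j ! i"
    proof (cases j)
      case (Suc j')
      obtain l where l: "l div 3 = j'" "zigzag_row l = i" using row_of_block[OF i] by blast
      have "l div 3 < 2 * k" using l(1) j Suc by simp
      then have "l < 6 * k" by (simp add: div_less_iff_less_mult)
      then have "fine_state (walk_of k c) (Suc l) (zigzag_row l) = fine_state (walk_of k c') (Suc l) (zigzag_row l)"
        using e1 by (auto simp: map_eq_conv)
      then have "walk_of k c j i = walk_of k c' j i" using C.fine_new[of l] C'.fine_new[of l] l Suc by simp
      then show ?thesis using j by (simp add: walk_of_def)
    qed (use e0 in simp)
  qed
qed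

lemma tight_walk_code:
  assumes c: "c \<in> balanced_walks N k" and k: "0 < k" and tight: "card (walk_verts k c) = 3 * k + 3"
  shows "walk_code k c \<in> run_codes N k"
proof -
  have cc: "c \<in> closed_walks N k" and b: "triple_walk.balanced_edges k (walk_of k c)" using c by (auto simp: balanced_walks_def)
  interpret C: triple_walk k "walk_of k c" by (rule triple_walk_walk_of[OF cc k])
  have V: "C.W.verts = walk_verts k c" by (rule triple_walk_verts[OF cc k])
  interpret Z: zigzag_walk "fine_state (walk_of k c)" "6 * k"
    by (rule C.zigzag_walkI[OF b]) (use tight V in simp)
  have "walk_verts k c \<subseteq> N" using closed_walkD(3)[OF cc] by (auto simp: walk_verts_def)
  then have sub: "C.W.verts \<subseteq> N" using V by simp
  have "map C.W.new [0..<6*k] \<in> runs N (map zigzag_row [0..<6*k]) (map (\<lambda>a. (zigzag_row a, C.W.old a)) (Z.open_steps 0))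
      (fine_state (walk_of k c) 0) (\<Union>x\<le>0. C.W.occ x)"
    by (rule Z.tight_walk_in_runs[OF _ sub]) (use C.fine_upd in \<open>auto simp: C.W.new_def\<close>)
  moreover have "Z.open_steps 0 = []" by (simp add: Z.open_steps_def)
  moreover have "(\<Union>x\<le>0. C.W.occ x) = set (c 0)"
  proof -
    have "length (c 0) = 3" using closed_walkD(1)[OF cc, of 0] k by simp
    then have "row_state (c 0) ` {..<3} = set (c 0)" by (auto simp: row_state_def set_length3)
    moreover have "C.W.occ 0 = row_state (c 0) ` {..<3}" unfolding C.W.occ_def fine_0[OF cc k] ..
    ultimately show ?thesis by simp
  qed
  ultimately have "map C.W.new [0..<6*k] \<in> runs N (zigzag_word k) [] (row_state (c 0)) (set (c 0))"
    by (simp add: fine_0[OF cc k] zigzag_word_def)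
  moreover have "c 0 \<in> triples_of N" using cc k by (auto simp: closed_walks_def)
  moreover have "walk_code k c = (c 0, map C.W.new [0..<6*k])" by (simp add: walk_code_def C.W.new_def)
  ultimately show ?thesis by (auto simp: run_codes_def)
qed

text \<open>Replaying a run from the given triple produces a closed walk, since the stack is empty at the end,
  and a balanced one, since the weight of a run is one for all signs.\<close>

lemma run_code_is_walk_code:
  assumes rc: "(b, vs) \<in> run_codes N k" and k: "0 < k"
  shows "\<exists>c\<in>balanced_walks N k. walk_code k c = (b, vs)"
proof -
  let ?w = "zigzag_word k"
  have b: "length b = 3" "distinct b" "set b \<subseteq> N" and vs: "vs \<in> runs N ?w [] (row_state b) (set b)"
    using rc by (auto simp: run_codes_def triples_of_def)
  have lw: "length ?w = 6 * k" by (simp add: zigzag_word_def)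
  have wl: "?w ! l = zigzag_row l" if "l < 6 * k" for l using that by (simp add: zigzag_word_def)
  have row_b: "row_state b i \<in> set b" if "i < 3" for i using that b by (simp add: row_state_def)
  \<comment> \<open>Replay the run; the values \<open>vs ! l\<close> beyond the length of \<open>vs\<close> do not enter the walk.\<close>
  define s where "s = rec_nat (row_state b) (\<lambda>l x. x(zigzag_row l := vs ! l))"
  have s0: "s 0 = row_state b" and sS: "s (Suc l) = (s l)(zigzag_row l := vs ! l)" for l by (simp_all add: s_def)
  have sw: "s (Suc l) = (s l)(?w ! l := vs ! l)" if "l < length ?w" for l using that sS wl lw by simp
  have weight: "(\<Prod>l<6 * k. gauge_weight \<theta> (zigzag_row l) (s l) (s (Suc l))) = 1" and closed: "s (6 * k) = s 0"
    if "sign_kernel \<theta>" for \<theta> :: "nat \<Rightarrow> nat \<Rightarrow> real"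
    using runs_weight[OF that, of vs N ?w "[]" s "set b"] vs sw unfolding s0[symmetric] lw by (auto simp: wl)
  have closed: "s (6 * k) = s 0" using closed[of "\<lambda>_ _. 1"] by (simp add: sign_kernel_def)
  have "set vs \<subseteq> N" by (rule runs_subset[OF vs]) (use row_b b zigzag_row_less in \<open>auto simp: zigzag_word_def\<close>)
  moreover have lvs: "length vs = 6 * k" using runs_length[OF vs] lw by simp
  ultimately have vsN: "vs ! l \<in> N" if "l < 6 * k" for l using that by auto
  have sN: "s l i \<in> N" if "l \<le> 6 * k" "i < 3" for l i
    using that(1) by (induction l) (use row_b[OF that(2)] b vsN in \<open>auto simp: s0 sS\<close>)
  \<comment> \<open>Since every vertex keeps to one row, the triples are distinct and consecutive ones disjoint.\<close>
  obtain r where r: "\<And>l i. l \<le> 6 * k \<Longrightarrow> i < 3 \<Longrightarrow> r (s l i) = i"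
    and moves: "\<And>l. l < 6 * k \<Longrightarrow> s (Suc l) (zigzag_row l) \<noteq> s l (zigzag_row l)"
  proof -
    have "\<exists>r'. (\<forall>v\<in>set b. r' v = (\<lambda>v. THE i. i < 3 \<and> b ! i = v) v) \<and> (\<forall>l\<le>length ?w. \<forall>i<3. r' (s l i) = i) \<and>
      (\<forall>l<length ?w. s (Suc l) (?w ! l) \<noteq> s l (?w ! l))"
    proof (rule runs_rows)
      show "vs \<in> runs N ?w [] (s 0) (set b)" using vs by (simp add: s0)
      show "s (Suc l) = (s l)(?w ! l := vs ! l)" if "l < length ?w" for l using sw that .
      show "set ?w \<subseteq> {..<3}" using zigzag_row_less by (auto simp: zigzag_word_def)
      show "s 0 i \<in> set b \<and> (THE i'. i' < 3 \<and> b ! i' = s 0 i) = i" if "i < 3" for i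
      proof -
        have "(THE i'. i' < 3 \<and> b ! i' = s 0 i) = i"
          by (rule the_equality) (use that b in \<open>auto simp: s0 row_state_def nth_eq_iff_index_eq\<close>)
        then show ?thesis using row_b[OF that] by (simp add: s0)
      qed
    qed auto
    then obtain r' where r': "\<And>l i. l \<le> 6 * k \<Longrightarrow> i < 3 \<Longrightarrow> r' (s l i) = i"
      "\<And>l. l < 6 * k \<Longrightarrow> s (Suc l) (?w ! l) \<noteq> s l (?w ! l)" unfolding lw by blast
    show thesis by (rule that[of r']) (use r' wl in auto)
  qed
  have block: "s (3 * j + 3) i = s (Suc l) i" "s l i = s (3 * j) i" if "l div 3 = j" "zigzag_row l = i" for l i j
  proof -
    have zr: "zigzag_row (3 * j) = (if even j then 2 else 0)" "zigzag_row (3 * j + 1) = 1" "zigzag_row (3 * j + 2) = (if even j then 0 else 2)"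
    proof -
      have dm: "(3 * j) div 3 = j" "(3 * j) mod 3 = 0" "(3 * j + 1) div 3 = j" "(3 * j + 1) mod 3 = 1"
        "(3 * j + 2) div 3 = j" "(3 * j + 2) mod 3 = 2" by presburger+
      show "zigzag_row (3 * j) = (if even j then 2 else 0)" "zigzag_row (3 * j + 1) = 1" "zigzag_row (3 * j + 2) = (if even j then 0 else 2)"
        unfolding zigzag_row_def dm by auto
    qed
    have s1: "s (3 * j + 1) = (s (3 * j))(zigzag_row (3 * j) := vs ! (3 * j))"
      "s (3 * j + 2) = (s (3 * j + 1))(zigzag_row (3 * j + 1) := vs ! (3 * j + 1))"
      "s (3 * j + 3) = (s (3 * j + 2))(zigzag_row (3 * j + 2) := vs ! (3 * j + 2))"
      using sS[of "3 * j"] sS[of "3 * j + 1"] sS[of "3 * j + 2"] by (simp_all add: numeral_3_eq_3 numeral_2_eq_2)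
    have "l = 3 * j + l mod 3" "l mod 3 < 3" using that by auto
    then consider "l = 3 * j" "Suc l = 3 * j + 1" | "l = 3 * j + 1" "Suc l = 3 * j + 2" | "l = 3 * j + 2" "Suc l = 3 * j + 3" by linarith
    then have "s (3 * j + 3) i = s (Suc l) i \<and> s l i = s (3 * j) i"
    proof cases
      case 1
      then have "zigzag_row (3 * j + 1) \<noteq> i" "zigzag_row (3 * j + 2) \<noteq> i" using that(2) zr by (auto split: if_splits)
      then show ?thesis unfolding s1(3) 1(2) using s1(2) 1(1) by simp
    next
      case 2
      then have "zigzag_row (3 * j) \<noteq> i" "zigzag_row (3 * j + 2) \<noteq> i" using that(2) zr by (auto split: if_splits)
      then show ?thesis unfolding s1(3) 2 using s1(1) by simp
    next
      case 3
      then have "zigzag_row (3 * j) \<noteq> i" "zigzag_row (3 * j + 1) \<noteq> i" using that(2) zr by (auto split: if_splits)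
      then have "s l i = s (3 * j) i" unfolding 3(1) using s1(1,2) by simp
      moreover have "s (Suc l) = s (3 * j + 3)" unfolding 3(2) ..
      ultimately show ?thesis by metis
    qed
    then show "s (3 * j + 3) i = s (Suc l) i" "s l i = s (3 * j) i" by auto
  qed
  define c where "c = restrict (\<lambda>j. map (s (3 * j)) [0..<3]) {..<2 * k}"
  have cj: "length (c j) = 3" "\<And>i. i < 3 \<Longrightarrow> c j ! i = s (3 * j) i" "set (c j) = s (3 * j) ` {..<3}" if "j < 2 * k" for j
    using that by (auto simp: c_def)
  have next_c: "set (c (Suc j mod (2 * k))) = s (3 * j + 3) ` {..<3}" "\<And>i. i < 3 \<Longrightarrow> c (Suc j mod (2 * k)) ! i = s (3 * j + 3) i" if "j < 2 * k" for j
  proof -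
    have a3: "3 * j + 3 = 3 * Suc j" by simp
    have "s (3 * (Suc j mod (2 * k))) = s (3 * Suc j)"
    proof (cases "Suc j = 2 * k")
      case True
      then have "3 * Suc j = 6 * k" "Suc j mod (2 * k) = 0" by simp_all
      then show ?thesis using closed by (metis mult_0_right)
    next
      case False then show ?thesis using that by simp
    qed
    moreover have "Suc j mod (2 * k) < 2 * k" using k by simp
    ultimately show "set (c (Suc j mod (2 * k))) = s (3 * j + 3) ` {..<3}" "\<And>i. i < 3 \<Longrightarrow> c (Suc j mod (2 * k)) ! i = s (3 * j + 3) i"
      unfolding a3 using cj by metis+
  qed
  have cc: "c \<in> closed_walks N k"
    unfolding closed_walks_def
  proof (intro CollectI conjI PiE_I allI impI)
    show "c j \<in> triples_of N" if "j \<in> {..<2 * k}" for j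
    proof -
      have j: "j < 2 * k" "3 * j \<le> 6 * k" using that by auto
      have "distinct (c j)"
        unfolding distinct_conv_nth cj(1)[OF j(1)]
        using cj(2)[OF j(1)] r[OF j(2)] by metis
      moreover have "set (c j) \<subseteq> N" using cj(3)[OF j(1)] sN[OF j(2)] by auto
      ultimately show ?thesis using cj(1)[OF j(1)] by (simp add: triples_of_def)
    qed
    show "c j = undefined" if "j \<notin> {..<2 * k}" for j using that by (simp add: c_def)
    show "set (c j) \<inter> set (c (Suc j mod (2 * k))) = {}" if j: "j < 2 * k" for j
    proof -
      have "s (3 * j) i \<noteq> s (3 * j + 3) i'" if i: "i < 3" "i' < 3" for i i'
      proof (cases "i = i'")
        case False
        then show ?thesis using r[of "3 * j" i] r[of "3 * j + 3" i'] i j by auto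
      next
        case True
        obtain l where l: "l div 3 = j" "zigzag_row l = i" using row_of_block[OF i(1)] by blast
        have "l div 3 < 2 * k" using l(1) j by simp
        then have "l < 6 * k" by (simp add: div_less_iff_less_mult)
        then show ?thesis using moves[of l] block[OF l] l True by metis
      qed
      then show ?thesis unfolding cj(3)[OF j] next_c(1)[OF j] by auto
    qed
  qed
  interpret C: triple_walk k "walk_of k c" by (rule triple_walk_walk_of[OF cc k])
  have c0: "c 0 = b"
    by (rule nth_equalityI) (use cj(1,2)[of 0] k b in \<open>auto simp: s0 row_state_def\<close>)
  have fine_s: "fine_state (walk_of k c) l = s l" if "l \<le> 6 * k" for l
    using that
  proof (induction l)
    case 0
    then show ?case using fine_0[OF cc k] c0 s0 by simp
  next
    case (Suc l)
    let ?i = "zigzag_row l"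
    have j: "l div 3 < 2 * k" using Suc.prems by (simp add: div_less_iff_less_mult)
    have "fine_state (walk_of k c) (Suc l) ?i = walk_of k c (Suc (l div 3)) ?i" by (rule C.fine_new)
    also have "\<dots> = s (3 * (l div 3) + 3) ?i" using next_c(2)[OF j zigzag_row_less] by (simp add: walk_of_def)
    also have "\<dots> = s (Suc l) ?i" by (rule block) simp_all
    finally show ?case using C.fine_upd[of l] Suc sS[of l] by simp
  qed
  have "triple_walk.balanced_edges k (walk_of k c)"
  proof (rule C.balanced_edgesI)
    fix \<theta> :: "nat \<Rightarrow> nat \<Rightarrow> real" assume sk: "sign_kernel \<theta>"
    have "(\<Prod>j<2 * k. C.step_weight \<theta> j) = (\<Prod>l<6 * k. gauge_weight \<theta> (zigzag_row l) (fine_state (walk_of k c) l) (fine_state (walk_of k c) (Suc l)))"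
      using C.gauge_product[OF sk] by simp
    also have "\<dots> = (\<Prod>l<6 * k. gauge_weight \<theta> (zigzag_row l) (s l) (s (Suc l)))"
      by (rule prod.cong) (auto simp: fine_s)
    finally show "(\<Prod>j<2 * k. C.step_weight \<theta> j) = 1" using weight[OF sk] by simp
  qed
  then have "c \<in> balanced_walks N k" using cc by (simp add: balanced_walks_def)
  moreover have "walk_code k c = (b, vs)"
    unfolding walk_code_def c0 using lvs by (auto intro!: nth_equalityI simp: fine_s sS)
  ultimately show ?thesis by blast
qed

lemma card_run_codes:
  assumes N: "finite N"
  shows "card (run_codes N k) = card (triples_of N) * (pairings (zigzag_word k) [] * falling (card N - 3) (3 * k))"
proof -
  have "card (runs N (zigzag_word k) [] (row_state b) (set b)) = pairings (zigzag_word k) [] * falling (card N - 3) (3 * k)"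
    if b: "b \<in> triples_of N" for b
  proof -
    have b': "length b = 3" "distinct b" "set b \<subseteq> N" using b by (auto simp: triples_of_def)
    have "card (runs N (zigzag_word k) [] (row_state b) (set b)) = pairings (zigzag_word k) (map fst ([] :: (nat \<times> nat) list)) * falling (card N - card (set b)) (3 * k)"
      by (rule card_runs[OF N]) (use b' zigzag_row_less in \<open>auto simp: zigzag_word_def row_state_def\<close>)
    then show ?thesis using b' distinct_card[of b] by simp
  qed
  then show ?thesis unfolding run_codes_def
    by (subst card_SigmaI) (auto simp: finite_triples_of finite_runs N)
qed

text \<open>Balanced walks with the maximal number \<open>3 * k + 3\<close> of vertices are encoded by runs, and the others
  have too few vertices to matter.\<close>

lemma card_balanced_walks:
  assumes N: "finite N" "N \<noteq> {}" and k: "0 < k"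
  shows "card (run_codes N k) \<le> card (balanced_walks N k)"
    and "card (balanced_walks N k) \<le> card (run_codes N k) + (3 * k + 2) ^ (6 * k) * card N ^ (3 * k + 2)"
proof -
  have finB: "finite (balanced_walks N k)"
    by (rule finite_subset[OF _ finite_closed_walks[OF N(1)]]) (auto simp: balanced_walks_def)
  have finR: "finite (run_codes N k)"
    unfolding run_codes_def using N by (intro finite_SigmaI finite_triples_of finite_runs)
  have sub: "balanced_walks N k \<subseteq> closed_walks N k" by (auto simp: balanced_walks_def)
  have "run_codes N k \<subseteq> walk_code k ` balanced_walks N k"
    using run_code_is_walk_code[OF _ k] by (auto simp: image_iff) metis
  then have "card (run_codes N k) \<le> card (walk_code k ` balanced_walks N k)" using finB by (intro card_mono) auto
  also have "\<dots> \<le> card (balanced_walks N k)" by (rule card_image_le[OF finB])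
  finally show "card (run_codes N k) \<le> card (balanced_walks N k)" .
  define S where "S = {c \<in> closed_walks N k. card (walk_verts k c) \<le> 3 * k + 2}"
  define T where "T = {c \<in> balanced_walks N k. card (walk_verts k c) = 3 * k + 3}"
  have "balanced_walks N k \<subseteq> T \<union> S"
  proof
    fix c assume c: "c \<in> balanced_walks N k"
    then have cc: "c \<in> closed_walks N k" and b: "triple_walk.balanced_edges k (walk_of k c)" by (auto simp: balanced_walks_def)
    interpret C: triple_walk k "walk_of k c" by (rule triple_walk_walk_of[OF cc k])
    have "card (walk_verts k c) \<le> 3 * k + 3" using C.card_verts_le[OF b] triple_walk_verts[OF cc k] by simp
    then show "c \<in> T \<union> S" using c cc by (auto simp: T_def S_def)
  qed
  then have "card (balanced_walks N k) \<le> card (T \<union> S)"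
    using finB finite_closed_walks[OF N(1)] by (intro card_mono) (auto simp: T_def S_def)
  also have "\<dots> \<le> card T + card S" by (rule card_Un_le)
  also have "card T \<le> card (run_codes N k)"
  proof (rule card_inj_on_le[OF _ _ finR])
    show "inj_on (walk_code k) T" by (rule inj_on_subset[OF inj_walk_code[OF k, of N]]) (auto simp: T_def balanced_walks_def)
    show "walk_code k ` T \<subseteq> run_codes N k" using tight_walk_code[OF _ k] by (auto simp: T_def)
  qed
  also have "card S \<le> (3 * k + 2) ^ (6 * k) * card N ^ (3 * k + 2)"
  proof -
    let ?I = "{..<2 * k} \<times> {..<3::nat}"
    define \<phi> where "\<phi> c = restrict (\<lambda>(j, i). c j ! i) ?I" for c :: "nat \<Rightarrow> nat list"
    have im: "\<phi> c ` ?I = walk_verts k c" if "c \<in> closed_walks N k" for c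
    proof -
      have "\<phi> c ` ?I = (\<lambda>(j, i). c j ! i) ` ?I" by (rule image_cong) (auto simp: \<phi>_def)
      also have "\<dots> = (\<Union>j<2 * k. (!) (c j) ` {..<3})" by auto
      also have "\<dots> = walk_verts k c" unfolding walk_verts_def
        by (rule SUP_cong) (use set_length3 closed_walkD(1)[OF that] in auto)
      finally show ?thesis .
    qed
    have "card S \<le> card {f \<in> ?I \<rightarrow>\<^sub>E N. card (f ` ?I) \<le> 3 * k + 2}"
    proof (rule card_inj_on_le)
      show "inj_on \<phi> S"
      proof
        fix c c' assume "c \<in> S" "c' \<in> S" and eq: "\<phi> c = \<phi> c'"
        then have c: "c \<in> closed_walks N k" "c' \<in> closed_walks N k" by (auto simp: S_def)
        show "c = c'"
        proof (rule closed_walks_eqI[OF c])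
          fix j i assume "j < 2 * k" "i < (3::nat)"
          then show "c j ! i = c' j ! i" using fun_cong[OF eq, of "(j, i)"] by (simp add: \<phi>_def)
        qed
      qed
      show "\<phi> ` S \<subseteq> {f \<in> ?I \<rightarrow>\<^sub>E N. card (f ` ?I) \<le> 3 * k + 2}"
      proof (rule image_subsetI)
        fix c assume "c \<in> S"
        then have c: "c \<in> closed_walks N k" "card (walk_verts k c) \<le> 3 * k + 2" by (auto simp: S_def)
        have "c j ! i \<in> N" if "j < 2 * k" "i < 3" for j i
          using closed_walkD(1,3)[OF c(1) that(1)] that(2) by (auto simp: subset_iff)
        then show "\<phi> c \<in> {f \<in> ?I \<rightarrow>\<^sub>E N. card (f ` ?I) \<le> 3 * k + 2}" using c im[OF c(1)] by (auto simp: \<phi>_def)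
      qed
      show "finite {f \<in> ?I \<rightarrow>\<^sub>E N. card (f ` ?I) \<le> 3 * k + 2}"
        by (rule finite_subset[of _ "?I \<rightarrow>\<^sub>E N"]) (use N in \<open>auto intro!: finite_PiE\<close>)
    qed
    also have "\<dots> \<le> (3 * k + 2) ^ card ?I * card N ^ (3 * k + 2)" by (rule card_small_range) (use N in auto)
    finally show ?thesis by (simp add: card_cartesian_product)
  qed
  finally show "card (balanced_walks N k) \<le> card (run_codes N k) + (3 * k + 2) ^ (6 * k) * card N ^ (3 * k + 2)" by simp
qed

text \<open>The pairs of walks whose products of matrix entries are correlated.\<close>

definition linked_pairs :: "nat set \<Rightarrow> nat \<Rightarrow> ((nat \<Rightarrow> nat list) \<times> (nat \<Rightarrow> nat list)) set" where
  "linked_pairs N k = {(c, c') \<in> closed_walks N k \<times> closed_walks N k.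
     (\<forall>e. even (triple_walk.edge_mult k (walk_of k c) e + triple_walk.edge_mult k (walk_of k c') e)) \<and>
     \<not> (c \<in> balanced_walks N k \<and> c' \<in> balanced_walks N k)}"

lemma card_linked_pairs:
  assumes N: "finite N" "N \<noteq> {}" and k: "0 < k"
  shows "card (linked_pairs N k) \<le> (6 * k + 4) ^ (12 * k) * card N ^ (6 * k + 4)"
proof -
  have small: "card (walk_verts k c \<union> walk_verts k c') \<le> 6 * k + 4" if h: "(c, c') \<in> linked_pairs N k" for c c'
  proof -
    have c: "c \<in> closed_walks N k" "c' \<in> closed_walks N k"
      and ev: "\<And>e. even (triple_walk.edge_mult k (walk_of k c) e + triple_walk.edge_mult k (walk_of k c') e)"
      and nb: "\<not> triple_walk.balanced_edges k (walk_of k c) \<or> \<not> triple_walk.balanced_edges k (walk_of k c')"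
      using h by (auto simp: linked_pairs_def balanced_walks_def)
    note C = triple_walk_walk_of[OF c(1) k] triple_walk_walk_of[OF c(2) k]
    show ?thesis using nb
    proof
      assume "\<not> triple_walk.balanced_edges k (walk_of k c)"
      then show ?thesis using card_triple_walk_pair[OF C ev] triple_walk_verts[OF c(1) k] triple_walk_verts[OF c(2) k] by simp
    next
      assume "\<not> triple_walk.balanced_edges k (walk_of k c')"
      moreover have "even (triple_walk.edge_mult k (walk_of k c') e + triple_walk.edge_mult k (walk_of k c) e)" for e using ev[of e] by (simp add: add.commute)
      ultimately show ?thesis using card_triple_walk_pair[OF C(2,1)] triple_walk_verts[OF c(1) k] triple_walk_verts[OF c(2) k] by (simp add: Un_commute)
    qed
  qed
  let ?I = "(UNIV :: bool set) \<times> {..<2 * k} \<times> {..<3::nat}"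
  define \<phi> where "\<phi> p = restrict (\<lambda>(b, j, i). (if b then fst p else snd p) j ! i) ?I" for p :: "(nat \<Rightarrow> nat list) \<times> (nat \<Rightarrow> nat list)"
  have lp: "c \<in> closed_walks N k" "c' \<in> closed_walks N k" if "(c, c') \<in> linked_pairs N k" for c c' using that by (auto simp: linked_pairs_def)
  have "card (linked_pairs N k) \<le> card {f \<in> ?I \<rightarrow>\<^sub>E N. card (f ` ?I) \<le> 6 * k + 4}"
  proof (rule card_inj_on_le)
    show "inj_on \<phi> (linked_pairs N k)"
    proof (rule inj_onI, clarify)
      fix c1 c2 d1 d2 assume c: "(c1, c2) \<in> linked_pairs N k" and d: "(d1, d2) \<in> linked_pairs N k" and eq: "\<phi> (c1, c2) = \<phi> (d1, d2)"
      have "c1 = d1"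
      proof (rule closed_walks_eqI[OF lp(1)[OF c] lp(1)[OF d]])
        fix j i assume "j < 2 * k" "i < (3::nat)"
        then show "c1 j ! i = d1 j ! i" using fun_cong[OF eq, of "(True, j, i)"] by (simp add: \<phi>_def)
      qed
      moreover have "c2 = d2"
      proof (rule closed_walks_eqI[OF lp(2)[OF c] lp(2)[OF d]])
        fix j i assume "j < 2 * k" "i < (3::nat)"
        then show "c2 j ! i = d2 j ! i" using fun_cong[OF eq, of "(False, j, i)"] by (simp add: \<phi>_def)
      qed
      ultimately show "c1 = d1 \<and> c2 = d2" by simp
    qed
    show "\<phi> ` linked_pairs N k \<subseteq> {f \<in> ?I \<rightarrow>\<^sub>E N. card (f ` ?I) \<le> 6 * k + 4}"
    proof (rule image_subsetI, clarify)
      fix c c' assume h: "(c, c') \<in> linked_pairs N k"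
      have inset: "d j ! i \<in> set (d j)" if "d \<in> closed_walks N k" "j < 2 * k" "i < 3" for d j i
        using closed_walkD(1)[OF that(1,2)] that by simp
      have inN: "d j ! i \<in> N" if "d \<in> closed_walks N k" "j < 2 * k" "i < 3" for d j i
        using inset[OF that] closed_walkD(3)[OF that(1,2)] by auto
      have "\<phi> (c, c') ` ?I \<subseteq> walk_verts k c \<union> walk_verts k c'"
      proof (rule image_subsetI)
        fix x assume "x \<in> ?I"
        then obtain b j i where x: "x = (b, j, i)" "j < 2 * k" "i < 3" by auto
        have "\<phi> (c, c') x = (if b then c j ! i else c' j ! i)" using x by (simp add: \<phi>_def)
        moreover have "c j ! i \<in> walk_verts k c" "c' j ! i \<in> walk_verts k c'"
          using inset[OF lp(1)[OF h] x(2,3)] inset[OF lp(2)[OF h] x(2,3)] x(2) by (auto simp: walk_verts_def)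
        ultimately show "\<phi> (c, c') x \<in> walk_verts k c \<union> walk_verts k c'" by auto
      qed
      then have "card (\<phi> (c, c') ` ?I) \<le> card (walk_verts k c \<union> walk_verts k c')"
        by (intro card_mono) (auto simp: walk_verts_def)
      also have "\<dots> \<le> 6 * k + 4" by (rule small[OF h])
      finally have s: "card (\<phi> (c, c') ` ?I) \<le> 6 * k + 4" .
      have P: "\<phi> (c, c') \<in> ?I \<rightarrow>\<^sub>E N"
        using inN[OF lp(1)[OF h]] inN[OF lp(2)[OF h]] by (auto simp: \<phi>_def)
      show "\<phi> (c, c') \<in> ?I \<rightarrow>\<^sub>E N \<and> card (\<phi> (c, c') ` ?I) \<le> 6 * k + 4" using s P by blast
    qed
    show "finite {f \<in> ?I \<rightarrow>\<^sub>E N. card (f ` ?I) \<le> 6 * k + 4}"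
      by (rule finite_subset[of _ "?I \<rightarrow>\<^sub>E N"]) (use N in \<open>auto intro!: finite_PiE\<close>)
  qed
  also have "\<dots> \<le> (6 * k + 4) ^ card ?I * card N ^ (6 * k + 4)" by (rule card_small_range) (use N in auto)
  also have "card ?I = 12 * k" by (simp add: card_cartesian_product)
  finally show ?thesis .
qed

section \<open>Noncrossing pairings of the zigzag word\<close>

definition segment_pairings :: "(nat \<Rightarrow> nat) \<Rightarrow> nat \<Rightarrow> nat \<Rightarrow> nat" where
  "segment_pairings \<rho> g n = pairings (map \<rho> [g..<g + n]) []"

lemma segment_Cons: "map \<rho> [g..<g + Suc n] = \<rho> g # map \<rho> [Suc g..<Suc g + n]"
proof -
  have "[g..<g + Suc n] = g # [Suc g..<g + Suc n]" by (rule upt_conv_Cons) simp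
  then show ?thesis by simp
qed

text \<open>The open letter \<open>j\<close> is closed at some position \<open>g + m\<close>, and everything before this position is
  paired within itself.\<close>

lemma pairings_split:
  "pairings (map \<rho> [g..<g + n]) (j # st) =
     (\<Sum>m<n. if \<rho> (g + m) = j then segment_pairings \<rho> g m * pairings (map \<rho> [Suc (g + m)..<g + n]) st else 0)"
proof (induction n arbitrary: g j st rule: less_induct)
  case (less n)
  show ?case
  proof (cases n)
    case 0 then show ?thesis by simp
  next
    case (Suc n')
    define N where "N = segment_pairings \<rho>"
    define p where "p M st = pairings (map \<rho> [Suc (g + M)..<g + n]) st" for M st
    define h where "h M = (if \<rho> (g + M) = j then N g M * p M st else 0)" for M
    define F where "F m M = (if \<rho> (Suc g + m) = \<rho> g \<and> \<rho> (Suc g + M) = j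
        then N (Suc g) m * N (Suc (Suc g + m)) (M - Suc m) * p (Suc M) st else 0)" for m M
    have seg: "map \<rho> [Suc g..<Suc g + n'] = map \<rho> [Suc g..<g + n]" using Suc by simp
    have IH1: "pairings (map \<rho> [Suc g..<g + n]) (\<rho> g # j # st) = (\<Sum>m<n'. \<Sum>M\<in>{m<..<n'}. F m M)"
    proof -
      have "pairings (map \<rho> [Suc g..<g + n]) (\<rho> g # j # st) = (\<Sum>m<n'. if \<rho> (Suc g + m) = \<rho> g then
          N (Suc g) m * pairings (map \<rho> [Suc (Suc g + m)..<g + n]) (j # st) else 0)"
      proof -
        have en: "g + n = Suc g + n'" using Suc by simp
        show ?thesis unfolding en N_def by (rule less.IH) (use Suc in simp)
      qed
      also have "\<dots> = (\<Sum>m<n'. \<Sum>M\<in>{m<..<n'}. F m M)"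
      proof (rule sum.cong)
        fix m assume "m \<in> {..<n'}"
        then have m: "m < n'" by simp
        define r where "r = n' - Suc m"
        have e: "g + n = Suc (Suc g + m) + r" "r < n" using m Suc by (auto simp: r_def)
        have "pairings (map \<rho> [Suc (Suc g + m)..<g + n]) (j # st) =
          (\<Sum>m'<r. if \<rho> (Suc (Suc g + m) + m') = j then N (Suc (Suc g + m)) m' * pairings (map \<rho> [Suc (Suc (Suc g + m) + m')..<g + n]) st else 0)"
          unfolding e(1) N_def by (rule less.IH[OF e(2)])
        also have "\<dots> = (\<Sum>M\<in>{m<..<n'}. if \<rho> (Suc g + M) = j then N (Suc (Suc g + m)) (M - Suc m) * p (Suc M) st else 0)"
          by (rule sum.reindex_bij_witness[of _ "\<lambda>M. M - Suc m" "\<lambda>m'. Suc m + m'"]) (auto simp: r_def p_def add.assoc)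
        finally show "(if \<rho> (Suc g + m) = \<rho> g then N (Suc g) m * pairings (map \<rho> [Suc (Suc g + m)..<g + n]) (j # st) else 0)
           = (\<Sum>M\<in>{m<..<n'}. F m M)"
          by (cases "\<rho> (Suc g + m) = \<rho> g") (auto simp: F_def sum_distrib_left mult.assoc intro!: sum.cong)
      qed simp
      finally show ?thesis .
    qed
    have IH2: "(if \<rho> (g + Suc M) = j then N g (Suc M) * p (Suc M) st else 0) = (\<Sum>m<M. F m M)" if M: "M < n'" for M
    proof -
      have "N g (Suc M) = pairings (map \<rho> [Suc g..<Suc g + M]) [\<rho> g]"
        unfolding N_def segment_pairings_def segment_Cons by simp
      also have "\<dots> = (\<Sum>m<M. if \<rho> (Suc g + m) = \<rho> g then N (Suc g) m * pairings (map \<rho> [Suc (Suc g + m)..<Suc g + M]) [] else 0)"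
        unfolding N_def by (rule less.IH) (use M Suc in simp)
      also have "\<dots> = (\<Sum>m<M. if \<rho> (Suc g + m) = \<rho> g then N (Suc g) m * N (Suc (Suc g + m)) (M - Suc m) else 0)"
        by (rule sum.cong) (auto simp: N_def segment_pairings_def)
      finally have "N g (Suc M) = \<dots>" .
      then show ?thesis
        by (auto simp: F_def sum_distrib_right intro!: sum.cong)
    qed
    have swap: "(\<Sum>m<n'. \<Sum>M\<in>{m<..<n'}. F m M) = (\<Sum>M<n'. \<Sum>m<M. F m M)"
    proof -
      have "(\<Sum>m<n'. \<Sum>M\<in>{m<..<n'}. F m M) = (\<Sum>m<n'. \<Sum>M\<in>{M\<in>{..<n'}. m < M}. F m M)"
        by (intro sum.cong) auto
      also have "\<dots> = (\<Sum>M<n'. \<Sum>m\<in>{m\<in>{..<n'}. m < M}. F m M)"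
        by (rule sum.swap_restrict) auto
      also have "\<dots> = (\<Sum>M<n'. \<Sum>m<M. F m M)"
        by (intro sum.cong) auto
      finally show ?thesis .
    qed
    have "pairings (map \<rho> [g..<g + n]) (j # st) = pairings (map \<rho> [Suc g..<g + n]) (\<rho> g # j # st)
        + (if \<rho> g = j then pairings (map \<rho> [Suc g..<g + n]) st else 0)"
      unfolding Suc segment_Cons seg[unfolded Suc] by simp
    also have "pairings (map \<rho> [Suc g..<g + n]) (\<rho> g # j # st) = (\<Sum>M<n'. if \<rho> (g + Suc M) = j then N g (Suc M) * p (Suc M) st else 0)"
      unfolding IH1 swap by (rule sum.cong) (use IH2 in auto)
    also have "(if \<rho> g = j then pairings (map \<rho> [Suc g..<g + n]) st else 0) = (if \<rho> (g + 0) = j then N g 0 * p 0 st else 0)"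
      by (simp add: N_def segment_pairings_def p_def)
    finally have eq: "pairings (map \<rho> [g..<g + n]) (j # st) = (\<Sum>M<n'. h (Suc M)) + h 0"
      by (simp only: h_def)
    have "(\<Sum>M<n'. h (Suc M)) + h 0 = (\<Sum>M<n. h M)"
      by (simp only: Suc sum.lessThan_Suc_shift add.commute)
    then show ?thesis unfolding eq by (simp only: h_def N_def p_def)
  qed
qed

lemma segment_pairings_0 [simp]: "segment_pairings \<rho> g 0 = 1"
  by (simp add: segment_pairings_def)

text \<open>The recursion of the Catalan numbers: the first letter is paired with the letter at distance
  \<open>Suc m\<close>.\<close>

lemma segment_pairings_Suc:
  "segment_pairings \<rho> g (Suc n) =
     (\<Sum>m<n. if \<rho> (Suc (g + m)) = \<rho> g then segment_pairings \<rho> (Suc g) m * segment_pairings \<rho> (g + m + 2) (n - Suc m) else 0)"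
proof -
  have "segment_pairings \<rho> g (Suc n) = pairings (map \<rho> [Suc g..<Suc g + n]) [\<rho> g]"
    unfolding segment_pairings_def segment_Cons by simp
  also have "\<dots> = (\<Sum>m<n. if \<rho> (Suc g + m) = \<rho> g then segment_pairings \<rho> (Suc g) m * pairings (map \<rho> [Suc (Suc g + m)..<Suc g + n]) [] else 0)"
    by (rule pairings_split)
  also have "\<dots> = (\<Sum>m<n. if \<rho> (Suc (g + m)) = \<rho> g then segment_pairings \<rho> (Suc g) m * segment_pairings \<rho> (g + m + 2) (n - Suc m) else 0)"
    by (rule sum.cong) (auto simp: segment_pairings_def)
  finally show ?thesis .
qed

abbreviation "zigzag_pairings \<equiv> segment_pairings zigzag_row"

lemma zigzag_pairings_mod: "g mod 6 = g' mod 6 \<Longrightarrow> zigzag_pairings g n = zigzag_pairings g' n"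
proof -
  assume a: "g mod 6 = g' mod 6"
  have "map zigzag_row [g..<g + n] = map zigzag_row [g'..<g' + n]"
  proof (rule nth_equalityI)
    fix i assume "i < length (map zigzag_row [g..<g + n])"
    moreover have "(g + i) mod 6 = (g' + i) mod 6" using a by (metis mod_add_left_eq)
    ultimately show "map zigzag_row [g..<g + n] ! i = map zigzag_row [g'..<g' + n] ! i"
      by (simp add: zigzag_row_mod6)
  qed simp
  then show ?thesis by (simp add: segment_pairings_def)
qed

lemma zigzag_row_eq_iff: "zigzag_row a = zigzag_row b \<longleftrightarrow> a mod 6 = b mod 6 \<or> (a + b + 1) mod 6 = 0"
proof -
  have "x < 6 \<Longrightarrow> y < 6 \<Longrightarrow> ([2,1,0,0,1,2] ! x = ([2,1,0,0,1,2] ! y :: nat)) = (x = y \<or> x + y + 1 = (6::nat))" for x y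
    by (auto simp: nth_Cons' split: if_splits)
  then have "zigzag_row a = zigzag_row b \<longleftrightarrow> a mod 6 = b mod 6 \<or> a mod 6 + b mod 6 + 1 = 6"
    by (simp add: zigzag_row_mod6)
  moreover have "x + y + 1 = 6 \<longleftrightarrow> (x + y + 1) mod 6 = 0" if "x < 6" "y < 6" for x y :: nat
    using that by (cases "x + y + 1 < 6") (auto simp: le_mod_geq)
  then have "a mod 6 + b mod 6 + 1 = 6 \<longleftrightarrow> (a mod 6 + b mod 6 + 1) mod 6 = 0" by simp
  moreover have "(a mod 6 + b mod 6 + 1) mod 6 = (a + b + 1) mod 6" by (metis mod_add_eq mod_add_left_eq)
  ultimately show ?thesis by simp
qed

text \<open>Partners in a noncrossing pairing stand at mirror images of the word, not at translates by a
  period: the length between them is even in all cases, while a translate would make it odd.\<close>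

lemma partner_distance:
  assumes a: "m mod 6 = 0 \<or> (2 * Suc g + m) mod 6 = 0" and z: "zigzag_row (Suc (g + m)) = zigzag_row g"
  shows "(2 * g + m + 2) mod 6 = 0"
proof -
  consider "Suc (g + m) mod 6 = g mod 6" | "(Suc (g + m) + g + 1) mod 6 = 0"
    using z unfolding zigzag_row_eq_iff by (rule disjE)
  then show ?thesis
  proof cases
    case 1
    have "6 dvd m \<or> 6 dvd (2 * Suc g + m)" using a by (simp only: dvd_eq_mod_eq_0)
    moreover have "even x" if "6 dvd x" for x :: nat using that by (rule dvd_trans[rotated]) simp
    ultimately have "even m \<or> even (2 * Suc g + m)" by blast
    then have "even m" by simp
    moreover have "Suc (g + m) mod 6 mod 2 = g mod 6 mod 2" using 1 by simp
    then have "Suc (g + m) mod 2 = g mod 2" by (simp add: mod_mod_cancel)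
    ultimately show ?thesis by presburger
  next
    case 2
    moreover have "Suc (g + m) + g + 1 = 2 * g + m + 2" by simp
    ultimately show ?thesis by (simp only:)
  qed
qed

text \<open>A word with a pairing is a concatenation of whole periods or a palindrome of the zigzag.\<close>

lemma zigzag_pairings_nonzero: "zigzag_pairings g n \<noteq> 0 \<Longrightarrow> n mod 6 = 0 \<or> (2 * g + n) mod 6 = 0"
proof (induction n arbitrary: g rule: less_induct)
  case (less n)
  show ?case
  proof (cases n)
    case (Suc n')
    obtain m where m: "m < n'" "zigzag_row (Suc (g + m)) = zigzag_row g" "zigzag_pairings (Suc g) m \<noteq> 0" "zigzag_pairings (g + m + 2) (n' - Suc m) \<noteq> 0"
      using less.prems unfolding Suc segment_pairings_Suc by (auto split: if_splits elim!: sum.not_neutral_contains_not_neutral)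
    define l where "l = n' - Suc m"
    have n: "n = m + 2 + l" using m Suc by (simp add: l_def)
    have a: "m mod 6 = 0 \<or> (2 * Suc g + m) mod 6 = 0" using less.IH[of m "Suc g"] m Suc by simp
    have b: "l mod 6 = 0 \<or> (2 * (g + m + 2) + l) mod 6 = 0" using less.IH[of l "g + m + 2"] m Suc by (simp add: l_def)
    have e: "6 dvd 2 * g + m + 2" using partner_distance[OF a m(2)] by (simp only: dvd_eq_mod_eq_0)
    have b': "6 dvd l \<or> 6 dvd 2 * (g + m + 2) + l" using b by (simp only: dvd_eq_mod_eq_0)
    then have "6 dvd (2 * g + m + 2) + l \<or> 6 dvd (2 * g + m + 2) + (m + 2 + l)"
    proof
      assume "6 dvd l"
      then show ?thesis using dvd_add[OF e] by blast
    next
      have "2 * (g + m + 2) + l = (2 * g + m + 2) + (m + 2 + l)" by simp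
      moreover assume "6 dvd 2 * (g + m + 2) + l"
      ultimately show ?thesis by (simp only: simp_thms)
    qed
    moreover have "(2 * g + m + 2) + l = 2 * g + n" using n by simp
    ultimately have "6 dvd n \<or> 6 dvd 2 * g + n" using dvd_add_right_iff[OF e] n by metis
    then show ?thesis by (simp only: dvd_eq_mod_eq_0)
  qed simp
qed

text \<open>The residue of the distance of the partners is determined by the phase, so the recursion becomes a
  convolution over whole periods.\<close>

lemma zigzag_pairings_convolution:
  assumes d: "(2 * g + d + 2) mod 6 = 0" "d < 6" and e: "n = 6 * q + d + 1 + e" and e6: "e < 6"
    and ne: "e mod 6 = 0 \<or> (2 * g + 6 - e) mod 6 = 0"
  shows "zigzag_pairings g (Suc n) = (\<Sum>a\<le>q. zigzag_pairings (Suc g) (6 * a + d) * zigzag_pairings (g + d + 2) (6 * (q - a) + e))"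
proof -
  define f where "f m = (if zigzag_row (Suc (g + m)) = zigzag_row g then zigzag_pairings (Suc g) m * zigzag_pairings (g + m + 2) (n - Suc m) else 0)" for m
  have zero: "f m = 0" if "(2 * g + m + 2) mod 6 \<noteq> 0" for m
  proof (rule ccontr)
    assume "f m \<noteq> 0"
    then have m: "zigzag_row (Suc (g + m)) = zigzag_row g" "zigzag_pairings (Suc g) m \<noteq> 0" by (auto simp: f_def split: if_splits)
    have a: "m mod 6 = 0 \<or> (2 * Suc g + m) mod 6 = 0" using zigzag_pairings_nonzero[OF m(2)] .
    show False using partner_distance[OF a m(1)] that by simp
  qed
  have "zigzag_pairings g (Suc n) = (\<Sum>m<n. f m)" unfolding segment_pairings_Suc f_def ..
  also have "\<dots> = (\<Sum>m\<in>(\<lambda>a. 6 * a + d) ` {..q}. f m)"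
  proof (rule sum.mono_neutral_right)
    show "(\<lambda>a. 6 * a + d) ` {..q} \<subseteq> {..<n}" using e by auto
    show "\<forall>m\<in>{..<n} - (\<lambda>a. 6 * a + d) ` {..q}. f m = 0"
    proof
      fix m assume m: "m \<in> {..<n} - (\<lambda>a. 6 * a + d) ` {..q}"
      show "f m = 0"
      proof (rule zero, rule notI)
        assume z: "(2 * g + m + 2) mod 6 = 0"
        have "m mod 6 = (m + (2 * g + d + 2)) mod 6" using d(1) by (metis mod_add_right_eq add_0_right)
        also have "m + (2 * g + d + 2) = d + (2 * g + m + 2)" by simp
        also have "\<dots> mod 6 = d mod 6" using z by (metis mod_add_right_eq add_0_right)
        finally have "m mod 6 = d" using d(2) by simp
        then have md: "m = 6 * (m div 6) + d" by (metis mult_div_mod_eq)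
        moreover have "m div 6 \<le> q"
        proof (rule ccontr)
          assume "\<not> m div 6 \<le> q"
          then have "6 * Suc q \<le> 6 * (m div 6)" by simp
          then show False using m md e e6 by auto
        qed
        ultimately show False using m by auto
      qed
    qed
  qed simp
  also have "\<dots> = (\<Sum>a\<le>q. f (6 * a + d))" by (subst sum.reindex) (auto simp: inj_on_def)
  also have "\<dots> = (\<Sum>a\<le>q. zigzag_pairings (Suc g) (6 * a + d) * zigzag_pairings (g + d + 2) (6 * (q - a) + e))"
  proof (rule sum.cong)
    fix a assume "a \<in> {..q}"
    then have a: "a \<le> q" by simp
    have r: "zigzag_row (Suc (g + (6 * a + d))) = zigzag_row g"
    proof -
      have "Suc (g + (6 * a + d)) + g + 1 = (2 * g + d + 2) + 6 * a" by simp
      then show ?thesis using d(1) unfolding zigzag_row_eq_iff by (simp only: mod_mult_self2 simp_thms)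
    qed
    have "n - Suc (6 * a + d) = 6 * (q - a) + e" using a e by (simp add: algebra_simps)
    moreover have "zigzag_pairings (g + (6 * a + d) + 2) k = zigzag_pairings (g + d + 2) k" for k
    proof (rule zigzag_pairings_mod)
      have "g + (6 * a + d) + 2 = (g + d + 2) + 6 * a" by simp
      then show "(g + (6 * a + d) + 2) mod 6 = (g + d + 2) mod 6" by (simp only: mod_mult_self2)
    qed
    ultimately show "f (6 * a + d) = zigzag_pairings (Suc g) (6 * a + d) * zigzag_pairings (g + d + 2) (6 * (q - a) + e)"
      using r by (simp add: f_def)
  qed simp
  finally show ?thesis .
qed

text \<open>The generating function of the pairings of zigzag segments that start in phase \<open>g\<close> and have length
  \<open>d\<close> modulo a period.\<close>

definition phase_series :: "nat \<Rightarrow> nat \<Rightarrow> rat fps" where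
  "phase_series g d = Abs_fps (\<lambda>n. of_nat (zigzag_pairings g (6 * n + d)))"

lemma phase_series_mod: "g mod 6 = g' mod 6 \<Longrightarrow> phase_series g d = phase_series g' d"
  unfolding phase_series_def using zigzag_pairings_mod by metis

lemma phase_series_full:
  assumes d: "(2 * g + d + 2) mod 6 = 0" "d \<le> 4"
  shows "phase_series g 0 = 1 + fps_X * (phase_series (Suc g) d * phase_series (g + d + 2) (4 - d))"
proof (rule fps_ext)
  fix n
  show "fps_nth (phase_series g 0) n = fps_nth (1 + fps_X * (phase_series (Suc g) d * phase_series (g + d + 2) (4 - d))) n"
  proof (cases n)
    case 0 then show ?thesis by (simp add: phase_series_def)
  next
    case (Suc q)
    have "zigzag_pairings g (Suc (6 * q + 5)) = (\<Sum>a\<le>q. zigzag_pairings (Suc g) (6 * a + d) * zigzag_pairings (g + d + 2) (6 * (q - a) + (4 - d)))"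
      by (rule zigzag_pairings_convolution) (use d in auto)
    moreover have "6 * Suc q = Suc (6 * q + 5)" by simp
    ultimately have "(of_nat (zigzag_pairings g (6 * Suc q)) :: rat) = of_nat (\<Sum>a\<le>q. zigzag_pairings (Suc g) (6 * a + d) * zigzag_pairings (g + d + 2) (6 * (q - a) + (4 - d)))"
      by simp
    moreover have "fps_nth (1 + fps_X * (phase_series (Suc g) d * phase_series (g + d + 2) (4 - d))) (Suc q) = fps_nth (phase_series (Suc g) d * phase_series (g + d + 2) (4 - d)) q"
      by simp
    moreover have "fps_nth (phase_series (Suc g) d * phase_series (g + d + 2) (4 - d)) q
       = of_nat (\<Sum>a\<le>q. zigzag_pairings (Suc g) (6 * a + d) * zigzag_pairings (g + d + 2) (6 * (q - a) + (4 - d)))"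
      by (simp add: phase_series_def fps_mult_nth atLeast0AtMost of_nat_sum)
    ultimately show ?thesis unfolding Suc by (simp add: phase_series_def)
  qed
qed

lemma phase_series_part:
  assumes d: "(2 * g + d + 2) mod 6 = 0" "d < 4"
  shows "phase_series g (d + 2) = phase_series (Suc g) d * phase_series (g + d + 2) 0"
proof (rule fps_ext)
  fix q
  have "zigzag_pairings g (Suc (6 * q + d + 1)) = (\<Sum>a\<le>q. zigzag_pairings (Suc g) (6 * a + d) * zigzag_pairings (g + d + 2) (6 * (q - a) + 0))"
    by (rule zigzag_pairings_convolution) (use d in auto)
  moreover have "6 * q + (d + 2) = Suc (6 * q + d + 1)" by simp
  ultimately have "(of_nat (zigzag_pairings g (6 * q + (d + 2))) :: rat) = of_nat (\<Sum>a\<le>q. zigzag_pairings (Suc g) (6 * a + d) * zigzag_pairings (g + d + 2) (6 * (q - a) + 0))"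
    by simp
  then show "fps_nth (phase_series g (d + 2)) q = fps_nth (phase_series (Suc g) d * phase_series (g + d + 2) 0) q"
    by (simp add: phase_series_def fps_mult_nth atLeast0AtMost of_nat_sum)
qed

lemma phase_series_full':
  assumes "(2 * g + d + 2) mod 6 = 0" "d + e = 4" "h mod 6 = Suc g mod 6" "h' mod 6 = (g + d + 2) mod 6"
  shows "phase_series g 0 = 1 + fps_X * (phase_series h d * phase_series h' e)"
proof -
  have "e = 4 - d" "d \<le> 4" using assms(2) by auto
  then show ?thesis using phase_series_full[OF assms(1)] phase_series_mod[OF assms(3)] phase_series_mod[OF assms(4)] by simp
qed

lemma phase_series_part':
  assumes "(2 * g + d + 2) mod 6 = 0" "d < 4" "d' = d + 2" "h mod 6 = Suc g mod 6" "h' mod 6 = (g + d + 2) mod 6"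
  shows "phase_series g d' = phase_series h d * phase_series h' 0"
  using phase_series_part[OF assms(1,2)] phase_series_mod[OF assms(4)] phase_series_mod[OF assms(5)] assms(3) by simp

text \<open>This is the equation of the generating function of the Fuss--Catalan numbers.\<close>

lemma phase_series_quartic: "phase_series 0 0 = 1 + fps_X * phase_series 0 0 ^ 4"
proof -
  define F where "F g = phase_series g 0" for g
  have G1: "phase_series 1 4 = phase_series 2 2 * F 5" unfolding F_def by (rule phase_series_part') simp_all
  have G2: "phase_series 2 2 = F 3 * F 4" unfolding F_def by (rule phase_series_part') simp_all
  have G4: "phase_series 4 4 = phase_series 5 2 * F 2" unfolding F_def by (rule phase_series_part') simp_all
  have G5: "phase_series 5 2 = F 0 * F 1" unfolding F_def by (rule phase_series_part') simp_all
  have F0: "F 0 = 1 + fps_X * (phase_series 1 4 * F 0)" unfolding F_def by (rule phase_series_full') simp_all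
  have F1: "F 1 = 1 + fps_X * (phase_series 2 2 * phase_series 5 2)" unfolding F_def by (rule phase_series_full') simp_all
  have F2: "F 2 = 1 + fps_X * (F 3 * phase_series 4 4)" unfolding F_def by (rule phase_series_full') simp_all
  have F3: "F 3 = 1 + fps_X * (phase_series 4 4 * F 3)" unfolding F_def by (rule phase_series_full') simp_all
  have F4: "F 4 = 1 + fps_X * (phase_series 5 2 * phase_series 2 2)" unfolding F_def by (rule phase_series_full') simp_all
  have F5: "F 5 = 1 + fps_X * (F 0 * phase_series 1 4)" unfolding F_def by (rule phase_series_full') simp_all
  have e1: "F 5 = F 0" using F0 F5 by (simp add: mult.commute)
  have e2: "F 4 = F 1" using F1 F4 by (simp add: mult.commute)
  have e3: "F 3 = F 2" using F2 F3 by (simp add: mult.commute)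
  \<comment> \<open>By the symmetry of the word the six series reduce to three, and all three are inverse to
    \<open>1 - w\<close>.\<close>
  define w where "w = fps_X * (F 0 * F 1 * F 2)"
  have c1: "F 0 * (1 - w) = 1" using F0 unfolding G1 G2 e1 e2 e3 w_def by (simp add: algebra_simps)
  have c2: "F 1 * (1 - w) = 1" using F1 unfolding G5 G2 e1 e2 e3 w_def by (simp add: algebra_simps)
  have c3: "F 2 * (1 - w) = 1" using F2 unfolding G4 G5 e1 e2 e3 w_def by (simp add: algebra_simps)
  have "1 - w \<noteq> 0" using c1 by auto
  then have "F 1 = F 0" "F 2 = F 0" using c1 c2 c3 by (metis mult_right_cancel)+
  then have "F 0 * (1 - fps_X * (F 0 * F 0 * F 0)) = 1" using c1 by (simp add: w_def)
  then have "F 0 = 1 + fps_X * F 0 ^ 4" by (simp add: algebra_simps power4_eq_xxxx eval_nat_numeral)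
  then show ?thesis by (simp add: F_def)
qed

text \<open>The solution of the quartic equation satisfies a linear differential equation of order three, whose
  coefficients are compared. Differentiating the quartic equation expresses every derivative of \<open>A\<close>
  as a rational function of \<open>A\<close> with a power of \<open>4 - 3 * A\<close> as denominator.\<close>

lemma quartic_recurrence:
  fixes A :: "'a :: {field_char_0} fps"
  assumes A: "A = 1 + fps_X * A ^ 4"
  shows "fps_nth A (Suc k) * ((3 * of_nat k + 4) * (3 * of_nat k + 3) * (3 * of_nat k + 2)) =
     4 * ((4 * of_nat k + 3) * (4 * of_nat k + 2) * (4 * of_nat k + 1)) * fps_nth A k"
proof -
  \<comment> \<open>The Euler operator multiplies the \<open>n\<close>-th coefficient by \<open>n\<close>.\<close>
  define th where "th f = fps_X * fps_deriv f" for f :: "'a fps"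
  have th_nth: "fps_nth (th f) n = of_nat n * fps_nth f n" for f n
    by (cases n) (auto simp: th_def)
  have th_add: "th (f + g) = th f + th g" for f g by (simp add: th_def algebra_simps)
  have th_diff: "th (f - g) = th f - th g" for f g by (simp add: th_def algebra_simps)
  have th_mult: "th (f * g) = th f * g + f * th g" for f g by (simp add: th_def algebra_simps)
  have th_c: "th (fps_const c) = 0" for c by (simp add: th_def)
  have th_X: "th fps_X = fps_X" by (simp add: th_def)
  have th_num: "th (numeral n) = 0" "th 1 = 0" for n by (simp_all add: th_def)
  define a1 a2 a3 D where "a1 = th A" and "a2 = th a1" and "a3 = th a2" and "D = 4 - 3 * A"
  have A4: "fps_X * A ^ 4 = A - 1" by (metis A add_diff_cancel_left')
  have thA4: "th (A ^ 4) = 4 * A ^ 3 * a1"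
  proof -
    have "A ^ 4 = A * (A * (A * A))" by (simp add: eval_nat_numeral algebra_simps)
    then show ?thesis unfolding a1_def by (simp add: th_mult) (simp add: eval_nat_numeral algebra_simps)
  qed
  have "th (fps_X * A ^ 4) = a1" unfolding A4 by (simp add: th_diff th_num a1_def)
  then have r0: "a1 = fps_X * A ^ 4 + fps_X * (4 * A ^ 3 * a1)" by (simp add: th_mult th_X thA4)
  have r1: "D * a1 = A * (A - 1)"
  proof -
    have "A * a1 = A * (fps_X * A ^ 4) + 4 * (fps_X * A ^ 4) * a1"
      by (subst r0) (simp add: algebra_simps eval_nat_numeral)
    then show ?thesis unfolding A4 D_def by (simp add: algebra_simps)
  qed
  have thD: "th D = - 3 * a1" unfolding D_def a1_def by (simp add: th_diff th_mult th_num)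
  have r2: "D * a2 = (2 * A - 1 + 3 * a1) * a1"
  proof -
    have "th (D * a1) = th (A * (A - 1))" using r1 by simp
    then show ?thesis unfolding th_mult thD a2_def[symmetric] th_diff th_num a1_def[symmetric] by (simp add: algebra_simps)
  qed
  have r3: "D * a3 = 2 * a1 * a1 + (2 * A - 1) * a2 + 9 * a1 * a2"
  proof -
    have "th (D * a2) = th ((2 * A - 1 + 3 * a1) * a1)" using r2 by simp
    then show ?thesis unfolding th_mult thD a3_def[symmetric] a2_def[symmetric] th_diff th_add th_num a1_def[symmetric]
      by (simp add: algebra_simps)
  qed
  \<comment> \<open>The linear differential equation satisfied by \<open>A\<close>. Multiplied by a power of \<open>D\<close>, each of
    \<open>a1, a2, a3\<close> is a polynomial in \<open>A\<close>, and \<open>fps_X\<close> becomes \<open>A - 1\<close> after multiplying by \<open>A ^ 4\<close>.\<close>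
  have key: "27 * a3 - 3 * a1 = 4 * fps_X * (64 * a3 + 96 * a2 + 44 * a1 + 6 * A)"
  proof -
    define P1 where "P1 = A * (A - 1)"
    define P2 where "P2 = (D * (2 * A - 1) + 3 * P1) * P1"
    define P3 where "P3 = 2 * D^2 * P1^2 + D * (2 * A - 1) * P2 + 9 * P1 * P2"
    have q1: "D * a1 = P1" using r1 by (simp add: P1_def)
    have q2: "D ^ 3 * a2 = P2"
    proof -
      have "D ^ 3 * a2 = D^2 * (D * a2)" by (simp add: eval_nat_numeral)
      also have "\<dots> = (D * (2 * A - 1) + 3 * (D * a1)) * (D * a1)" unfolding r2 by (simp add: algebra_simps eval_nat_numeral)
      finally show ?thesis unfolding q1 P2_def .
    qed
    have q3: "D ^ 5 * a3 = P3"
    proof -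
      have "D ^ 5 * a3 = D ^ 4 * (D * a3)" by (simp add: eval_nat_numeral)
      also have "\<dots> = 2 * D^2 * (D * a1)^2 + D * (2 * A - 1) * (D ^ 3 * a2) + 9 * (D * a1) * (D ^ 3 * a2)"
        unfolding r3 by (simp add: algebra_simps eval_nat_numeral)
      finally show ?thesis unfolding q1 q2 P3_def .
    qed
    have "A ^ 4 * D ^ 5 * (27 * a3 - 3 * a1) = A ^ 4 * (27 * (D ^ 5 * a3) - 3 * D ^ 4 * (D * a1))"
      by (simp add: algebra_simps eval_nat_numeral)
    also have "\<dots> = A ^ 4 * (27 * P3 - 3 * D ^ 4 * P1)" unfolding q1 q3 ..
    also have "\<dots> = 4 * (A - 1) * (64 * P3 + 96 * D ^ 2 * P2 + 44 * D ^ 4 * P1 + 6 * D ^ 5 * A)"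
      unfolding P3_def P2_def P1_def D_def by (simp add: algebra_simps eval_nat_numeral)
    also have "\<dots> = 4 * (fps_X * A ^ 4) * (64 * (D ^ 5 * a3) + 96 * D ^ 2 * (D ^ 3 * a2) + 44 * D ^ 4 * (D * a1) + 6 * D ^ 5 * A)"
      unfolding q1 q2 q3 A4 ..
    also have "\<dots> = A ^ 4 * D ^ 5 * (4 * fps_X * (64 * a3 + 96 * a2 + 44 * a1 + 6 * A))"
      by (simp add: algebra_simps eval_nat_numeral)
    finally have eq: "A ^ 4 * D ^ 5 * (27 * a3 - 3 * a1) = A ^ 4 * D ^ 5 * (4 * fps_X * (64 * a3 + 96 * a2 + 44 * a1 + 6 * A))" .
    have A0: "fps_nth A 0 = 1"
    proof -
      show ?thesis using arg_cong[OF A, of "\<lambda>f. fps_nth f 0"] by simp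
    qed
    have "A \<noteq> 0" using A0 by auto
    moreover have "fps_nth D 0 = 1" by (simp add: D_def A0 fps_numeral_nth)
    then have "D \<noteq> 0" by auto
    ultimately show ?thesis using eq by simp
  qed
  have nums: "fps_nth (numeral n * f) m = numeral n * fps_nth f m" for n f m
    by (metis fps_mult_left_const_nth numeral_fps_const)
  have l: "fps_nth (27 * a3 - 3 * a1) (Suc k) = (27 * of_nat (Suc k) ^ 3 - 3 * of_nat (Suc k)) * fps_nth A (Suc k)"
    unfolding a3_def a2_def a1_def fps_sub_nth nums th_nth by (simp add: algebra_simps eval_nat_numeral del: of_nat_Suc)
  have "fps_nth (4 * fps_X * (64 * a3 + 96 * a2 + 44 * a1 + 6 * A)) (Suc k) = fps_nth (4 * (64 * a3 + 96 * a2 + 44 * a1 + 6 * A)) k"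
  proof -
    have "4 * fps_X * (64 * a3 + 96 * a2 + 44 * a1 + 6 * A) = fps_X * (4 * (64 * a3 + 96 * a2 + 44 * a1 + 6 * A))"
      by (simp only: mult_ac)
    then show ?thesis by (simp only: fps_X_mult_nth) simp
  qed
  also have "\<dots> = 4 * ((64 * of_nat k ^ 3 + 96 * of_nat k ^ 2 + 44 * of_nat k + 6) * fps_nth A k)"
    unfolding a3_def a2_def a1_def nums fps_add_nth th_nth by (simp add: algebra_simps eval_nat_numeral)
  finally have "(27 * of_nat (Suc k) ^ 3 - 3 * of_nat (Suc k)) * fps_nth A (Suc k) = 4 * ((64 * of_nat k ^ 3 + 96 * of_nat k ^ 2 + 44 * of_nat k + 6) * fps_nth A k)"
    using key l by simp
  then show ?thesis by (simp add: algebra_simps eval_nat_numeral)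
qed

theorem pairings_recurrence:
  "pairings (zigzag_word (Suc k)) [] * ((3 * k + 4) * (3 * k + 3) * (3 * k + 2)) =
     4 * ((4 * k + 3) * (4 * k + 2) * (4 * k + 1)) * pairings (zigzag_word k) []"
proof -
  have n: "fps_nth (phase_series 0 0) k = of_nat (pairings (zigzag_word k) [])" for k
    by (simp add: phase_series_def segment_pairings_def zigzag_word_def)
  have "of_nat (pairings (zigzag_word (Suc k)) [] * ((3 * k + 4) * (3 * k + 3) * (3 * k + 2))) =
     (of_nat (4 * ((4 * k + 3) * (4 * k + 2) * (4 * k + 1)) * pairings (zigzag_word k) []) :: rat)"
    using quartic_recurrence[OF phase_series_quartic, of k] unfolding n by (simp only: of_nat_mult of_nat_add of_nat_numeral of_nat_1)
  then show ?thesis by (simp only: of_nat_eq_iff)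
qed

section \<open>Moments of singular values\<close>

definition mtrace :: "'a :: comm_ring_1 mat \<Rightarrow> 'a" where
  "mtrace A = (\<Sum>i<dim_row A. A $$ (i, i))"

lemma mtrace_mult_comm:
  assumes A: "A \<in> carrier_mat n n" and B: "B \<in> carrier_mat n n"
  shows "mtrace (A * B) = mtrace (B * A)"
proof -
  have "mtrace (A * B) = (\<Sum>i<n. \<Sum>j<n. A $$ (i, j) * B $$ (j, i))"
    using A B by (auto simp: mtrace_def scalar_prod_def atLeast0LessThan intro!: sum.cong)
  also have "\<dots> = (\<Sum>j<n. \<Sum>i<n. A $$ (i, j) * B $$ (j, i))" by (rule sum.swap)
  also have "\<dots> = mtrace (B * A)"
    using A B by (auto simp: mtrace_def scalar_prod_def atLeast0LessThan mult.commute intro!: sum.cong)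
  finally show ?thesis .
qed

lemma upper_triangular_power:
  fixes B :: "'a :: comm_ring_1 mat"
  assumes B: "B \<in> carrier_mat n n" "upper_triangular B"
  shows "upper_triangular (B ^\<^sub>m k) \<and> (\<forall>i<n. (B ^\<^sub>m k) $$ (i, i) = (B $$ (i, i)) ^ k)"
proof (induction k)
  case 0
  show ?case using B by (auto intro!: upper_triangularI)
next
  case (Suc k)
  have P: "B ^\<^sub>m k \<in> carrier_mat n n" using B by simp
  have entry: "(B ^\<^sub>m Suc k) $$ (i, j) = (\<Sum>l<n. (B ^\<^sub>m k) $$ (i, l) * B $$ (l, j))" if "i < n" "j < n" for i j
    using P B that by (auto simp: scalar_prod_def atLeast0LessThan intro!: sum.cong)
  have z1: "(B ^\<^sub>m k) $$ (i, l) = 0" if "l < i" "i < n" for i l using Suc P that by (auto dest!: upper_triangularD)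
  have z2: "B $$ (l, j) = 0" if "j < l" "l < n" for l j using B that by (auto dest!: upper_triangularD)
  have "upper_triangular (B ^\<^sub>m Suc k)"
  proof (rule upper_triangularI)
    fix i j assume ij: "j < i" "i < dim_row (B ^\<^sub>m Suc k)"
    then have n: "i < n" "j < n" using B by auto
    have "(B ^\<^sub>m k) $$ (i, l) * B $$ (l, j) = 0" if "l < n" for l
      using z1[of l i] z2[of j l] ij n that by (cases "l < i") auto
    then show "(B ^\<^sub>m Suc k) $$ (i, j) = 0" unfolding entry[OF n] by (intro sum.neutral) auto
  qed
  moreover have "(B ^\<^sub>m Suc k) $$ (i, i) = (B $$ (i, i)) ^ Suc k" if i: "i < n" for i
  proof -
    have "(\<Sum>l<n. (B ^\<^sub>m k) $$ (i, l) * B $$ (l, i)) = (\<Sum>l<n. if l = i then (B ^\<^sub>m k) $$ (i, i) * B $$ (i, i) else 0)"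
    proof (rule sum.cong)
      fix l assume "l \<in> {..<n}"
      then show "(B ^\<^sub>m k) $$ (i, l) * B $$ (l, i) = (if l = i then (B ^\<^sub>m k) $$ (i, i) * B $$ (i, i) else 0)"
        using z1[of l i] z2[of i l] i by (cases l i rule: linorder_cases) auto
    qed simp
    also have "\<dots> = (B $$ (i, i)) ^ Suc k" using Suc i by simp
    finally show ?thesis unfolding entry[OF i i] .
  qed
  ultimately show ?case by blast
qed

text \<open>By the Schur decomposition the matrix is similar to a triangular one.\<close>

lemma mtrace_power_eigenvalues:
  fixes A :: "real mat"
  assumes A: "A \<in> carrier_mat n n" and es: "char_poly A = (\<Prod>e\<leftarrow>es. [:- e, 1:])"
  shows "mtrace (A ^\<^sub>m k) = (\<Sum>e\<leftarrow>es. e ^ k)"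
proof -
  obtain B P Q where s: "schur_decomposition A es = (B, P, Q)" by (metis prod_cases3)
  from schur_decomposition[OF A es s] have sim: "similar_mat_wit A B P Q" and ut: "upper_triangular B" and d: "diag_mat B = es" by auto
  from similar_mat_witD2[OF A sim] have B: "B \<in> carrier_mat n n" and P: "P \<in> carrier_mat n n" and Q: "Q \<in> carrier_mat n n"
    and QP: "Q * P = 1\<^sub>m n" by auto
  have Bk: "B ^\<^sub>m k \<in> carrier_mat n n" using B by simp
  have "A ^\<^sub>m k = P * (B ^\<^sub>m k) * Q" by (rule similar_mat_wit_pow_id[OF sim])
  then have "mtrace (A ^\<^sub>m k) = mtrace ((P * (B ^\<^sub>m k)) * Q)" by simp
  also have "\<dots> = mtrace (Q * (P * (B ^\<^sub>m k)))" by (rule mtrace_mult_comm) (use P Bk Q in auto)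
  also have "Q * (P * (B ^\<^sub>m k)) = (Q * P) * (B ^\<^sub>m k)" using P Q Bk by (simp add: assoc_mult_mat[of _ n n _ n _ n])
  also have "\<dots> = B ^\<^sub>m k" unfolding QP by (rule left_mult_one_mat[OF Bk])
  also have "mtrace (B ^\<^sub>m k) = (\<Sum>i<n. (B $$ (i, i)) ^ k)"
    using upper_triangular_power[OF B ut, of k] Bk by (auto simp: mtrace_def intro!: sum.cong)
  also have "\<dots> = (\<Sum>e\<leftarrow>es. e ^ k)"
    unfolding d[symmetric] diag_mat_def using B by (simp add: sum_list_sum_nth atLeast0LessThan comp_def)
  finally show ?thesis .
qed

text \<open>For an eigenvector \<open>v\<close> one has \<open>z (v, v) = (M v, M v)\<close> with the Hermitian inner product.\<close>

lemma gram_eigenvalue_nonneg: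
  fixes M :: "real mat"
  assumes M: "M \<in> carrier_mat n n" and ev: "eigenvalue (map_mat complex_of_real (transpose_mat M * M)) z"
  shows "\<exists>r\<ge>0. z = complex_of_real r"
proof -
  define C where "C = map_mat complex_of_real M"
  have C: "C \<in> carrier_mat n n" using M by (simp add: C_def)
  have MM: "map_mat complex_of_real (transpose_mat M * M) = transpose_mat C * C"
  proof -
    have "map_mat complex_of_real (transpose_mat M) = transpose_mat C" using M by (auto simp: C_def intro!: eq_matI)
    moreover have "map_mat complex_of_real (transpose_mat M * M) = map_mat complex_of_real (transpose_mat M) * C"
      unfolding C_def by (rule of_real_hom.mat_hom_mult[of _ n n _ n]) (use M in auto)
    ultimately show ?thesis by simp
  qed
  obtain v where v: "v \<in> carrier_vec n" "v \<noteq> 0\<^sub>v n" "(transpose_mat C * C) *\<^sub>v v = z \<cdot>\<^sub>v v"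
    using ev C unfolding MM eigenvalue_def eigenvector_def by auto
  define w where "w = C *\<^sub>v v"
  have w: "w \<in> carrier_vec n" using C v by (simp add: w_def)
  have conj_w: "C *\<^sub>v conjugate v = conjugate w"
  proof (rule eq_vecI)
    show "dim_vec (C *\<^sub>v conjugate v) = dim_vec (conjugate w)" using C w by simp
    fix i assume "i < dim_vec (conjugate w)"
    then have i: "i < n" using w by simp
    have "(C *\<^sub>v conjugate v) $ i = (\<Sum>j<n. C $$ (i, j) * cnj (v $ j))"
      using C v i by (auto simp: scalar_prod_def atLeast0LessThan intro!: sum.cong)
    also have "\<dots> = cnj (\<Sum>j<n. C $$ (i, j) * v $ j)"
      using M i unfolding C_def by (auto simp: intro!: sum.cong)
    also have "(\<Sum>j<n. C $$ (i, j) * v $ j) = w $ i"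
      using C v i by (auto simp: w_def scalar_prod_def atLeast0LessThan intro!: sum.cong)
    finally show "(C *\<^sub>v conjugate v) $ i = conjugate w $ i" using w i by simp
  qed
  have "z * (v \<bullet>c v) = (z \<cdot>\<^sub>v v) \<bullet>c v" using v by simp
  also have "\<dots> = (transpose_mat C *\<^sub>v w) \<bullet>c v"
    unfolding v(3)[symmetric] w_def using C v by (subst assoc_mult_mat_vec[of _ n n _ n]) auto
  also have "\<dots> = w \<bullet> (C *\<^sub>v conjugate v)"
    by (rule transpose_vec_mult_scalar[OF C]) (use v w in auto)
  also have "\<dots> = w \<bullet>c w" unfolding conj_w ..
  finally have zv: "z * (v \<bullet>c v) = w \<bullet>c w" .
  have vv: "v \<bullet>c v > 0" using v by simp
  have ww: "w \<bullet>c w \<ge> 0" by (rule conjugate_square_ge_0_vec)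
  define p q where "p = Re (v \<bullet>c v)" and "q = Re (w \<bullet>c w)"
  have p: "0 < p" "v \<bullet>c v = complex_of_real p" using vv by (auto simp: p_def less_complex_def complex_eq_iff)
  have q: "0 \<le> q" "w \<bullet>c w = complex_of_real q" using ww by (auto simp: q_def less_eq_complex_def complex_eq_iff)
  have "z = complex_of_real (q / p)" using zv p q by (simp add: field_simps)
  then show ?thesis using p q by (intro exI[of _ "q / p"]) auto
qed

lemma gram_char_poly:
  fixes M :: "real mat"
  assumes M: "M \<in> carrier_mat n n"
  obtains es where "char_poly (transpose_mat M * M) = (\<Prod>e\<leftarrow>es. [:- e, 1:])" "length es = n" "\<And>e. e \<in> set es \<Longrightarrow> 0 \<le> e"
proof -
  let ?A = "transpose_mat M * M"
  let ?C = "map_mat complex_of_real ?A"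
  have A: "?A \<in> carrier_mat n n" using M by simp
  have C: "?C \<in> carrier_mat n n" using A by simp
  obtain as where as: "char_poly ?C = (\<Prod>a\<leftarrow>as. [:- a, 1:])" "length as = n" using char_poly_factorized[OF C] by blast
  have "\<exists>r\<ge>0. a = complex_of_real r" if "a \<in> set as" for a
  proof -
    have "poly (char_poly ?C) a = 0" unfolding as(1) using that by (auto simp: poly_prod_list prod_list_zero_iff image_iff intro!: bexI[of _ a])
    then have "eigenvalue ?C a" using eigenvalue_root_char_poly[OF C] by simp
    then show ?thesis by (rule gram_eigenvalue_nonneg[OF M])
  qed
  then obtain r where r: "\<And>a. a \<in> set as \<Longrightarrow> 0 \<le> r a \<and> a = complex_of_real (r a)" by metis
  define es where "es = map r as"
  have as_es: "as = map complex_of_real es" using r by (simp add: es_def map_idI)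
  interpret h: map_poly_inj_comm_ring_hom complex_of_real ..
  have "map_poly complex_of_real (char_poly ?A) = char_poly ?C" by (rule of_real_hom.char_poly_hom[OF A, symmetric])
  also have "\<dots> = map_poly complex_of_real (\<Prod>e\<leftarrow>es. [:- e, 1:])"
    unfolding as(1) as_es by (simp add: h.hom_prod_list comp_def)
  finally have "char_poly ?A = (\<Prod>e\<leftarrow>es. [:- e, 1:])" by simp
  then show thesis using that[of es] as(2) r by (auto simp: es_def)
qed

lemma sum_mset_count: "(\<Sum>x\<in>#A. (h x :: real)) = (\<Sum>x\<in>set_mset A. real (count A x) * h x)"
proof -
  have "(\<Sum>x\<in>#A. h x) = (\<Sum>x\<in>S. real (count A x) * h x)" if "finite S" "set_mset A \<subseteq> S" for S
    using that(2)
  proof (induction A)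
    case (add a A)
    have "(\<Sum>x\<in>S. real (count (add_mset a A) x) * h x) = (\<Sum>x\<in>S. real (count A x) * h x + (if x = a then h a else 0))"
      by (rule sum.cong) (auto simp: algebra_simps)
    also have "\<dots> = (\<Sum>x\<in>S. real (count A x) * h x) + h a" using add.prems that(1) by (simp add: sum.distrib)
    finally show ?case using add by simp
  qed simp
  then show ?thesis by simp
qed

lemma expectation_pmf_of_multiset:
  assumes "A \<noteq> {#}"
  shows "measure_pmf.expectation (pmf_of_multiset A) h = (\<Sum>x\<in>#A. (h x :: real)) / real (size A)"
proof -
  have "measure_pmf.expectation (pmf_of_multiset A) h = (\<Sum>x\<in>set_mset A. h x * pmf (pmf_of_multiset A) x)"
    by (rule integral_measure_pmf_real) (use assms in \<open>auto simp: set_pmf_of_multiset\<close>)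
  also have "\<dots> = (\<Sum>x\<in>set_mset A. real (count A x) * h x) / real (size A)"
    using assms by (simp add: pmf_of_multiset sum_divide_distrib mult.commute)
  finally show ?thesis by (simp add: sum_mset_count)
qed

lemma singular_values_gram:
  assumes M: "M \<in> carrier_mat n n" and es: "char_poly (transpose_mat M * M) = (\<Prod>e\<leftarrow>es. [:- e, 1:])"
  shows "singular_values M = image_mset sqrt (mset es)"
proof -
  have "proots (\<Prod>e\<leftarrow>es. [:- e, 1:]) = mset es"
  proof (induction es)
    case (Cons e es)
    have "(\<Prod>e\<leftarrow>es. [:- e, 1:]) \<noteq> 0" by (auto simp: prod_list_zero_iff)
    then show ?case using Cons by (simp add: proots_mult del: mult_pCons_left)
  qed simp
  then show ?thesis by (simp add: singular_values_def es)
qed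

lemma real_distribution_singular_value: "real_distribution (singular_value_distribution M)"
  unfolding singular_value_distribution_def
  by (rule prob_space.real_distribution_distr[OF measure_pmf.prob_space_axioms]) simp

lemma integrable_singular_value_power:
  assumes "singular_values M \<noteq> {#}"
  shows "integrable (singular_value_distribution M) (\<lambda>x. x ^ k)"
proof -
  have "finite (set_pmf (pmf_of_multiset (singular_values M)))" using assms by (simp add: set_pmf_of_multiset)
  then have "integrable (measure_pmf (pmf_of_multiset (singular_values M))) (\<lambda>x. x ^ k)" by (rule integrable_measure_pmf_finite)
  then show ?thesis unfolding singular_value_distribution_def by (subst integrable_distr_eq) auto
qed

lemma singular_value_nonneg:
  assumes M: "M \<in> carrier_mat n n" and n: "0 < n"
  shows "AE x in singular_value_distribution M. 0 \<le> x" "singular_values M \<noteq> {#}"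
proof -
  obtain es where es: "char_poly (transpose_mat M * M) = (\<Prod>e\<leftarrow>es. [:- e, 1:])" "length es = n" "\<And>e. e \<in> set es \<Longrightarrow> 0 \<le> e"
    by (rule gram_char_poly[OF M]) blast
  have sv: "singular_values M = image_mset sqrt (mset es)" by (rule singular_values_gram[OF M es(1)])
  show ne: "singular_values M \<noteq> {#}" unfolding sv using es(2) n by auto
  have "AE x in measure_pmf (pmf_of_multiset (singular_values M)). 0 \<le> x"
    using ne es(3) by (auto simp: AE_measure_pmf_iff set_pmf_of_multiset sv)
  then show "AE x in singular_value_distribution M. 0 \<le> x"
    unfolding singular_value_distribution_def by (subst AE_distr_iff) auto
qed

lemma singular_value_moment:
  assumes M: "M \<in> carrier_mat n n" and n: "0 < n"
  shows "(\<integral>x. x ^ (2 * k) \<partial>singular_value_distribution M) = mtrace ((transpose_mat M * M) ^\<^sub>m k) / real n"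
proof -
  obtain es where es: "char_poly (transpose_mat M * M) = (\<Prod>e\<leftarrow>es. [:- e, 1:])" "length es = n" "\<And>e. e \<in> set es \<Longrightarrow> 0 \<le> e"
    by (rule gram_char_poly[OF M]) blast
  have sv: "singular_values M = image_mset sqrt (mset es)" by (rule singular_values_gram[OF M es(1)])
  have ne: "singular_values M \<noteq> {#}" by (rule singular_value_nonneg[OF M n])
  have "(\<integral>x. x ^ (2 * k) \<partial>singular_value_distribution M) = measure_pmf.expectation (pmf_of_multiset (singular_values M)) (\<lambda>x. x ^ (2 * k))"
    unfolding singular_value_distribution_def by (subst integral_distr) auto
  also have "\<dots> = (\<Sum>x\<in>#singular_values M. x ^ (2 * k)) / real (size (singular_values M))" by (rule expectation_pmf_of_multiset[OF ne])
  also have "size (singular_values M) = n" using es(2) by (simp add: sv)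
  also have "(\<Sum>x\<in>#singular_values M. x ^ (2 * k)) = (\<Sum>e\<leftarrow>es. e ^ k)"
  proof -
    have "(\<Sum>x\<in>#singular_values M. x ^ (2 * k)) = (\<Sum>e\<leftarrow>es. sqrt e ^ (2 * k))"
      unfolding sv by (simp add: image_mset.compositionality comp_def sum_mset_sum_list[symmetric] del: sum_mset_sum_list)
    also have "\<dots> = (\<Sum>e\<leftarrow>es. e ^ k)" by (rule arg_cong[where f = sum_list], rule map_cong) (use es(3) in \<open>auto simp: power_mult\<close>)
    finally show ?thesis .
  qed
  also have "\<dots> = mtrace ((transpose_mat M * M) ^\<^sub>m k)"
    using mtrace_power_eigenvalues[OF _ es(1), of n k] M by simp
  finally show ?thesis .
qed

section \<open>Traces as sums over closed walks\<close>

text \<open>Entries of a product of matrices whose factors \<open>K m\<close> may vary with the position.\<close>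

fun walk_sum :: "'s set \<Rightarrow> (nat \<Rightarrow> 's \<Rightarrow> 's \<Rightarrow> real) \<Rightarrow> nat \<Rightarrow> 's \<Rightarrow> 's \<Rightarrow> real" where
  "walk_sum S K 0 x y = (if x = y then 1 else 0)"
| "walk_sum S K (Suc m) x y = (\<Sum>z\<in>S. walk_sum S K m x z * K m z y)"

lemma walk_sum_paths:
  assumes S: "finite S" and x: "x \<in> S"
  shows "walk_sum S K (Suc m) x y =
    (\<Sum>c | c \<in> {..m} \<rightarrow>\<^sub>E S \<and> c 0 = x. (\<Prod>j<m. K j (c j) (c (Suc j))) * K m (c m) y)"
proof (induction m arbitrary: y)
  case 0
  have "{c. c \<in> {..0::nat} \<rightarrow>\<^sub>E S \<and> c 0 = x} = {\<lambda>j\<in>{..0}. x}"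
    using x by (auto simp: PiE_def extensional_def fun_eq_iff)
  moreover have "walk_sum S K (Suc 0) x y = K 0 x y" using S x by (simp add: if_distrib[of "\<lambda>a. a * _"] sum.delta cong: if_cong)
  ultimately show ?case by simp
next
  case (Suc m)
  let ?P = "\<lambda>m::nat. {c. c \<in> {..m} \<rightarrow>\<^sub>E S \<and> c 0 = x}"
  have fin: "finite (?P m)" for m by (rule finite_subset[of _ "{..m} \<rightarrow>\<^sub>E S"]) (use S in \<open>auto intro!: finite_PiE\<close>)
  have "walk_sum S K (Suc (Suc m)) x y = (\<Sum>z\<in>S. walk_sum S K (Suc m) x z * K (Suc m) z y)" by simp
  also have "\<dots> = (\<Sum>z\<in>S. \<Sum>c\<in>?P m. (\<Prod>j<m. K j (c j) (c (Suc j))) * K m (c m) z * K (Suc m) z y)"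
    unfolding Suc by (simp only: sum_distrib_right)
  also have "\<dots> = (\<Sum>(z, c)\<in>S \<times> ?P m. (\<Prod>j<m. K j (c j) (c (Suc j))) * K m (c m) z * K (Suc m) z y)"
    by (rule sum.cartesian_product)
  also have "\<dots> = (\<Sum>c\<in>?P (Suc m). (\<Prod>j<Suc m. K j (c j) (c (Suc j))) * K (Suc m) (c (Suc m)) y)"
  proof (rule sum.reindex_bij_witness[where i = "\<lambda>c. (c (Suc m), restrict c {..m})" and j = "\<lambda>(z, c). c(Suc m := z)"])
    fix p assume "p \<in> S \<times> ?P m"
    then obtain z c where p: "p = (z, c)" "z \<in> S" "c \<in> {..m} \<rightarrow>\<^sub>E S" "c 0 = x" by auto
    have "restrict (c(Suc m := z)) {..m} = c" using p(3) by (auto simp: fun_eq_iff restrict_def PiE_def extensional_def)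
    then show "((case p of (z, c) \<Rightarrow> c(Suc m := z)) (Suc m), restrict (case p of (z, c) \<Rightarrow> c(Suc m := z)) {..m}) = p" using p by simp
    show "(case p of (z, c) \<Rightarrow> c(Suc m := z)) \<in> ?P (Suc m)" using p by (auto simp: PiE_def extensional_def Pi_def)
    have "(\<Prod>j<m. K j ((c(Suc m := z)) j) ((c(Suc m := z)) (Suc j))) = (\<Prod>j<m. K j (c j) (c (Suc j)))"
      by (rule prod.cong) auto
    then show "(\<Prod>j<Suc m. K j ((case p of (z, c) \<Rightarrow> c(Suc m := z)) j) ((case p of (z, c) \<Rightarrow> c(Suc m := z)) (Suc j))) *
        K (Suc m) ((case p of (z, c) \<Rightarrow> c(Suc m := z)) (Suc m)) y =
        (case p of (z, c) \<Rightarrow> (\<Prod>j<m. K j (c j) (c (Suc j))) * K m (c m) z * K (Suc m) z y)"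
      using p by simp
  next
    fix c assume "c \<in> ?P (Suc m)"
    then have c: "c \<in> {..Suc m} \<rightarrow>\<^sub>E S" "c 0 = x" by auto
    show "(case (c (Suc m), restrict c {..m}) of (z, c) \<Rightarrow> c(Suc m := z)) = c"
      using c by (auto simp: fun_eq_iff PiE_def extensional_def)
    show "(c (Suc m), restrict c {..m}) \<in> S \<times> ?P m" using c by (auto simp: PiE_def Pi_def)
  qed
  finally show ?case .
qed

lemma walk_sum_closed:
  assumes S: "finite S" and m: "0 < m"
  shows "(\<Sum>x\<in>S. walk_sum S K m x x) = (\<Sum>c\<in>{..<m} \<rightarrow>\<^sub>E S. \<Prod>j<m. K j (c j) (c (Suc j mod m)))"
proof -
  obtain m' where m': "m = Suc m'" using m by (cases m) auto
  let ?f = "\<lambda>c. \<Prod>j<m. K j (c j) (c (Suc j mod m))"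
  have fin: "finite ({..<m} \<rightarrow>\<^sub>E S)" using S by (intro finite_PiE) auto
  have "(\<Sum>x\<in>S. walk_sum S K m x x) = (\<Sum>x\<in>S. \<Sum>c | c \<in> {..<m} \<rightarrow>\<^sub>E S \<and> c 0 = x. ?f c)"
  proof (rule sum.cong)
    fix x assume x: "x \<in> S"
    have "(\<Prod>j<m'. K j (c j) (c (Suc j))) * K m' (c m') x = ?f c" if "c 0 = x" for c
      unfolding m' prod.lessThan_Suc using that by (auto intro!: prod.cong arg_cong2[where f = "(*)"])
    then show "walk_sum S K m x x = (\<Sum>c | c \<in> {..<m} \<rightarrow>\<^sub>E S \<and> c 0 = x. ?f c)"
      unfolding m' walk_sum_paths[OF S x] lessThan_Suc_atMost by (intro sum.cong) (auto simp: m' lessThan_Suc_atMost)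
  qed simp
  also have "\<dots> = (\<Sum>c\<in>{..<m} \<rightarrow>\<^sub>E S. ?f c)"
    by (rule sum.group[OF fin S]) (use m in \<open>auto simp: PiE_def Pi_def\<close>)
  finally show ?thesis .
qed

lemma gram_power_entry:
  fixes B :: "'s \<Rightarrow> 's \<Rightarrow> real" and xs :: "'s list"
  assumes d: "distinct xs" and M: "M = mat (length xs) (length xs) (\<lambda>(i, j). B (xs ! i) (xs ! j))"
    and i: "i < length xs" and j: "j < length xs"
  shows "((transpose_mat M * M) ^\<^sub>m k) $$ (i, j) = walk_sum (set xs) (\<lambda>l x y. if even l then B y x else B x y) (2 * k) (xs ! i) (xs ! j)"
  using j
proof (induction k arbitrary: j)
  case 0
  then show ?case using d i M by (simp add: nth_eq_iff_index_eq)
next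
  case (Suc k)
  let ?n = "length xs" and ?S = "set xs" and ?K = "\<lambda>l x y. if even l then B y x else B x y"
  let ?A = "transpose_mat M * M"
  have Mc: "M \<in> carrier_mat ?n ?n" using M by simp
  have Ac: "?A \<in> carrier_mat ?n ?n" using Mc by simp
  have re: "(\<Sum>z\<in>?S. h z) = (\<Sum>l<?n. h (xs ! l))" for h :: "'s \<Rightarrow> real"
    using d by (simp add: sum.distinct_set_conv_list sum_list_sum_nth atLeast0LessThan)
  have A: "?A $$ (l, j) = (\<Sum>a<?n. B (xs ! a) (xs ! l) * B (xs ! a) (xs ! j))" if "l < ?n" "j < ?n" for l j
    using that by (auto simp: M scalar_prod_def atLeast0LessThan intro!: sum.cong)
  have "(?A ^\<^sub>m Suc k) $$ (i, j) = (\<Sum>l<?n. (?A ^\<^sub>m k) $$ (i, l) * ?A $$ (l, j))"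
    using Ac i Suc.prems pow_carrier_mat[OF Ac, of k] by (auto simp: scalar_prod_def atLeast0LessThan intro!: sum.cong)
  also have "\<dots> = (\<Sum>l<?n. \<Sum>a<?n. walk_sum ?S ?K (2 * k) (xs ! i) (xs ! l) * B (xs ! a) (xs ! l) * B (xs ! a) (xs ! j))"
    using Suc A by (simp add: sum_distrib_left mult.assoc)
  also have "\<dots> = (\<Sum>a<?n. (\<Sum>l<?n. walk_sum ?S ?K (2 * k) (xs ! i) (xs ! l) * B (xs ! a) (xs ! l)) * B (xs ! a) (xs ! j))"
    by (subst sum.swap) (simp add: sum_distrib_right)
  also have "\<dots> = (\<Sum>a<?n. walk_sum ?S ?K (Suc (2 * k)) (xs ! i) (xs ! a) * B (xs ! a) (xs ! j))"
    by (simp add: re)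
  also have "\<dots> = walk_sum ?S ?K (Suc (Suc (2 * k))) (xs ! i) (xs ! j)"
    by (subst walk_sum.simps(2)) (simp add: re del: walk_sum.simps)
  finally show ?case by (simp del: walk_sum.simps)
qed

text \<open>The factors \<open>M\<^sup>T\<close> and \<open>M\<close> alternate along the walk, so the arguments of \<open>B\<close> are exchanged in
  every other step.\<close>

lemma mtrace_gram_power:
  fixes B :: "'s \<Rightarrow> 's \<Rightarrow> real" and xs :: "'s list"
  assumes d: "distinct xs" and M: "M = mat (length xs) (length xs) (\<lambda>(i, j). B (xs ! i) (xs ! j))" and k: "0 < k"
  shows "mtrace ((transpose_mat M * M) ^\<^sub>m k) =
    (\<Sum>c\<in>{..<2 * k} \<rightarrow>\<^sub>E set xs. \<Prod>j<2 * k. if even j then B (c (Suc j mod (2 * k))) (c j) else B (c j) (c (Suc j mod (2 * k))))"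
proof -
  let ?K = "\<lambda>l x y. if even l then B y x else B x y"
  have Mc: "M \<in> carrier_mat (length xs) (length xs)" using M by simp
  have Ac: "(transpose_mat M * M) ^\<^sub>m k \<in> carrier_mat (length xs) (length xs)" using Mc by (intro pow_carrier_mat) simp
  have "mtrace ((transpose_mat M * M) ^\<^sub>m k) = (\<Sum>i<length xs. walk_sum (set xs) ?K (2 * k) (xs ! i) (xs ! i))"
    unfolding mtrace_def using Ac gram_power_entry[OF d M] by (auto intro!: sum.cong)
  also have "\<dots> = (\<Sum>x\<in>set xs. walk_sum (set xs) ?K (2 * k) x x)"
    using d by (simp add: sum.distinct_set_conv_list sum_list_sum_nth atLeast0LessThan)
  also have "\<dots> = (\<Sum>c\<in>{..<2 * k} \<rightarrow>\<^sub>E set xs. \<Prod>j<2 * k. ?K j (c j) (c (Suc j mod (2 * k))))"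
    by (rule walk_sum_closed) (use k in auto)
  finally show ?thesis .
qed

section \<open>Moments from the differential equation\<close>

context
  fixes a :: real
    and f f' f'' f''' :: "real \<Rightarrow> real"
  assumes a: "a = 16 / (3 * sqrt 3)"
    and f': "\<And>x. x \<in> {0<..<a} \<Longrightarrow> (f has_real_derivative f' x) (at x)"
    and f'': "\<And>x. x \<in> {0<..<a} \<Longrightarrow> (f' has_real_derivative f'' x) (at x)"
    and f''': "\<And>x. x \<in> {0<..<a} \<Longrightarrow> (f'' has_real_derivative f''' x) (at x)"
    and ode: "\<And>x. x \<in> {0<..<a} \<Longrightarrow>
      (27 * x ^ 4 - 256 * x ^ 2) * f''' x + (162 * x ^ 3 - 768 * x) * f'' x
        + (177 * x ^ 2 - 192) * f' x + 15 * x * f x = 0"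
    and int: "(f has_integral 1) {0<..<a}"
    and lim_a_0: "(f \<longlongrightarrow> 0) (at_left a)"
    and lim_a_1: "((\<lambda>x. (x - a) * f' x) \<longlongrightarrow> 0) (at_left a)"
    and lim_a_2: "((\<lambda>x. 2 * (x - a) * f'' x + f' x) \<longlongrightarrow> 0) (at_left a)"
    and lim_0_0: "((\<lambda>x. x * f x) \<longlongrightarrow> 0) (at_right 0)"
    and lim_0_1: "((\<lambda>x. x ^ 2 * f' x) \<longlongrightarrow> 0) (at_right 0)"
    and lim_0_2: "((\<lambda>x. x ^ 3 * f'' x) \<longlongrightarrow> 0) (at_right 0)"
begin

lemma a_pos: "0 < a" unfolding a by simp
lemma a_sq: "27 * a^2 = 256" unfolding a by (simp add: power_divide power_mult_distrib)

text \<open>The boundary terms that arise when \<open>x ^ (2 k + 1)\<close> times the left hand side of the differential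
  equation is integrated by parts until only \<open>f\<close> is left under the integral.\<close>

definition boundary :: "nat \<Rightarrow> real \<Rightarrow> real" where
  "boundary k x = (let p = real (2 * k + 1) in
     x ^ (2 * k) * ((27 * x ^ 5 - 256 * x ^ 3) * f'' x
     + ((54 - 27 * p) * x ^ 4 + 256 * (p - 1) * x ^ 2) * f' x
     + ((27 * (p + 4) * (p + 3) - 162 * (p + 3) + 177) * x ^ 3 - (256 * (p + 2) * (p + 1) - 768 * (p + 1) + 192) * x) * f x))"

definition next_coeff where "next_coeff k = 8 * ((3 * real k + 4) * (3 * real k + 3) * (3 * real k + 2))"
definition this_coeff where "this_coeff k = 32 * ((4 * real k + 3) * (4 * real k + 2) * (4 * real k + 1))"

lemma boundary_deriv:
  assumes x: "x \<in> {0<..<a}"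
  shows "(boundary k has_real_derivative (next_coeff k * x ^ (2 * k + 2) - this_coeff k * x ^ (2 * k)) * f x) (at x)"
proof -
  define p where "p = real (2 * k + 1)"
  have p: "p = 2 * real k + 1" by (simp add: p_def)
  define h where "h x = (27 * x ^ 5 - 256 * x ^ 3) * f'' x
     + ((54 - 27 * p) * x ^ 4 + 256 * (p - 1) * x ^ 2) * f' x
     + ((27 * (p + 4) * (p + 3) - 162 * (p + 3) + 177) * x ^ 3 - (256 * (p + 2) * (p + 1) - 768 * (p + 1) + 192) * x) * f x" for x
  define h' where "h' = (27 * x ^ 5 - 256 * x ^ 3) * f''' x + (135 * x ^ 4 - 768 * x ^ 2) * f'' x
     + ((54 - 27 * p) * x ^ 4 + 256 * (p - 1) * x ^ 2) * f'' x + ((54 - 27 * p) * 4 * x ^ 3 + 256 * (p - 1) * 2 * x) * f' x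
     + ((27 * (p + 4) * (p + 3) - 162 * (p + 3) + 177) * x ^ 3 - (256 * (p + 2) * (p + 1) - 768 * (p + 1) + 192) * x) * f' x
     + ((27 * (p + 4) * (p + 3) - 162 * (p + 3) + 177) * 3 * x ^ 2 - (256 * (p + 2) * (p + 1) - 768 * (p + 1) + 192)) * f x"
  have h: "(h has_real_derivative h') (at x)"
    unfolding h_def h'_def
    by (rule derivative_eq_intros refl f'[OF x] f''[OF x] f'''[OF x])+ (simp add: algebra_simps)
  have b: "boundary k = (\<lambda>x. x ^ (2 * k) * h x)" by (simp add: boundary_def h_def p_def Let_def fun_eq_iff)
  have pw: "((\<lambda>x. x ^ (2 * k)) has_real_derivative 2 * real k * x ^ (2 * k - 1)) (at x)"
    by (auto intro!: derivative_eq_intros)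
  have "(boundary k has_real_derivative (2 * real k * x ^ (2 * k - 1)) * h x + h' * x ^ (2 * k)) (at x)"
    unfolding b by (rule DERIV_mult[OF pw h])
  moreover have E1: "(2 * real k * x ^ (2 * k - 1)) * h x = x ^ (2 * k) * (2 * real k * (h x / x))"
    using x by (cases k) auto
  moreover have E2: "2 * real k * (h x / x) + h' = (next_coeff k * x ^ 2 - this_coeff k) * f x"
  proof -
    have hx: "h x / x = (27 * x ^ 4 - 256 * x ^ 2) * f'' x
     + ((54 - 27 * p) * x ^ 3 + 256 * (p - 1) * x) * f' x
     + ((27 * (p + 4) * (p + 3) - 162 * (p + 3) + 177) * x ^ 2 - (256 * (p + 2) * (p + 1) - 768 * (p + 1) + 192)) * f x"
      unfolding h_def using x by (simp add: field_simps eval_nat_numeral)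
    have "2 * real k * (h x / x) + h' - (next_coeff k * x ^ 2 - this_coeff k) * f x =
       x * ((27 * x ^ 4 - 256 * x ^ 2) * f''' x + (162 * x ^ 3 - 768 * x) * f'' x
        + (177 * x ^ 2 - 192) * f' x + 15 * x * f x)"
      unfolding hx h'_def next_coeff_def this_coeff_def p by (simp add: algebra_simps eval_nat_numeral)
    then show ?thesis unfolding ode[OF x] by simp
  qed
  moreover have "(2 * real k * x ^ (2 * k - 1)) * h x + h' * x ^ (2 * k) = (next_coeff k * x ^ (2 * k + 2) - this_coeff k * x ^ (2 * k)) * f x"
  proof -
    have "(2 * real k * x ^ (2 * k - 1)) * h x + h' * x ^ (2 * k) = x ^ (2 * k) * (2 * real k * (h x / x) + h')"
      unfolding E1 by (simp only: distrib_left mult.commute)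
    also have "\<dots> = (next_coeff k * x ^ (2 * k + 2) - this_coeff k * x ^ (2 * k)) * f x"
      unfolding E2 by (simp add: algebra_simps power_add power2_eq_square)
    finally show ?thesis .
  qed
  ultimately show ?thesis by simp
qed

lemma boundary_at_0: "(boundary k \<longlongrightarrow> 0) (at_right 0)"
proof -
  let ?p = "real (2 * k + 1)"
  have e: "boundary k x = x ^ (2 * k) * ((27 * x ^ 2 - 256) * (x ^ 3 * f'' x)
     + ((54 - 27 * ?p) * x ^ 2 + 256 * (?p - 1)) * (x ^ 2 * f' x)
     + ((27 * (?p + 4) * (?p + 3) - 162 * (?p + 3) + 177) * x ^ 2 - (256 * (?p + 2) * (?p + 1) - 768 * (?p + 1) + 192)) * (x * f x))" for x
    unfolding boundary_def Let_def by (simp add: algebra_simps eval_nat_numeral)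
  have "((\<lambda>x. x ^ (2 * k) * ((27 * x ^ 2 - 256) * (x ^ 3 * f'' x)
     + ((54 - 27 * ?p) * x ^ 2 + 256 * (?p - 1)) * (x ^ 2 * f' x)
     + ((27 * (?p + 4) * (?p + 3) - 162 * (?p + 3) + 177) * x ^ 2 - (256 * (?p + 2) * (?p + 1) - 768 * (?p + 1) + 192)) * (x * f x)))
     \<longlongrightarrow> 0 ^ (2 * k) * ((27 * 0 ^ 2 - 256) * 0
     + ((54 - 27 * ?p) * 0 ^ 2 + 256 * (?p - 1)) * 0
     + ((27 * (?p + 4) * (?p + 3) - 162 * (?p + 3) + 177) * 0 ^ 2 - (256 * (?p + 2) * (?p + 1) - 768 * (?p + 1) + 192)) * 0)) (at_right 0)"
    by (intro tendsto_intros lim_0_0 lim_0_1 lim_0_2)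
  then show ?thesis unfolding e[abs_def] by simp
qed

lemma boundary_at_a: "(boundary k \<longlongrightarrow> 0) (at_left a)"
proof -
  define p where "p = real (2 * k + 1)"
  define A where "A = 27 * (p + 4) * (p + 3) - 162 * (p + 3) + 177"
  define B where "B = 256 * (p + 2) * (p + 1) - 768 * (p + 1) + 192"
  have e: "boundary k x = x ^ (2 * k) * (27 / 2 * x ^ 3 * (x + a) * (2 * (x - a) * f'' x + f' x)
     + 27 * x ^ 2 * ((3 / 2 - p) * x - (p - 1) * a) * ((x - a) * f' x) + (A * x ^ 3 - B * x) * f x)" for x
  proof -
    \<comment> \<open>With this value of \<open>a\<close> the coefficient of \<open>f''\<close> vanishes at \<open>a\<close>, and what remains regroups
      into the combinations of \<open>f\<close>, \<open>f'\<close>, \<open>f''\<close> whose limits are prescribed.\<close>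
    have s: "256 = 27 * (a * a)" using a_sq by (simp add: power2_eq_square)
    have "boundary k x = x ^ (2 * k) * ((27 * x ^ 5 - 27 * (a * a) * x ^ 3) * f'' x
      + ((54 - 27 * p) * x ^ 4 + 27 * (a * a) * (p - 1) * x ^ 2) * f' x + (A * x ^ 3 - B * x) * f x)"
      unfolding boundary_def Let_def A_def B_def p_def[symmetric] s ..
    also have "\<dots> = x ^ (2 * k) * (27 / 2 * x ^ 3 * (x + a) * (2 * (x - a) * f'' x + f' x)
     + 27 * x ^ 2 * ((3 / 2 - p) * x - (p - 1) * a) * ((x - a) * f' x) + (A * x ^ 3 - B * x) * f x)"
      by (simp add: algebra_simps eval_nat_numeral add_divide_distrib diff_divide_distrib)
    finally show ?thesis .
  qed
  have "((\<lambda>x. x ^ (2 * k) * (27 / 2 * x ^ 3 * (x + a) * (2 * (x - a) * f'' x + f' x)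
     + 27 * x ^ 2 * ((3 / 2 - p) * x - (p - 1) * a) * ((x - a) * f' x) + (A * x ^ 3 - B * x) * f x))
     \<longlongrightarrow> a ^ (2 * k) * (27 / 2 * a ^ 3 * (a + a) * 0
     + 27 * a ^ 2 * ((3 / 2 - p) * a - (p - 1) * a) * 0 + (A * a ^ 3 - B * a) * 0)) (at_left a)"
    by (intro tendsto_intros lim_a_0 lim_a_1 lim_a_2)
  then show ?thesis unfolding e[abs_def] by simp
qed

text \<open>Both boundary terms vanish, so only the integral of a multiple of \<open>f\<close> is left.\<close>

lemma moment_relation: "((\<lambda>x. (next_coeff k * x ^ (2 * k + 2) - this_coeff k * x ^ (2 * k)) * f x) has_integral 0) {0..a}"
proof -
  define g where "g x = (if x \<in> {0<..<a} then boundary k x else 0)" for x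
  have g_ev: "eventually (\<lambda>x. boundary k x = g x) (at x)" if "x \<in> {0<..<a}" for x
    using eventually_at_in_open'[of "{0<..<a}" x] that by (auto elim: eventually_mono simp: g_def)
  have g0: "(g \<longlongrightarrow> 0) (at_right 0)"
    by (rule Lim_transform_eventually[OF boundary_at_0])
       (use eventually_at_right_real[OF a_pos] in \<open>auto elim!: eventually_mono simp: g_def\<close>)
  have ga: "(g \<longlongrightarrow> 0) (at_left a)"
    by (rule Lim_transform_eventually[OF boundary_at_a])
       (use eventually_at_left_real[OF a_pos] in \<open>auto elim!: eventually_mono simp: g_def\<close>)
  have gd: "(g has_real_derivative (next_coeff k * x ^ (2 * k + 2) - this_coeff k * x ^ (2 * k)) * f x) (at x)" if x: "x \<in> {0<..<a}" for x
    by (rule has_field_derivative_transform_within_open[OF boundary_deriv[OF x], of "{0<..<a}"]) (use x in \<open>auto simp: g_def\<close>)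
  have "continuous_on {0..a} g"
  proof (rule continuous_on_IccI)
    show "(g \<longlongrightarrow> g x) (at x)" if "0 < x" "x < a" for x
      using DERIV_isCont[OF gd[of x]] that by (simp add: isCont_def)
  qed (use g0 ga a_pos in \<open>auto simp: g_def\<close>)
  then have "((\<lambda>x. (next_coeff k * x ^ (2 * k + 2) - this_coeff k * x ^ (2 * k)) * f x) has_integral (g a - g 0)) {0..a}"
    by (intro fundamental_theorem_of_calculus_interior)
       (use a_pos gd in \<open>auto simp: has_real_derivative_iff_has_vector_derivative[symmetric]\<close>)
  then show ?thesis by (simp add: g_def)
qed

text \<open>Up to the factor 8, the relation between consecutive moments is the recursion of the Fuss--Catalan
  numbers. The sign of \<open>f\<close> is unknown and its integral may converge conditionally, so the moments
  are expressed through the continuous function \<open>F\<close>.\<close>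

lemma moments_from_ode:
  obtains F m where "continuous_on {0..a} F" "F 0 = 0" "F a = 1"
    "\<And>x. x \<in> {0<..<a} \<Longrightarrow> (F has_real_derivative f x) (at x)"
    "\<And>k. ((\<lambda>x. 2 * real k * x ^ (2 * k - 1) * F x) has_integral (a ^ (2 * k) - m k)) {0..a}"
    "m 0 = 1" "\<And>k. (3 * real k + 4) * (3 * real k + 3) * (3 * real k + 2) * m (Suc k) = 4 * ((4 * real k + 3) * (4 * real k + 2) * (4 * real k + 1)) * m k"
proof -
  have fint: "(f has_integral 1) {0..a}"
    using int by (simp add: has_integral_Icc_iff_Ioo)
  define F where "F x = integral {0..x} f" for x
  have Fc: "continuous_on {0..a} F"
    unfolding F_def by (rule indefinite_integral_continuous_1) (use fint in auto)
  have F0: "F 0 = 0" by (simp add: F_def)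
  have Fa: "F a = 1" using fint by (simp add: F_def integral_unique)
  have Fd: "(F has_real_derivative f x) (at x)" if x: "x \<in> {0<..<a}" for x
  proof -
    have "((\<lambda>u. integral {0..u} f) has_vector_derivative f x) (at x within {0..a} - {})"
      by (rule integral_has_vector_derivative_continuous_at)
         (use fint x DERIV_isCont[OF f'[OF x]] in \<open>auto intro: continuous_at_imp_continuous_at_within\<close>)
    then have "(F has_vector_derivative f x) (at x within {0..a})" by (simp add: F_def[abs_def])
    then show ?thesis using x at_within_Icc_at[of 0 x a] by (simp add: has_real_derivative_iff_has_vector_derivative)
  qed
  define G where "G k = (\<lambda>x. 2 * real k * x ^ (2 * k - 1) * F x)" for k :: nat
  have Gc: "continuous_on {0..a} (G k)" for k unfolding G_def by (intro continuous_intros Fc)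
  define m where "m k = a ^ (2 * k) - integral {0..a} (G k)" for k
  have m: "((\<lambda>x. x ^ (2 * k) * f x) has_integral m k) {0..a}" for k
  proof -
    define H where "H x = x ^ (2 * k) * F x - integral {0..x} (G k)" for x
    have Hc: "continuous_on {0..a} H"
      unfolding H_def by (intro continuous_intros Fc indefinite_integral_continuous_1 integrable_continuous_interval Gc)
    have Hd: "(H has_real_derivative x ^ (2 * k) * f x) (at x)" if x: "x \<in> {0<..<a}" for x
    proof -
      have "((\<lambda>u. integral {0..u} (G k)) has_real_derivative G k x) (at x within {0..a})"
        by (rule integral_has_real_derivative[OF Gc]) (use x in auto)
      then have "((\<lambda>u. integral {0..u} (G k)) has_real_derivative G k x) (at x)"
        using x at_within_Icc_at[of 0 x a] by simp
      then show ?thesis unfolding H_def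
        by (auto intro!: derivative_eq_intros Fd x simp: G_def)
    qed
    have "((\<lambda>x. x ^ (2 * k) * f x) has_integral (H a - H 0)) {0..a}"
      by (rule fundamental_theorem_of_calculus_interior)
         (use a_pos Hc Hd in \<open>auto simp: has_real_derivative_iff_has_vector_derivative[symmetric]\<close>)
    moreover have "H a - H 0 = m k" by (simp add: H_def m_def Fa F0)
    ultimately show ?thesis by simp
  qed
  have m0: "m 0 = 1" by (simp add: m_def G_def)
  have rel: "next_coeff k * m (Suc k) = this_coeff k * m k" for k
  proof -
    have hi: "((\<lambda>x. next_coeff k * (x ^ (2 * Suc k) * f x) - this_coeff k * (x ^ (2 * k) * f x)) has_integral (next_coeff k * m (Suc k) - this_coeff k * m k)) {0..a}"
      by (intro has_integral_diff has_integral_mult_right m)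
    have eq: "(\<lambda>x. next_coeff k * (x ^ (2 * Suc k) * f x) - this_coeff k * (x ^ (2 * k) * f x)) = (\<lambda>x. (next_coeff k * x ^ (2 * k + 2) - this_coeff k * x ^ (2 * k)) * f x)"
      by (simp add: algebra_simps fun_eq_iff)
    have "next_coeff k * m (Suc k) - this_coeff k * m k = 0" by (rule has_integral_unique[OF hi[unfolded eq] moment_relation])
    then show ?thesis by simp
  qed
  have i1: "((\<lambda>x. 2 * real k * x ^ (2 * k - 1) * F x) has_integral (a ^ (2 * k) - m k)) {0..a}" for k
    using integrable_integral[OF integrable_continuous_interval[OF Gc[of k]]] unfolding m_def by (simp add: G_def)
  have i2: "(3 * real k + 4) * (3 * real k + 3) * (3 * real k + 2) * m (Suc k) = 4 * ((4 * real k + 3) * (4 * real k + 2) * (4 * real k + 1)) * m k" for k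
    using rel[of k] by (simp add: next_coeff_def this_coeff_def mult_ac)
  show thesis by (rule that[OF Fc F0 Fa Fd i1 m0 i2])
qed

end

section \<open>The method of moments\<close>

text \<open>The method of moments for a limit given by a continuous function \<open>F\<close>, which becomes a distribution
  function only as a consequence; \<open>c k\<close> is the moment of order \<open>2 k\<close> of \<open>F\<close> on \<open>{0..a}\<close>, integrated
  by parts.\<close>

locale moment_convergence =
  fixes a :: real and F :: "real \<Rightarrow> real" and c :: "nat \<Rightarrow> real" and \<mu> :: "nat \<Rightarrow> real measure"
  assumes a_pos: "0 < a"
    and F_cont: "continuous_on {0..a} F" and F_0: "F 0 = 0" and F_a: "F a = 1"
    and c_integral: "((\<lambda>x. 2 * real k * x ^ (2 * k - 1) * F x) has_integral (a ^ (2 * k) - c k)) {0..a}"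
    and distr: "real_distribution (\<mu> n)"
    and nonneg: "AE x in \<mu> n. 0 \<le> x"
    and integrable_moment: "integrable (\<mu> n) (\<lambda>x. x ^ (2 * k))"
    and moments: "(\<lambda>n. \<integral>x. x ^ (2 * k) \<partial>\<mu> n) \<longlonglongrightarrow> c k"
begin

lemma F_bounded: obtains M where "1 \<le> M" "\<And>x. x \<in> {0..a} \<Longrightarrow> \<bar>F x\<bar> \<le> M"
proof -
  have "compact (F ` {0..a})" by (intro compact_continuous_image F_cont) auto
  then obtain M where "\<forall>y\<in>F ` {0..a}. norm y \<le> M" using compact_imp_bounded bounded_iff by blast
  then have "\<bar>F x\<bar> \<le> max 1 M" if "x \<in> {0..a}" for x using that by force
  then show thesis using that[of "max 1 M"] by auto
qed

lemma power_has_integral: "((\<lambda>x. 2 * real k * x ^ (2 * k - 1)) has_integral (if k = 0 then 0 else a ^ (2 * k))) {0..a}"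
proof -
  have "((\<lambda>x. 2 * real k * x ^ (2 * k - 1)) has_integral (a ^ (2 * k) - 0 ^ (2 * k))) {0..a}"
    by (rule fundamental_theorem_of_calculus)
       (use a_pos in \<open>auto intro!: derivative_eq_intros simp: has_real_derivative_iff_has_vector_derivative[symmetric]\<close>)
  then show ?thesis by (cases "k = 0") (auto simp: power_0_left)
qed

text \<open>The limiting moments grow like those of a distribution on \<open>{0..a}\<close>.\<close>

lemma c_bound: obtains K where "0 < K" "\<And>k. c k \<le> K * a ^ (2 * k)"
proof -
  obtain M where M: "1 \<le> M" "\<And>x. x \<in> {0..a} \<Longrightarrow> \<bar>F x\<bar> \<le> M" by (rule F_bounded) blast
  have "c k \<le> (1 + M) * a ^ (2 * k)" for k
  proof -
    have "((\<lambda>x. (- M) * (2 * real k * x ^ (2 * k - 1))) has_integral (- M) * (if k = 0 then 0 else a ^ (2 * k))) {0..a}"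
      by (intro has_integral_mult_right power_has_integral)
    then have "(- M) * (if k = 0 then 0 else a ^ (2 * k)) \<le> a ^ (2 * k) - c k"
    proof (rule has_integral_le[OF _ c_integral])
      fix x assume x: "x \<in> {0..a}"
      then have "- M \<le> F x" using M(2)[OF x] by linarith
      then have "(2 * real k * x ^ (2 * k - 1)) * (- M) \<le> (2 * real k * x ^ (2 * k - 1)) * F x"
        using x by (intro mult_left_mono) auto
      then show "- M * (2 * real k * x ^ (2 * k - 1)) \<le> 2 * real k * x ^ (2 * k - 1) * F x"
        by (subst mult.commute)
    qed
    moreover have "M * (if k = 0 then 0 else a ^ (2 * k)) \<le> M * a ^ (2 * k)" using M a_pos by auto
    ultimately show ?thesis by (simp add: algebra_simps)
  qed
  then show thesis using that[of "1 + M"] M by auto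
qed

lemma sets_\<mu> [simp, measurable_cong]: "sets (\<mu> n) = sets borel"
  using distr[of n] by (simp add: real_distribution.events_eq_borel)

lemma prob_\<mu>: "prob_space (\<mu> n)" using distr[of n] by (simp add: real_distribution_def)

definition "tail B k n = (\<integral>x. x ^ (2 * k) * indicator {B<..} x \<partial>\<mu> n)"

lemma integrable_tail: "integrable (\<mu> n) (\<lambda>x. x ^ (2 * k) * indicator {B<..} x)"
  by (rule integrable_real_mult_indicator) (auto intro: integrable_moment)

lemma tail_nonneg: "0 \<le> tail B k n" unfolding tail_def by (intro integral_nonneg_AE) (auto simp: indicator_def)

text \<open>Compare \<open>x ^ (2 k)\<close> beyond \<open>B\<close> with a much higher moment.\<close>

lemma tail_tendsto: assumes B: "a < B" shows "(\<lambda>n. tail B k n) \<longlonglongrightarrow> 0"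
proof (rule tendstoI)
  fix e :: real assume e: "0 < e"
  obtain K where K: "0 < K" "\<And>k. c k \<le> K * a ^ (2 * k)" by (rule c_bound) blast
  have Bp: "0 < B" using B a_pos by simp
  have "(\<lambda>j. K * a ^ (2 * k) * ((a / B)^2) ^ j) \<longlonglongrightarrow> K * a ^ (2 * k) * 0"
    by (intro tendsto_intros LIMSEQ_realpow_zero) (use B a_pos in \<open>auto simp: power_less_one_iff abs_square_less_1\<close>)
  then have "eventually (\<lambda>j. K * a ^ (2 * k) * ((a / B)^2) ^ j < e) sequentially" using e by (auto dest: order_tendstoD(2))
  then obtain j where j: "K * a ^ (2 * k) * ((a / B)^2) ^ j < e" by (meson eventually_happens' sequentially_bot)
  have "c (k + j) / B ^ (2 * j) \<le> K * a ^ (2 * (k + j)) / B ^ (2 * j)"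
    by (rule divide_right_mono[OF K(2)]) (use Bp in simp)
  also have "\<dots> = K * a ^ (2 * k) * ((a / B)^2) ^ j" by (simp add: power_add power_divide power_mult[symmetric] distrib_left)
  finally have cj: "c (k + j) / B ^ (2 * j) < e" using j by simp
  have "(\<lambda>n. (\<integral>x. x ^ (2 * (k + j)) \<partial>\<mu> n) / B ^ (2 * j)) \<longlonglongrightarrow> c (k + j) / B ^ (2 * j)"
    by (intro tendsto_intros moments) (use Bp in auto)
  then have "eventually (\<lambda>n. (\<integral>x. x ^ (2 * (k + j)) \<partial>\<mu> n) / B ^ (2 * j) < e) sequentially"
    using cj by (rule order_tendstoD(2))
  then show "eventually (\<lambda>n. dist (tail B k n) 0 < e) sequentially"
  proof eventually_elim
    case (elim n)
    have "tail B k n \<le> (\<integral>x. x ^ (2 * (k + j)) / B ^ (2 * j) \<partial>\<mu> n)"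
      unfolding tail_def
    proof (rule integral_mono)
      fix x
      show "x ^ (2 * k) * indicator {B<..} x \<le> x ^ (2 * (k + j)) / B ^ (2 * j)"
      proof (cases "B < x")
        case True
        then have "B ^ (2 * j) \<le> x ^ (2 * j)" using Bp by (intro power_mono) auto
        then have "x ^ (2 * k) * B ^ (2 * j) \<le> x ^ (2 * k) * x ^ (2 * j)" by (intro mult_left_mono) auto
        then show ?thesis using True Bp by (simp add: pos_le_divide_eq power_add distrib_left)
      next
        case False
        have "0 \<le> x ^ (2 * (k + j))" by (rule zero_le_even_power) simp
        then have "0 \<le> x ^ (2 * (k + j)) / B ^ (2 * j)" using Bp by (intro divide_nonneg_nonneg) auto
        then show ?thesis using False by simp
      qed
    qed (intro integrable_tail integrable_divide integrable_moment)+
    also have "\<dots> = (\<integral>x. x ^ (2 * (k + j)) \<partial>\<mu> n) / B ^ (2 * j)" by simp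
    finally show ?case using elim tail_nonneg[of B k n] by simp
  qed
qed

text \<open>A continuous tent supported on \<open>{u..v}\<close>.\<close>

definition bump :: "real \<Rightarrow> real \<Rightarrow> real \<Rightarrow> real" where
  "bump u v y = max 0 (min (y - u) (v - y))"

lemma bump_cont: "continuous_on S (bump u v)"
  unfolding bump_def by (intro continuous_intros)

lemma bump_nonneg: "0 \<le> bump u v y" by (simp add: bump_def)
lemma bump_outside: "y \<le> u \<or> v \<le> y \<Longrightarrow> bump u v y = 0" by (auto simp: bump_def)

definition mass where "mass u v = integral {0..v} (\<lambda>y. y * bump u v y)"

lemma mass_pos: assumes "0 \<le> u" "u < v" shows "0 < mass u v"
proof -
  have "mass u v \<noteq> 0"
  proof
    assume "mass u v = 0"
    then have "integral (cbox 0 v) (\<lambda>y. y * bump u v y) = 0" by (simp add: mass_def)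
    then have "\<forall>y\<in>cbox 0 v. y * bump u v y = 0"
      by (subst (asm) integral_cbox_eq_0_iff) (use assms in \<open>auto intro!: continuous_intros bump_cont simp: bump_nonneg box_real\<close>)
    moreover have "(u + v) / 2 \<in> cbox 0 v" using assms by auto
    ultimately have "(u + v) / 2 * bump u v ((u + v) / 2) = 0" by blast
    moreover have "bump u v ((u + v) / 2) = (v - u) / 2" using assms by (auto simp: bump_def field_simps)
    ultimately show False using assms by simp
  qed
  moreover have "0 \<le> mass u v" unfolding mass_def
    by (intro integral_nonneg integrable_continuous_interval continuous_intros bump_cont) (auto simp: bump_nonneg)
  ultimately show ?thesis by simp
qed

text \<open>The tent scaled so that \<open>y * T u v y\<close> has integral one. The antiderivative \<open>step u v\<close> rises from 0
  to 1 between \<open>u\<close> and \<open>v\<close>, and its expectation falls short of one by the average of the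
  distribution function with the weight \<open>y * T u v y\<close>.\<close>

definition T where "T u v y = bump u v y / mass u v"
definition step where "step u v x = integral {0..x} (\<lambda>y. y * T u v y)"

context
  fixes u v :: real
  assumes uv: "0 \<le> u" "u < v" "v \<le> a"
begin

lemma T_cont: "continuous_on S (T u v)"
  unfolding T_def using mass_pos[OF uv(1,2)] by (intro continuous_intros bump_cont) auto
lemma T_nonneg: "0 \<le> T u v y" using mass_pos[OF uv(1,2)] bump_nonneg by (simp add: T_def)
lemma T_outside: "y \<le> u \<or> v \<le> y \<Longrightarrow> T u v y = 0" by (simp add: T_def bump_outside)
lemma T_int: "(\<lambda>y. y * T u v y) integrable_on {p..q}"
  by (intro integrable_continuous_interval continuous_intros T_cont)

lemma step_mono: assumes "x \<le> y" shows "step u v x \<le> step u v y"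
  unfolding step_def by (rule integral_subset_le) (use assms T_int T_nonneg in auto)

lemma step_left: assumes "x \<le> u" shows "step u v x = 0"
proof -
  have "integral {0..x} (\<lambda>y. y * T u v y) = integral {0..x} (\<lambda>y. 0)"
    by (rule integral_cong) (use assms T_outside in auto)
  then show ?thesis by (simp add: step_def)
qed

lemma step_v: "step u v v = 1"
proof -
  have "step u v v = mass u v / mass u v"
    unfolding step_def T_def mass_def by (simp add: times_divide_eq_right)
  then show ?thesis using mass_pos[OF uv(1,2)] by simp
qed

lemma step_right: assumes "v \<le> x" shows "step u v x = 1"
proof -
  have "step u v x = integral {0..v} (\<lambda>y. y * T u v y) + integral {v..x} (\<lambda>y. y * T u v y)"
    unfolding step_def by (rule Henstock_Kurzweil_Integration.integral_combine[symmetric]) (use assms uv T_int in auto)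
  also have "integral {v..x} (\<lambda>y. y * T u v y) = integral {v..x} (\<lambda>y. 0)"
    by (rule integral_cong) (use T_outside in auto)
  finally show ?thesis using step_v by (simp add: step_def)
qed

lemma step_bounds: "0 \<le> step u v x" "step u v x \<le> 1"
  using step_mono[of x "max v x"] step_right[of "max v x"] step_mono[of "min u x" x] step_left[of "min u x"] by auto

lemma step_measurable: "step u v \<in> borel_measurable borel"
  by (intro borel_measurable_mono monoI step_mono)

lemma step_integrable: "integrable (\<mu> n) (step u v)"
proof -
  interpret prob_space "\<mu> n" by (rule prob_\<mu>)
  show ?thesis by (rule integrable_const_bound[where B = 1]) (use step_bounds step_measurable in auto)
qed

definition avg where "avg = integral {0..a} (\<lambda>y. y * T u v y * F y)"

lemma TF_int: "(\<lambda>y. y * T u v y * F y) integrable_on {0..a}"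
  by (intro integrable_continuous_interval continuous_intros T_cont F_cont)

lemma T_has_integral: "((\<lambda>y. y * T u v y) has_integral 1) {0..a}"
  using step_right[of a] uv T_int[of 0 a] by (simp add: step_def has_integral_integral)

lemma avg_le: assumes "\<And>y. u \<le> y \<Longrightarrow> y \<le> v \<Longrightarrow> F y \<le> w" shows "avg \<le> w"
proof -
  have h1: "((\<lambda>y. y * T u v y * w) has_integral 1 * w) {0..a}" by (rule has_integral_mult_left[OF T_has_integral])
  have h2: "((\<lambda>y. y * T u v y * F y) has_integral avg) {0..a}" unfolding avg_def by (rule integrable_integral[OF TF_int])
  have h3: "y * T u v y * F y \<le> y * T u v y * w" if "y \<in> {0..a}" for y
  proof (cases "u \<le> y \<and> y \<le> v")
    case True
    then show ?thesis using that assms[of y] T_nonneg[of y] by (intro mult_left_mono) auto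
  next
    case False
    then have "T u v y = 0" by (intro T_outside) auto
    then show ?thesis by simp
  qed
  have "avg \<le> 1 * w" by (rule has_integral_le[OF h2 h1 h3])
  then show ?thesis by simp
qed

lemma avg_ge: assumes "\<And>y. u \<le> y \<Longrightarrow> y \<le> v \<Longrightarrow> w \<le> F y" shows "w \<le> avg"
proof -
  have h1: "((\<lambda>y. y * T u v y * w) has_integral 1 * w) {0..a}" by (rule has_integral_mult_left[OF T_has_integral])
  have h2: "((\<lambda>y. y * T u v y * F y) has_integral avg) {0..a}" unfolding avg_def by (rule integrable_integral[OF TF_int])
  have h3: "y * T u v y * w \<le> y * T u v y * F y" if "y \<in> {0..a}" for y
  proof (cases "u \<le> y \<and> y \<le> v")
    case True
    then show ?thesis using that assms[of y] T_nonneg[of y] by (intro mult_left_mono) auto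
  next
    case False
    then have "T u v y = 0" by (intro T_outside) auto
    then show ?thesis by simp
  qed
  have "1 * w \<le> avg" by (rule has_integral_le[OF h1 h2 h3])
  then show ?thesis by simp
qed

text \<open>Weierstrass in the variable \<open>x ^ 2\<close>, because only even moments are known.\<close>

lemma polynomial_approximation:
  assumes e: "0 < e" and B: "a < B"
  obtains q :: "nat \<Rightarrow> real" and m where "\<And>x. x \<in> {0..B} \<Longrightarrow> \<bar>T u v x - (\<Sum>i\<le>m. q i * x ^ (2 * i))\<bar> \<le> e"
proof -
  have "continuous_on {0..B^2} (\<lambda>y. T u v (sqrt y))"
    by (intro continuous_on_compose2[OF T_cont[of UNIV]] continuous_intros) auto
  then obtain g where g: "polynomial_function g" "\<And>y. y \<in> {0..B^2} \<Longrightarrow> norm (T u v (sqrt y) - g y) < e"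
    using Stone_Weierstrass_polynomial_function[of "{0..B^2}" "\<lambda>y. T u v (sqrt y)" e] e by blast
  then have "real_polynomial_function g" by (simp add: real_polynomial_function_eq)
  then obtain q m where q: "g = (\<lambda>x. \<Sum>i\<le>m. q i * x ^ i)" using real_polynomial_function_iff_sum by blast
  have "\<bar>T u v x - (\<Sum>i\<le>m. q i * x ^ (2 * i))\<bar> \<le> e" if x: "x \<in> {0..B}" for x
  proof -
    have "x^2 \<in> {0..B^2}" using x by (auto intro: power_mono)
    then have "\<bar>T u v (sqrt (x^2)) - g (x^2)\<bar> < e" using g(2)[of "x^2"] by simp
    then show ?thesis using x by (simp add: q power_mult)
  qed
  then show thesis using that by blast
qed

text \<open>Approximate \<open>T u v\<close> by an even polynomial. The antiderivative of \<open>y * p y\<close> is an even polynomial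
  too, so its expectations converge, and the limit is found by integrating \<open>y * p y\<close> against \<open>F\<close>.\<close>

lemma step_integral_tendsto: "(\<lambda>n. \<integral>x. step u v x \<partial>\<mu> n) \<longlonglongrightarrow> 1 - avg"
proof -
  \<comment> \<open>Any bound beyond \<open>a\<close> serves: the polynomial approximates on \<open>{0..B}\<close>, and the tail estimate
    disposes of \<open>{B<..}\<close>.\<close>
  define B where "B = a + 1"
  have B: "a < B" "0 < B" using a_pos by (auto simp: B_def)
  obtain M where M: "1 \<le> M" "\<And>x. x \<in> {0..a} \<Longrightarrow> \<bar>F x\<bar> \<le> M" by (rule F_bounded) blast
  define C where "C = B^2 + a^2 * (1 + M) + 1"
  have C: "0 < C" unfolding C_def using M a_pos by (intro add_nonneg_pos add_nonneg_nonneg mult_nonneg_nonneg) auto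
  show ?thesis
  proof (rule tendstoI)
    fix e' :: real assume e': "0 < e'"
    define e where "e = e' / (4 * C)"
    have e: "0 < e" using e' C by (simp add: e_def)
    obtain q m where q: "\<And>x. x \<in> {0..B} \<Longrightarrow> \<bar>T u v x - (\<Sum>i\<le>m. q i * x ^ (2 * i))\<bar> \<le> e"
      by (rule polynomial_approximation[OF e B(1)]) blast
    define p where "p x = (\<Sum>i\<le>m. q i * x ^ (2 * i))" for x
    define r where "r i = q i / (2 * real i + 2)" for i
    define P where "P x = (\<Sum>i\<le>m. r i * x ^ (2 * Suc i))" for x
    have p_cont: "continuous_on S p" for S unfolding p_def by (intro continuous_intros)
    have P_deriv: "(P has_real_derivative x * p x) (at x)" for x
    proof -
      have "((\<lambda>x. r i * x ^ (2 * Suc i)) has_real_derivative x * (q i * x ^ (2 * i))) (at x)" for i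
      proof -
        have D: "((\<lambda>x. r i * x ^ (2 * Suc i)) has_real_derivative r i * (real (2 * Suc i) * x ^ (2 * Suc i - Suc 0))) (at x)"
          by (intro DERIV_cmult DERIV_pow)
        have "r i * real (2 * Suc i) = q i" by (simp add: r_def field_simps)
        then have E: "r i * (real (2 * Suc i) * x ^ (2 * Suc i - Suc 0)) = x * (q i * x ^ (2 * i))"
          by (simp only: mult.assoc[symmetric]) (simp add: mult_ac)
        show ?thesis using D unfolding E .
      qed
      then show ?thesis unfolding P_def p_def sum_distrib_left by (rule DERIV_sum)
    qed
    have P_int: "((\<lambda>y. y * p y) has_integral P x) {0..x}" if "0 \<le> x" for x
    proof -
      have "((\<lambda>y. y * p y) has_integral P x - P 0) {0..x}"
        by (rule fundamental_theorem_of_calculus)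
           (use that P_deriv in \<open>auto simp: has_real_derivative_iff_has_vector_derivative[symmetric] intro: DERIV_subset\<close>)
      then show ?thesis by (simp add: P_def)
    qed
    have close: "\<bar>step u v x - P x\<bar> \<le> e * x^2" if x: "x \<in> {0..B}" for x
    proof -
      have hi: "((\<lambda>y. y * T u v y - y * p y) has_integral step u v x - P x) {0..x}"
        unfolding step_def by (intro has_integral_diff integrable_integral T_int P_int) (use x in auto)
      have "norm (step u v x - P x) \<le> (e * x) * measure lborel {0..x}"
      proof (rule has_integral_bound_real[where S = "{}", OF _ _ hi])
        show "0 \<le> e * x" using e x by simp
        fix y assume "y \<in> {0..x} - {}"
        then have y: "y \<in> {0..x}" by simp
        have "\<bar>y * T u v y - y * p y\<bar> = y * \<bar>T u v y - p y\<bar>" using y by (simp add: abs_mult right_diff_distrib[symmetric])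
        also have "\<dots> \<le> x * e" using q[of y] y x e unfolding p_def by (intro mult_mono) auto
        finally show "norm (y * T u v y - y * p y) \<le> e * x" by (simp add: mult.commute)
      qed simp
      then show ?thesis using x by (simp add: power2_eq_square mult.assoc)
    qed
    have P_integrable: "integrable (\<mu> n) P" for n unfolding P_def
      by (intro Bochner_Integration.integrable_sum integrable_mult_right integrable_moment)
    define l where "l = (\<Sum>i\<le>m. r i * c (Suc i))"
    have P_lim: "(\<lambda>n. \<integral>x. P x \<partial>\<mu> n) \<longlonglongrightarrow> l"
    proof -
      have "(\<integral>x. P x \<partial>\<mu> n) = (\<Sum>i\<le>m. r i * (\<integral>x. x ^ (2 * Suc i) \<partial>\<mu> n))" for n
        unfolding P_def using integrable_moment[of n "Suc _"]
        by (subst Bochner_Integration.integral_sum) (auto simp del: power_Suc)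
      then show ?thesis unfolding l_def using moments[of "Suc _"] by (auto intro!: tendsto_intros simp del: power_Suc mult_Suc_right)
    qed
    have l_eq: "((\<lambda>y. y * p y * F y) has_integral (P a - l)) {0..a}"
    proof -
      have "((\<lambda>y. \<Sum>i\<le>m. r i * (2 * real (Suc i) * y ^ (2 * Suc i - 1) * F y)) has_integral (\<Sum>i\<le>m. r i * (a ^ (2 * Suc i) - c (Suc i)))) {0..a}"
        by (intro has_integral_sum has_integral_mult_right c_integral) auto
      moreover have "(\<Sum>i\<le>m. r i * (2 * real (Suc i) * y ^ (2 * Suc i - 1) * F y)) = y * p y * F y" for y
        unfolding p_def sum_distrib_left sum_distrib_right
        by (rule sum.cong) (auto simp: r_def field_simps)
      moreover have "(\<Sum>i\<le>m. r i * (a ^ (2 * Suc i) - c (Suc i))) = P a - l"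
        by (simp add: P_def l_def right_diff_distrib sum_subtractf)
      ultimately show ?thesis by simp
    qed
    have l_close: "\<bar>l - (1 - avg)\<bar> \<le> e * (a^2 * (1 + M))"
    proof -
      have hi: "((\<lambda>y. y * T u v y * F y - y * p y * F y) has_integral avg - (P a - l)) {0..a}"
        unfolding avg_def by (intro has_integral_diff integrable_integral TF_int l_eq)
      have "norm (avg - (P a - l)) \<le> (a * e * M) * measure lborel {0..a}"
      proof (rule has_integral_bound_real[where S = "{}", OF _ _ hi])
        show "0 \<le> a * e * M" using e a_pos M by simp
        fix y assume "y \<in> {0..a} - {}"
        then have y: "y \<in> {0..a}" by simp
        have "y * T u v y * F y - y * p y * F y = y * (T u v y - p y) * F y" by (simp add: algebra_simps)
        then have "\<bar>y * T u v y * F y - y * p y * F y\<bar> = y * \<bar>T u v y - p y\<bar> * \<bar>F y\<bar>" using y by (simp add: abs_mult)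
        also have "\<dots> \<le> a * e * M" using q[of y] M(2)[OF y] y B e unfolding p_def by (intro mult_mono) auto
        finally show "norm (y * T u v y * F y - y * p y * F y) \<le> a * e * M" by simp
      qed simp
      then have 1: "\<bar>avg - (P a - l)\<bar> \<le> e * (a^2 * M)" using a_pos by (simp add: power2_eq_square mult_ac)
      have "\<bar>1 - P a\<bar> \<le> e * a^2" using close[of a] step_right[of a] uv B a_pos by simp
      then show ?thesis using 1 by (simp add: algebra_simps abs_le_iff)
    qed
    define tl where "tl n = tail B 0 n + (\<Sum>i\<le>m. \<bar>r i\<bar> * tail B (Suc i) n)" for n
    have "(\<lambda>n. tail B 0 n + (\<Sum>i\<le>m. \<bar>r i\<bar> * tail B (Suc i) n)) \<longlonglongrightarrow> 0 + (\<Sum>i\<le>m. \<bar>r i\<bar> * 0)"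
      by (intro tendsto_intros tail_tendsto B)
    then have tl_lim: "tl \<longlonglongrightarrow> 0" by (simp add: tl_def[abs_def])
    have main: "\<bar>(\<integral>x. step u v x \<partial>\<mu> n) - (\<integral>x. P x \<partial>\<mu> n)\<bar> \<le> e * B^2 + tl n" for n
    proof -
      interpret M: prob_space "\<mu> n" by (rule prob_\<mu>)
      let ?h = "\<lambda>x. e * B^2 + (x ^ (2 * 0) * indicator {B<..} x + (\<Sum>i\<le>m. \<bar>r i\<bar> * (x ^ (2 * Suc i) * indicator {B<..} x)))"
      have "\<bar>(\<integral>x. step u v x \<partial>\<mu> n) - (\<integral>x. P x \<partial>\<mu> n)\<bar> = \<bar>\<integral>x. step u v x - P x \<partial>\<mu> n\<bar>"
        by (subst Bochner_Integration.integral_diff) (auto intro: step_integrable P_integrable)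
      also have "\<dots> \<le> (\<integral>x. \<bar>step u v x - P x\<bar> \<partial>\<mu> n)" by (rule integral_abs_bound)
      also have "\<dots> \<le> (\<integral>x. ?h x \<partial>\<mu> n)"
      proof (rule integral_mono_AE)
        show "integrable (\<mu> n) (\<lambda>x. \<bar>step u v x - P x\<bar>)" by (intro integrable_abs Bochner_Integration.integrable_diff step_integrable P_integrable)
        show "integrable (\<mu> n) ?h"
          by (intro Bochner_Integration.integrable_add Bochner_Integration.integrable_sum integrable_mult_right integrable_tail) simp
        show "AE x in \<mu> n. \<bar>step u v x - P x\<bar> \<le> ?h x"
          using nonneg[of n]
        proof eventually_elim
          case (elim x)
          show ?case
          proof (cases "x \<le> B")
            case True
            then have "\<bar>step u v x - P x\<bar> \<le> e * x^2" using close elim by simp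
            also have "\<dots> \<le> e * B^2" using e elim True by (intro mult_left_mono power_mono) auto
            finally show ?thesis using True by simp
          next
            case False
            have "\<bar>P x\<bar> \<le> (\<Sum>i\<le>m. \<bar>r i * x ^ (2 * Suc i)\<bar>)" unfolding P_def by (rule sum_abs)
            also have "\<dots> = (\<Sum>i\<le>m. \<bar>r i\<bar> * x ^ (2 * Suc i))" using elim by (simp add: abs_mult)
            finally have "\<bar>step u v x - P x\<bar> \<le> 1 + (\<Sum>i\<le>m. \<bar>r i\<bar> * x ^ (2 * Suc i))" using step_bounds[of x] by linarith
            moreover have "0 \<le> e * B^2" using e by simp
            ultimately show ?thesis using False by simp
          qed
        qed
      qed
      also have "\<dots> = (\<integral>x. e * B^2 \<partial>\<mu> n) + (\<integral>x. x ^ (2 * 0) * indicator {B<..} x + (\<Sum>i\<le>m. \<bar>r i\<bar> * (x ^ (2 * Suc i) * indicator {B<..} x)) \<partial>\<mu> n)"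
        by (rule Bochner_Integration.integral_add)
           (intro M.integrable_const Bochner_Integration.integrable_add Bochner_Integration.integrable_sum integrable_mult_right integrable_tail)+
      also have "(\<integral>x. x ^ (2 * 0) * indicator {B<..} x + (\<Sum>i\<le>m. \<bar>r i\<bar> * (x ^ (2 * Suc i) * indicator {B<..} x)) \<partial>\<mu> n)
         = tail B 0 n + (\<integral>x. (\<Sum>i\<le>m. \<bar>r i\<bar> * (x ^ (2 * Suc i) * indicator {B<..} x)) \<partial>\<mu> n)"
        unfolding tail_def by (rule Bochner_Integration.integral_add)
           (intro Bochner_Integration.integrable_sum integrable_mult_right integrable_tail)+
      also have "(\<integral>x. (\<Sum>i\<le>m. \<bar>r i\<bar> * (x ^ (2 * Suc i) * indicator {B<..} x)) \<partial>\<mu> n)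
         = (\<Sum>i\<le>m. (\<integral>x. \<bar>r i\<bar> * (x ^ (2 * Suc i) * indicator {B<..} x) \<partial>\<mu> n))"
        by (rule Bochner_Integration.integral_sum) (intro integrable_mult_right integrable_tail)
      also have "\<dots> = (\<Sum>i\<le>m. \<bar>r i\<bar> * tail B (Suc i) n)"
        unfolding tail_def by (simp only: integral_mult_right_zero)
      also have "(\<integral>x. e * B^2 \<partial>\<mu> n) = e * B^2" using M.prob_space by simp
      also have "e * B^2 + (tail B 0 n + (\<Sum>i\<le>m. \<bar>r i\<bar> * tail B (Suc i) n)) = e * B^2 + tl n" by (simp add: tl_def)
      finally show ?thesis .
    qed
    have ev1: "eventually (\<lambda>n. \<bar>(\<integral>x. P x \<partial>\<mu> n) - l\<bar> < e' / 4) sequentially"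
      using tendstoD[OF P_lim, of "e' / 4"] e' by (simp add: dist_real_def)
    have ev2: "eventually (\<lambda>n. tl n < e' / 4) sequentially"
      using order_tendstoD(2)[OF tl_lim, of "e' / 4"] e' by simp
    show "eventually (\<lambda>n. dist (\<integral>x. step u v x \<partial>\<mu> n) (1 - avg) < e') sequentially"
      using ev1 ev2
    proof eventually_elim
      case (elim n)
      have "e * B^2 + e * (a^2 * (1 + M)) < e * C" unfolding C_def using e by (simp add: algebra_simps)
      also have "e * C = e' / 4" using C by (simp add: e_def)
      finally show ?case using elim main[of n] l_close unfolding dist_real_def by linarith
    qed
  qed
qed

end

lemma cdf_\<mu>_le: "cdf (\<mu> n) x \<le> 1 - (\<integral>y. step x v y \<partial>\<mu> n)" if "0 \<le> x" "x < v" "v \<le> a"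
proof -
  interpret M: real_distribution "\<mu> n" by (rule distr)
  have "(\<integral>y. step x v y \<partial>\<mu> n) \<le> (\<integral>y. indicator {x<..} y \<partial>\<mu> n)"
  proof (rule integral_mono[OF step_integrable[OF that]])
    show "integrable (\<mu> n) (indicator {x<..} :: real \<Rightarrow> real)"
      by (rule integrable_real_indicator) (auto simp: M.emeasure_eq_measure)
  qed (use step_left[OF that] step_bounds[OF that] in \<open>auto simp: indicator_def\<close>)
  also have "\<dots> = measure (\<mu> n) {x<..}" by simp
  also have "{x<..} = UNIV - {..x}" by auto
  also have "measure (\<mu> n) (UNIV - {..x}) = 1 - measure (\<mu> n) {..x}"
    using M.prob_compl[of "{..x}"] by simp
  finally show ?thesis by (simp add: cdf_def)
qed

lemma cdf_\<mu>_ge: "1 - (\<integral>y. step u x y \<partial>\<mu> n) \<le> cdf (\<mu> n) x" if "0 \<le> u" "u < x" "x \<le> a"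
proof -
  interpret M: real_distribution "\<mu> n" by (rule distr)
  have "measure (\<mu> n) {x<..} = (\<integral>y. indicator {x<..} y \<partial>\<mu> n)" by simp
  also have "\<dots> \<le> (\<integral>y. step u x y \<partial>\<mu> n)"
  proof (rule integral_mono[OF _ step_integrable[OF that]])
    show "integrable (\<mu> n) (indicator {x<..} :: real \<Rightarrow> real)"
      by (rule integrable_real_indicator) (auto simp: M.emeasure_eq_measure)
  qed (use step_right[OF that] step_bounds[OF that] in \<open>auto simp: indicator_def\<close>)
  also have "{x<..} = UNIV - {..x}" by auto
  also have "measure (\<mu> n) (UNIV - {..x}) = 1 - measure (\<mu> n) {..x}"
    using M.prob_compl[of "{..x}"] by simp
  finally show ?thesis by (simp add: cdf_def)
qed

lemma cdf_upper: assumes x: "0 \<le> x" "x < a" and e: "0 < e"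
  shows "eventually (\<lambda>n. cdf (\<mu> n) x < F x + e) sequentially"
proof -
  have "continuous (at x within {0..a}) F" using F_cont x by (auto simp: continuous_on_eq_continuous_within)
  then obtain d where d: "0 < d" "\<And>y. y \<in> {0..a} \<Longrightarrow> dist y x < d \<Longrightarrow> dist (F y) (F x) < e / 2"
    using e unfolding continuous_within_eps_delta by (metis half_gt_zero)
  define v where "v = min a (x + d / 2)"
  have v: "x < v" "v \<le> a" using x d by (auto simp: v_def)
  have "avg x v \<le> F x + e / 2"
  proof (rule avg_le[OF x(1) v])
    fix y assume y: "x \<le> y" "y \<le> v"
    then have "dist (F y) (F x) < e / 2" using d x by (intro d(2)) (auto simp: v_def dist_real_def)
    then show "F y \<le> F x + e / 2" unfolding dist_real_def by linarith
  qed
  moreover have "(\<lambda>n. 1 - (\<integral>y. step x v y \<partial>\<mu> n)) \<longlonglongrightarrow> 1 - (1 - avg x v)"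
    by (intro tendsto_intros step_integral_tendsto[OF x(1) v])
  ultimately have "eventually (\<lambda>n. 1 - (\<integral>y. step x v y \<partial>\<mu> n) < F x + e) sequentially"
    using e by (intro order_tendstoD(2)) auto
  then show ?thesis by eventually_elim (use cdf_\<mu>_le[OF x(1) v] in \<open>auto intro: le_less_trans\<close>)
qed

lemma cdf_lower: assumes x: "0 < x" "x \<le> a" and e: "0 < e"
  shows "eventually (\<lambda>n. F x - e < cdf (\<mu> n) x) sequentially"
proof -
  have "continuous (at x within {0..a}) F" using F_cont x by (auto simp: continuous_on_eq_continuous_within)
  then obtain d where d: "0 < d" "\<And>y. y \<in> {0..a} \<Longrightarrow> dist y x < d \<Longrightarrow> dist (F y) (F x) < e / 2"
    using e unfolding continuous_within_eps_delta by (metis half_gt_zero)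
  define u where "u = max 0 (x - d / 2)"
  have u: "0 \<le> u" "u < x" using x d by (auto simp: u_def)
  have "F x - e / 2 \<le> avg u x"
  proof (rule avg_ge[OF u x(2)])
    fix y assume y: "u \<le> y" "y \<le> x"
    then have "dist (F y) (F x) < e / 2" using d x by (intro d(2)) (auto simp: u_def dist_real_def)
    then show "F x - e / 2 \<le> F y" unfolding dist_real_def by linarith
  qed
  moreover have "(\<lambda>n. 1 - (\<integral>y. step u x y \<partial>\<mu> n)) \<longlonglongrightarrow> 1 - (1 - avg u x)"
    by (intro tendsto_intros step_integral_tendsto[OF u x(2)])
  ultimately have "eventually (\<lambda>n. F x - e < 1 - (\<integral>y. step u x y \<partial>\<mu> n)) sequentially"
    using e by (intro order_tendstoD(1)) auto
  then show ?thesis by eventually_elim (use cdf_\<mu>_ge[OF u x(2)] in \<open>auto intro: less_le_trans\<close>)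
qed

text \<open>The averages of \<open>F\<close> over short intervals on either side of \<open>x\<close> squeeze the distribution functions.\<close>

lemma cdf_tendsto:
  "(\<lambda>n. cdf (\<mu> n) x) \<longlonglongrightarrow> (if x \<le> 0 then 0 else if x < a then F x else 1)"
proof -
  have nn: "0 \<le> cdf (\<mu> n) y" "cdf (\<mu> n) y \<le> 1" for n y
  proof -
    interpret M: real_distribution "\<mu> n" by (rule distr)
    show "0 \<le> cdf (\<mu> n) y" "cdf (\<mu> n) y \<le> 1" by (auto simp: M.cdf_nonneg M.cdf_bounded_prob)
  qed
  have mono: "cdf (\<mu> n) y \<le> cdf (\<mu> n) z" if "y \<le> z" for n y z
  proof -
    interpret M: real_distribution "\<mu> n" by (rule distr)
    show ?thesis using that by (rule M.cdf_nondecreasing)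
  qed
  have up: "eventually (\<lambda>n. cdf (\<mu> n) x < (if x \<le> 0 then 0 else if x < a then F x else 1) + e) sequentially" if e: "0 < e" for e
  proof (cases "x < a")
    case True
    have "eventually (\<lambda>n. cdf (\<mu> n) (max 0 x) < F (max 0 x) + e) sequentially" by (rule cdf_upper) (use True a_pos e in auto)
    then show ?thesis
    proof eventually_elim
      case (elim n)
      show ?case
      proof (cases "x \<le> 0")
        case True
        then have "max 0 x = 0" by simp
        then show ?thesis using elim mono[of x 0 n] True F_0 by simp
      next
        case False
        then have "max 0 x = x" by simp
        then show ?thesis using elim False \<open>x < a\<close> by simp
      qed
    qed
  next
    case False
    then show ?thesis using nn(2) e a_pos by (auto intro!: always_eventually) (smt (verit))
  qed
  have lo: "eventually (\<lambda>n. (if x \<le> 0 then 0 else if x < a then F x else 1) - e < cdf (\<mu> n) x) sequentially" if e: "0 < e" for e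
  proof (cases "x \<le> 0")
    case True
    have "0 - e < cdf (\<mu> n) x" for n using nn(1)[of n x] e by linarith
    then show ?thesis using True by simp
  next
    case False
    have "eventually (\<lambda>n. F (min a x) - e < cdf (\<mu> n) (min a x)) sequentially" by (rule cdf_lower) (use False a_pos e in auto)
    then show ?thesis
    proof eventually_elim
      case (elim n)
      then show ?case using mono[of "min a x" x n] False F_a by (cases "x < a") (auto simp: min_def)
    qed
  qed
  show ?thesis
  proof (rule order_tendstoI)
    fix w assume "w < (if x \<le> 0 then 0 else if x < a then F x else 1)"
    then show "eventually (\<lambda>n. w < cdf (\<mu> n) x) sequentially"
      using lo[of "(if x \<le> 0 then 0 else if x < a then F x else 1) - w"] by simp
  next
    fix w assume "(if x \<le> 0 then 0 else if x < a then F x else 1) < w"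
    then show "eventually (\<lambda>n. cdf (\<mu> n) x < w) sequentially"
      using up[of "w - (if x \<le> 0 then 0 else if x < a then F x else 1)"] by simp
  qed
qed

lemma F_mono: assumes "0 \<le> x" "x \<le> y" "y \<le> a" shows "F x \<le> F y"
proof -
  let ?G = "\<lambda>x. if x \<le> 0 then 0 else if x < a then F x else 1"
  have G: "?G z = F z" if "0 \<le> z" "z \<le> a" for z using that F_0 F_a a_pos by (cases "z = 0"; cases "z = a") auto
  have "?G x \<le> ?G y"
  proof (rule LIMSEQ_le[OF cdf_tendsto cdf_tendsto], intro exI allI impI)
    fix n
    interpret M: real_distribution "\<mu> n" by (rule distr)
    show "cdf (\<mu> n) x \<le> cdf (\<mu> n) y" using assms by (intro M.cdf_nondecreasing)
  qed
  then show ?thesis using G[of x] G[of y] assms by simp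
qed

text \<open>As a limit of distribution functions \<open>F\<close> is monotone, so its derivative is nonnegative.\<close>

theorem density_limit:
  assumes deriv: "\<And>x. x \<in> {0<..<a} \<Longrightarrow> (F has_real_derivative f x) (at x)"
    and f_cont: "continuous_on {0<..<a} f"
  shows "x \<in> {0<..<a} \<Longrightarrow> 0 \<le> f x"
    and "weak_conv_m \<mu> (density lborel (\<lambda>x. ennreal (indicator {0<..<a} x * f x)))"
proof -
  have f_nonneg: "0 \<le> f x" if x: "x \<in> {0<..<a}" for x
  proof (rule ccontr)
    assume "\<not> 0 \<le> f x"
    then obtain d where d: "0 < d" "\<And>h. 0 < h \<Longrightarrow> h < d \<Longrightarrow> F (x + h) < F x"
      using has_real_derivative_neg_dec_right[of F "f x" x UNIV] deriv[OF x] by auto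
    define h where "h = min (d / 2) ((a - x) / 2)"
    have h: "0 < h" "h < d" "x + h \<le> a" using d x by (auto simp: h_def min_def field_simps)
    then have "F x \<le> F (x + h)" using x by (intro F_mono) auto
    then show False using d(2)[OF h(1,2)] by simp
  qed
  then show "x \<in> {0<..<a} \<Longrightarrow> 0 \<le> f x" .
  let ?f = "\<lambda>x. indicator {0<..<a} x * f x"
  have meas: "?f \<in> borel_measurable borel"
    using borel_measurable_continuous_on_indicator[OF _ f_cont] by simp
  have nn_f: "0 \<le> ?f x" for x using f_nonneg[of x] by (auto simp: indicator_def)
  have hi: "(?f has_integral (if x \<le> 0 then 0 else if x < a then F x else 1)) {..x}" for x
  proof -
    have base: "(f has_integral (F z)) {0..z}" if z: "0 \<le> z" "z \<le> a" for z
    proof -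
      have "(f has_integral (F z - F 0)) {0..z}"
        by (rule fundamental_theorem_of_calculus_interior)
           (use z continuous_on_subset[OF F_cont] deriv in \<open>auto simp: has_real_derivative_iff_has_vector_derivative[symmetric]\<close>)
      then show ?thesis using F_0 by simp
    qed
    define z where "z = min a (max 0 x)"
    have z: "0 \<le> z" "z \<le> a" using a_pos by (auto simp: z_def)
    have "((\<lambda>y. if y \<in> {0..z} then f y else 0) has_integral (F z)) UNIV" using base[OF z] by (simp only: has_integral_restrict_UNIV)
    then have "((\<lambda>y. if y \<in> {..x} then ?f y else 0) has_integral (F z)) UNIV"
      by (rule has_integral_spike_finite[of "{0, a, x}", rotated 2]) (auto simp: z_def indicator_def)
    then have "(?f has_integral F z) {..x}" by (simp only: has_integral_restrict_UNIV)
    moreover have "F z = (if x \<le> 0 then 0 else if x < a then F x else 1)" using a_pos F_0 F_a by (auto simp: z_def min_def max_def)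
    ultimately show ?thesis by simp
  qed
  let ?D = "density lborel (\<lambda>x. ennreal (?f x))"
  have cdf_D: "cdf ?D x = (if x \<le> 0 then 0 else if x < a then F x else 1)" for x
  proof -
    let ?r = "if x \<le> 0 then 0 else if x < a then F x else 1"
    have r0: "0 \<le> ?r" by (rule has_integral_nonneg[OF hi]) (use nn_f in auto)
    have "emeasure ?D {..x} = (\<integral>\<^sup>+y. ennreal (?f y) * indicator {..x} y \<partial>lborel)"
      using meas by (subst emeasure_density) auto
    also have "\<dots> = (\<integral>\<^sup>+y. ennreal (?f y * indicator {..x} y) \<partial>lborel)"
      by (intro nn_integral_cong) (auto simp: indicator_def)
    also have "\<dots> = ennreal ?r"
    proof (rule nn_integral_has_integral_lborel)
      show "(\<lambda>y. ?f y * indicator {..x} y) \<in> borel_measurable borel" using meas by measurable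
      show "0 \<le> ?f y * indicator {..x} y" for y using nn_f by auto
      have "((\<lambda>y. if y \<in> {..x} then ?f y else 0) has_integral ?r) UNIV" using hi[of x] by (simp only: has_integral_restrict_UNIV)
      then show "((\<lambda>y. ?f y * indicator {..x} y) has_integral ?r) UNIV"
        by (rule has_integral_eq[rotated]) (auto simp: indicator_def)
    qed
    finally show ?thesis using r0 by (simp add: cdf_def measure_def)
  qed
  show "weak_conv_m \<mu> ?D"
    unfolding weak_conv_m_def weak_conv_def cdf_D using cdf_tendsto by blast
qed

end

section \<open>Random signs\<close>

definition vertex_pairs :: "nat \<Rightarrow> nat set set" where
  "vertex_pairs n = {e. e \<subseteq> {1..n} \<and> card e = 2}"

definition member_sign :: "nat set set \<Rightarrow> nat set \<Rightarrow> real" where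
  "member_sign E e = (if e \<in> E then 1 else -1)"

lemma finite_vertex_pairs: "finite (vertex_pairs n)"
  by (rule finite_subset[of _ "Pow {1..n}"]) (auto simp: vertex_pairs_def)

lemma graphs_on_eq: "graphs_on n = Pow (vertex_pairs n)"
  by (simp add: graphs_on_def vertex_pairs_def)

lemma finite_graphs_on: "finite (graphs_on n)" by (simp add: graphs_on_eq finite_vertex_pairs)
lemma card_graphs_on_pos: "0 < card (graphs_on n)"
  using finite_graphs_on by (auto simp: card_gt_0_iff graphs_on_eq)

text \<open>The edge signs are independent with mean zero.\<close>

lemma sign_character_sum:
  "(\<Sum>E\<in>graphs_on n. \<Prod>e\<in>vertex_pairs n. member_sign E e ^ m e) =
     (if \<forall>e\<in>vertex_pairs n. even (m e) then real (card (graphs_on n)) else 0)"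
proof (cases "\<forall>e\<in>vertex_pairs n. even (m e)")
  case True
  then have "(\<Prod>e\<in>vertex_pairs n. member_sign E e ^ m e) = 1" for E
    by (intro prod.neutral) (auto simp: member_sign_def)
  then show ?thesis using True by simp
next
  case False
  then obtain d where d: "d \<in> vertex_pairs n" "odd (m d)" by auto
  let ?f = "\<lambda>E. \<Prod>e\<in>vertex_pairs n. member_sign E e ^ m e"
  \<comment> \<open>Toggling the edge \<open>d\<close> is an involution on the graphs that changes the sign of every term.\<close>
  define flip where "flip E = (if d \<in> E then E - {d} else insert d E)" for E :: "nat set set"
  have flip: "flip (flip E) = E" for E by (auto simp: flip_def)
  have "?f (flip E) = - ?f E" for E
  proof -
    have "?f X = member_sign X d ^ m d * (\<Prod>e\<in>vertex_pairs n - {d}. member_sign X e ^ m e)" for X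
      by (rule prod.remove[OF finite_vertex_pairs d(1)])
    moreover have "(\<Prod>e\<in>vertex_pairs n - {d}. member_sign (flip E) e ^ m e) = (\<Prod>e\<in>vertex_pairs n - {d}. member_sign E e ^ m e)"
      by (rule prod.cong) (auto simp: member_sign_def flip_def)
    moreover have "member_sign (flip E) d ^ m d = - (member_sign E d ^ m d)"
      using d(2) by (auto simp: member_sign_def flip_def)
    ultimately show ?thesis by simp
  qed
  then have "(\<Sum>E\<in>graphs_on n. ?f (flip E)) = - (\<Sum>E\<in>graphs_on n. ?f E)" by (simp add: sum_negf)
  moreover have "(\<Sum>E\<in>graphs_on n. ?f (flip E)) = (\<Sum>E\<in>graphs_on n. ?f E)"
    by (rule sum.reindex_bij_witness[where i = flip and j = flip]) (use flip d in \<open>auto simp: graphs_on_eq flip_def\<close>)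
  ultimately have "(\<Sum>E\<in>graphs_on n. ?f E) = 0" by simp
  then show ?thesis by (simp only: if_not_P[OF False])
qed

lemma set_triples_of: "set (triples n) = triples_of {1..n}"
  by (simp add: set_triples triples_of_def)

lemma edge_mult_outside:
  assumes c: "c \<in> closed_walks {1..n} k" and k: "0 < k" and e: "e \<notin> vertex_pairs n"
  shows "triple_walk.edge_mult k (walk_of k c) e = 0"
proof (rule ccontr)
  interpret C: triple_walk k "walk_of k c" by (rule triple_walk_walk_of[OF c k])
  assume "C.edge_mult e \<noteq> 0"
  then have pos: "0 < C.edge_mult e" by simp
  have "walk_verts k c \<subseteq> {1..n}" using closed_walkD(3)[OF c] by (auto simp: walk_verts_def)
  then have "e \<subseteq> {1..n}" using C.edge_subset_verts[OF pos] triple_walk_verts[OF c k] by simp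
  moreover obtain j d where "j < 2 * k" "d < 5" "C.walk_edge (j, d) = e"
    using pos unfolding C.edge_mult_def by (auto simp: card_gt_0_iff)
  then have "card e = 2" using C.walk_edge_distinct[of j d] by auto
  ultimately show False using e by (simp add: vertex_pairs_def)
qed

definition walk_sign :: "nat \<Rightarrow> nat \<Rightarrow> nat set set \<Rightarrow> (nat \<Rightarrow> nat list) \<Rightarrow> real" where
  "walk_sign n k E c = (\<Prod>e\<in>vertex_pairs n. member_sign E e ^ triple_walk.edge_mult k (walk_of k c) e)"

text \<open>The product along the walk is regrouped by the edges of the graph.\<close>

lemma Z3_walk_product:
  assumes c: "c \<in> closed_walks {1..n} k" and k: "0 < k"
  shows "(\<Prod>j<2 * k. if even j then Z3_entry E (c (Suc j mod (2 * k))) (c j) else Z3_entry E (c j) (c (Suc j mod (2 * k))))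
    = walk_sign n k E c"
proof -
  interpret C: triple_walk k "walk_of k c" by (rule triple_walk_walk_of[OF c k])
  have sym: "edge_sign E a b = edge_sign E b a" for a b by (simp add: edge_sign_def insert_commute)
  have h: "member_sign E {a, b} = edge_sign E a b" for a b by (simp add: member_sign_def edge_sign_def)
  have "(\<Prod>j<2 * k. if even j then Z3_entry E (c (Suc j mod (2 * k))) (c j) else Z3_entry E (c j) (c (Suc j mod (2 * k))))
     = (\<Prod>j<2 * k. C.step_weight (edge_sign E) j)"
  proof (rule prod.cong)
    fix j assume "j \<in> {..<2 * k}"
    then have j: "j < 2 * k" by simp
    have t: "walk_of k c j i = c j ! i" "walk_of k c (Suc j) i = c (Suc j mod (2 * k)) ! i" for i
      using j by (simp_all add: walk_of_def)
    have d: "set (c j) \<inter> set (c (Suc j mod (2 * k))) = {}" by (rule closed_walkD(4)[OF c j])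
    show "(if even j then Z3_entry E (c (Suc j mod (2 * k))) (c j) else Z3_entry E (c j) (c (Suc j mod (2 * k)))) = C.step_weight (edge_sign E) j"
    proof (cases "even j")
      case True
      have "set (c (Suc j mod (2 * k))) \<inter> set (c j) = {}" using d by blast
      then have "Z3_entry E (c (Suc j mod (2 * k))) (c j) =
          (\<Prod>i<3. edge_sign E (c (Suc j mod (2 * k)) ! i) (c j ! i)) * (\<Prod>i<2. edge_sign E (c (Suc j mod (2 * k)) ! Suc i) (c j ! i))"
        by (simp add: Z3_entry_def)
      moreover have "(\<Prod>i<3. edge_sign E (c (Suc j mod (2 * k)) ! i) (c j ! i)) = (\<Prod>i<3. edge_sign E (c j ! i) (c (Suc j mod (2 * k)) ! i))"
        by (rule prod.cong[OF refl]) (rule sym)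
      moreover have "(\<Prod>i<2. edge_sign E (c (Suc j mod (2 * k)) ! Suc i) (c j ! i)) = (\<Prod>i<2. edge_sign E (c j ! i) (c (Suc j mod (2 * k)) ! Suc i))"
        by (rule prod.cong[OF refl]) (rule sym)
      ultimately show ?thesis using True by (simp only: C.step_weight_def t if_True)
    next
      case False
      then show ?thesis using d by (simp only: C.step_weight_def t if_False Z3_entry_def if_True simp_thms)
    qed
  qed simp
  also have "\<dots> = (\<Prod>q\<in>{..<2 * k} \<times> {..<5}. member_sign E (C.walk_edge q))"
    by (rule C.step_weight_product_edges) (rule h)
  also have "\<dots> = (\<Prod>e\<in>C.walk_edge ` ({..<2 * k} \<times> {..<5}). member_sign E e ^ C.edge_mult e)"
    by (rule C.edge_product_by_multiplicity)
  also have "\<dots> = (\<Prod>e\<in>vertex_pairs n. member_sign E e ^ C.edge_mult e)"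
  proof (rule prod.mono_neutral_left)
    show "finite (vertex_pairs n)" by (rule finite_vertex_pairs)
    show "C.walk_edge ` ({..<2 * k} \<times> {..<5}) \<subseteq> vertex_pairs n"
    proof (rule image_subsetI)
      fix q assume q: "q \<in> {..<2 * k} \<times> {..<5::nat}"
      define S where "S = {q' \<in> {..<2 * k} \<times> {..<5::nat}. C.walk_edge q' = C.walk_edge q}"
      have "q \<in> S" using q by (simp add: S_def)
      moreover have "finite S" unfolding S_def by (rule finite_subset[of _ "{..<2 * k} \<times> {..<5}"]) auto
      ultimately have "card S \<noteq> 0" by auto
      then have "C.edge_mult (C.walk_edge q) \<noteq> 0" unfolding C.edge_mult_def S_def .
      then show "C.walk_edge q \<in> vertex_pairs n" by (rule contrapos_np) (rule edge_mult_outside[OF c k])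
    qed
    show "\<forall>e\<in>vertex_pairs n - C.walk_edge ` ({..<2 * k} \<times> {..<5}). member_sign E e ^ C.edge_mult e = 1"
    proof
      fix e assume "e \<in> vertex_pairs n - C.walk_edge ` ({..<2 * k} \<times> {..<5})"
      then have "{q \<in> {..<2 * k} \<times> {..<5}. C.walk_edge q = e} = {}" by auto
      then have "C.edge_mult e = 0" unfolding C.edge_mult_def by (metis card.empty)
      then show "member_sign E e ^ C.edge_mult e = 1" by simp
    qed
  qed
  finally show ?thesis by (simp add: walk_sign_def)
qed

definition sign_trace :: "nat \<Rightarrow> nat \<Rightarrow> nat set set \<Rightarrow> real" where
  "sign_trace n k E = (\<Sum>c\<in>closed_walks {1..n} k. walk_sign n k E c)"

lemma mtrace_scaled_Z3:
  assumes k: "0 < k" and M: "M = r \<cdot>\<^sub>m Z3_matrix n E"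
  shows "mtrace ((transpose_mat M * M) ^\<^sub>m k) = r ^ (2 * k) * sign_trace n k E"
proof -
  have M': "M = mat (length (triples n)) (length (triples n)) (\<lambda>(i, j). r * Z3_entry E (triples n ! i) (triples n ! j))"
    unfolding M Z3_matrix_def by (auto intro!: eq_matI)
  let ?Z = "\<lambda>c j. if even j then Z3_entry E (c (Suc j mod (2 * k))) (c j) else Z3_entry E (c j) (c (Suc j mod (2 * k)))"
  have "mtrace ((transpose_mat M * M) ^\<^sub>m k) =
    (\<Sum>c\<in>{..<2 * k} \<rightarrow>\<^sub>E set (triples n). \<Prod>j<2 * k. if even j then r * Z3_entry E (c (Suc j mod (2 * k))) (c j) else r * Z3_entry E (c j) (c (Suc j mod (2 * k))))"
    by (rule mtrace_gram_power[OF distinct_triples M' k])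
  also have "\<dots> = (\<Sum>c\<in>{..<2 * k} \<rightarrow>\<^sub>E triples_of {1..n}. r ^ (2 * k) * (\<Prod>j<2 * k. ?Z c j))"
  proof (rule sum.cong)
    fix c
    have "(\<Prod>j<2 * k. if even j then r * Z3_entry E (c (Suc j mod (2 * k))) (c j) else r * Z3_entry E (c j) (c (Suc j mod (2 * k))))
       = (\<Prod>j<2 * k. r * ?Z c j)" by (rule prod.cong) auto
    then show "(\<Prod>j<2 * k. if even j then r * Z3_entry E (c (Suc j mod (2 * k))) (c j) else r * Z3_entry E (c j) (c (Suc j mod (2 * k))))
       = r ^ (2 * k) * (\<Prod>j<2 * k. ?Z c j)" by (simp add: prod.distrib)
  qed (simp add: set_triples_of)
  also have "\<dots> = r ^ (2 * k) * (\<Sum>c\<in>{..<2 * k} \<rightarrow>\<^sub>E triples_of {1..n}. \<Prod>j<2 * k. ?Z c j)"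
    by (simp add: sum_distrib_left)
  also have "(\<Sum>c\<in>{..<2 * k} \<rightarrow>\<^sub>E triples_of {1..n}. \<Prod>j<2 * k. ?Z c j) = (\<Sum>c\<in>closed_walks {1..n} k. \<Prod>j<2 * k. ?Z c j)"
  proof (rule sum.mono_neutral_right)
    show "finite ({..<2 * k} \<rightarrow>\<^sub>E triples_of {1..n})" by (intro finite_PiE finite_triples_of) auto
    show "closed_walks {1..n} k \<subseteq> {..<2 * k} \<rightarrow>\<^sub>E triples_of {1..n}" by (auto simp: closed_walks_def)
    show "\<forall>c\<in>({..<2 * k} \<rightarrow>\<^sub>E triples_of {1..n}) - closed_walks {1..n} k. (\<Prod>j<2 * k. ?Z c j) = 0"
    proof
      fix c assume "c \<in> ({..<2 * k} \<rightarrow>\<^sub>E triples_of {1..n}) - closed_walks {1..n} k"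
      then obtain j where j: "j < 2 * k" "set (c j) \<inter> set (c (Suc j mod (2 * k))) \<noteq> {}" by (auto simp: closed_walks_def)
      then have "?Z c j = 0" by (auto simp: Z3_entry_def Int_commute)
      with j(1) have "\<exists>j\<in>{..<2 * k}. ?Z c j = 0" by blast
      then show "(\<Prod>j<2 * k. ?Z c j) = 0" by (intro prod_zero) simp
    qed
  qed
  also have "\<dots> = sign_trace n k E" unfolding sign_trace_def by (rule sum.cong[OF refl]) (rule Z3_walk_product[OF _ k])
  finally show ?thesis .
qed

lemma balanced_iff:
  assumes c: "c \<in> closed_walks {1..n} k" and k: "0 < k"
  shows "c \<in> balanced_walks {1..n} k \<longleftrightarrow> (\<forall>e\<in>vertex_pairs n. even (triple_walk.edge_mult k (walk_of k c) e))"
proof -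
  interpret C: triple_walk k "walk_of k c" by (rule triple_walk_walk_of[OF c k])
  show ?thesis using edge_mult_outside[OF c k] c by (auto simp: balanced_walks_def C.balanced_edges_def)
qed

lemma sum_sign_trace:
  assumes k: "0 < k"
  shows "(\<Sum>E\<in>graphs_on n. sign_trace n k E) = real (card (graphs_on n)) * real (card (balanced_walks {1..n} k))"
proof -
  have fin: "finite (closed_walks {1..n} k)" by (rule finite_closed_walks) simp
  have "(\<Sum>E\<in>graphs_on n. sign_trace n k E) = (\<Sum>c\<in>closed_walks {1..n} k. \<Sum>E\<in>graphs_on n. walk_sign n k E c)"
    unfolding sign_trace_def by (rule sum.swap)
  also have "\<dots> = (\<Sum>c\<in>closed_walks {1..n} k. if c \<in> balanced_walks {1..n} k then real (card (graphs_on n)) else 0)"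
  proof (rule sum.cong[OF refl])
    fix c assume c: "c \<in> closed_walks {1..n} k"
    show "(\<Sum>E\<in>graphs_on n. walk_sign n k E c) = (if c \<in> balanced_walks {1..n} k then real (card (graphs_on n)) else 0)"
      unfolding walk_sign_def sign_character_sum balanced_iff[OF c k] ..
  qed
  also have "\<dots> = (\<Sum>c\<in>closed_walks {1..n} k \<inter> balanced_walks {1..n} k. real (card (graphs_on n)))"
    by (rule sum.inter_restrict[OF fin, symmetric])
  also have "closed_walks {1..n} k \<inter> balanced_walks {1..n} k = balanced_walks {1..n} k" by (auto simp: balanced_walks_def)
  finally show ?thesis by simp
qed

text \<open>A pair of walks contributes when the two together use every edge evenly: both are balanced, or the
  pair is linked.\<close>

lemma sum_sign_trace_square:
  assumes k: "0 < k"
  shows "(\<Sum>E\<in>graphs_on n. (sign_trace n k E)^2) = real (card (graphs_on n)) *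
     (real (card (balanced_walks {1..n} k))^2 + real (card (linked_pairs {1..n} k)))"
proof -
  let ?W = "closed_walks {1..n} k" and ?B = "balanced_walks {1..n} k"
  have fin: "finite ?W" by (rule finite_closed_walks) simp
  let ?m = "\<lambda>c. triple_walk.edge_mult k (walk_of k c)"
  define P where "P = {p \<in> ?W \<times> ?W. \<forall>e\<in>vertex_pairs n. even (?m (fst p) e + ?m (snd p) e)}"
  have "(\<Sum>E\<in>graphs_on n. (sign_trace n k E)^2) = (\<Sum>E\<in>graphs_on n. \<Sum>p\<in>?W \<times> ?W. walk_sign n k E (fst p) * walk_sign n k E (snd p))"
    unfolding sign_trace_def power2_eq_square sum_product sum.cartesian_product by (simp add: case_prod_beta)
  also have "\<dots> = (\<Sum>p\<in>?W \<times> ?W. \<Sum>E\<in>graphs_on n. walk_sign n k E (fst p) * walk_sign n k E (snd p))" by (rule sum.swap)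
  also have "\<dots> = (\<Sum>p\<in>?W \<times> ?W. if p \<in> P then real (card (graphs_on n)) else 0)"
  proof (rule sum.cong)
    fix p assume p: "p \<in> ?W \<times> ?W"
    have "(\<Sum>E\<in>graphs_on n. walk_sign n k E (fst p) * walk_sign n k E (snd p)) =
       (\<Sum>E\<in>graphs_on n. \<Prod>e\<in>vertex_pairs n. member_sign E e ^ (?m (fst p) e + ?m (snd p) e))"
      by (simp only: walk_sign_def prod.distrib[symmetric] power_add)
    also have "\<dots> = (if p \<in> P then real (card (graphs_on n)) else 0)"
      unfolding sign_character_sum using p by (simp add: P_def)
    finally show "(\<Sum>E\<in>graphs_on n. walk_sign n k E (fst p) * walk_sign n k E (snd p)) = (if p \<in> P then real (card (graphs_on n)) else 0)" .
  qed simp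
  also have "\<dots> = (\<Sum>p\<in>(?W \<times> ?W) \<inter> P. real (card (graphs_on n)))"
    by (rule sum.inter_restrict[symmetric]) (use fin in simp)
  also have "(?W \<times> ?W) \<inter> P = P" by (auto simp: P_def)
  also have "P = ?B \<times> ?B \<union> linked_pairs {1..n} k"
  proof -
    have iff: "p \<in> P \<longleftrightarrow> p \<in> ?W \<times> ?W \<and> (\<forall>e. even (?m (fst p) e + ?m (snd p) e))" for p
    proof (cases "p \<in> ?W \<times> ?W")
      case True
      then have "?m (fst p) e = 0" "?m (snd p) e = 0" if "e \<notin> vertex_pairs n" for e
        using edge_mult_outside[OF _ k that] by auto
      then have "even (?m (fst p) e + ?m (snd p) e)" if "e \<notin> vertex_pairs n" for e using that by simp
      then show ?thesis using True unfolding P_def by blast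
    qed (auto simp: P_def)
    have B: "c \<in> ?B \<longleftrightarrow> c \<in> ?W \<and> (\<forall>e. even (?m c e))" for c
      using triple_walk.balanced_edges_def[OF triple_walk_walk_of[OF _ k, of c "{1..n}"]] by (auto simp: balanced_walks_def)
    show ?thesis
    proof (rule Set.set_eqI)
      fix p
      show "p \<in> P \<longleftrightarrow> p \<in> ?B \<times> ?B \<union> linked_pairs {1..n} k"
      proof (cases p)
        case (Pair c c')
        show ?thesis unfolding Pair iff Un_iff mem_Times_iff linked_pairs_def using B[of c] B[of c'] by auto
      qed
    qed
  qed
  also have "(\<Sum>p\<in>?B \<times> ?B \<union> linked_pairs {1..n} k. real (card (graphs_on n))) =
     real (card (graphs_on n)) * real (card (?B \<times> ?B \<union> linked_pairs {1..n} k))" by simp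
  also have "card (?B \<times> ?B \<union> linked_pairs {1..n} k) = card ?B * card ?B + card (linked_pairs {1..n} k)"
  proof -
    have "finite ?B" by (rule finite_subset[OF _ fin]) (auto simp: balanced_walks_def)
    moreover have "finite (linked_pairs {1..n} k)" by (rule finite_subset[of _ "?W \<times> ?W"]) (use fin in \<open>auto simp: linked_pairs_def\<close>)
    moreover have "(?B \<times> ?B) \<inter> linked_pairs {1..n} k = {}" by (auto simp: linked_pairs_def)
    ultimately show ?thesis by (subst card_Un_disjoint) (auto simp: card_cartesian_product)
  qed
  finally show ?thesis by (simp add: power2_eq_square)
qed

text \<open>The variance of the trace counts the linked pairs.\<close>

lemma sum_sign_trace_deviation:
  assumes k: "0 < k"
  shows "(\<Sum>E\<in>graphs_on n. (sign_trace n k E - real (card (balanced_walks {1..n} k)))^2)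
     = real (card (graphs_on n)) * real (card (linked_pairs {1..n} k))"
proof -
  let ?b = "real (card (balanced_walks {1..n} k))"
  have "(\<Sum>E\<in>graphs_on n. (sign_trace n k E - ?b)^2) =
     (\<Sum>E\<in>graphs_on n. (sign_trace n k E)^2 - 2 * ?b * sign_trace n k E + ?b^2)"
    by (rule sum.cong[OF refl]) (simp add: power2_diff mult_ac)
  also have "\<dots> = (\<Sum>E\<in>graphs_on n. (sign_trace n k E)^2) - 2 * ?b * (\<Sum>E\<in>graphs_on n. sign_trace n k E) + real (card (graphs_on n)) * ?b^2"
    by (simp only: sum.distrib sum_subtractf sum_distrib_left[symmetric] sum_constant)
  finally show ?thesis unfolding sum_sign_trace[OF k] sum_sign_trace_square[OF k] by (simp add: algebra_simps power2_eq_square)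
qed

section \<open>Almost sure convergence of the moments\<close>

lemma card_triples_of: assumes "3 \<le> n" shows "card (triples_of {1..n}) = n * (n - 1) * (n - 2)"
proof -
  have "card (triples_of {1..n}) = \<Prod>{card {1..n} - 3 + 1..card {1..n}}"
    unfolding triples_of_def by (rule card_lists_distinct_length_eq) (use assms in auto)
  also have "{card {1..n} - 3 + 1..card {1..n}} = {n - 2, n - 1, n}" using assms by auto
  also have "\<Prod>\<dots> = n * (n - 1) * (n - 2)"
  proof -
    have "n - 2 \<noteq> n - 1" "n - 2 \<noteq> n" "n - 1 \<noteq> n" using assms by arith+
    then show ?thesis by simp
  qed
  finally show ?thesis .
qed

lemma length_triples: "length (triples n) = card (triples_of {1..n})"
  using distinct_card[OF distinct_triples[of n]] set_triples_of[of n] by simp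

lemma card_triples_ge: assumes "3 \<le> n" shows "(real n / 3) ^ 3 \<le> real (card (triples_of {1..n}))"
proof -
  have "(real n / 3) ^ 3 = (real n / 3) * (real n / 3) * (real n / 3)" by (simp add: power3_eq_cube)
  also have "\<dots> \<le> real n * real (n - 1) * real (n - 2)"
    by (intro mult_mono) (use assms in \<open>auto simp: of_nat_diff\<close>)
  finally show ?thesis unfolding card_triples_of[OF assms] by (simp only: of_nat_mult)
qed

lemma balanced_walks_asymptotics:
  assumes k: "0 < k"
  shows "(\<lambda>n. real (card (balanced_walks {1..n} k)) / (real (card (triples_of {1..n})) * real n ^ (3 * k)))
     \<longlonglongrightarrow> real (pairings (zigzag_word k) [])"
proof -
  let ?N = "\<lambda>n. real (card (triples_of {1..n}))" and ?p = "real (pairings (zigzag_word k) [])"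
  define K where "K = real ((3 * k + 2) ^ (6 * k))"
  have fl: "(\<lambda>n. ?p * (\<Prod>i<3 * k. real (n - 3 - i) / real n)) \<longlonglongrightarrow> ?p * (\<Prod>i<3 * k. 1)"
  proof (intro tendsto_intros)
    fix i
    have "(\<lambda>n. 1 - real (3 + i) / real n) \<longlonglongrightarrow> 1 - 0" by (intro tendsto_diff tendsto_const lim_const_over_n)
    then have lim: "(\<lambda>n. 1 - real (3 + i) / real n) \<longlonglongrightarrow> 1" by simp
    have "eventually (\<lambda>n. 1 - real (3 + i) / real n = real (n - 3 - i) / real n) sequentially"
      using eventually_ge_at_top[of "Suc (3 + i)"] by eventually_elim (auto simp: of_nat_diff field_simps)
    then show "(\<lambda>n. real (n - 3 - i) / real n) \<longlonglongrightarrow> 1" by (rule Lim_transform_eventually[OF lim])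
  qed
  have lower: "?p * (\<Prod>i<3 * k. real (n - 3 - i) / real n) \<le> real (card (balanced_walks {1..n} k)) / (?N n * real n ^ (3 * k))"
    and upper: "real (card (balanced_walks {1..n} k)) / (?N n * real n ^ (3 * k)) \<le> ?p * (\<Prod>i<3 * k. real (n - 3 - i) / real n) + 27 * K / real n"
    if n: "3 \<le> n" for n
  proof -
    have N: "finite {1..n}" "{1..n} \<noteq> {}" using n by auto
    have Npos: "0 < ?N n" using card_triples_of[OF n] n by simp
    have np: "0 < real n" using n by simp
    have r: "real (card (run_codes {1..n} k)) / (?N n * real n ^ (3 * k)) = ?p * (\<Prod>i<3 * k. real (n - 3 - i) / real n)"
    proof -
      have "real (card (run_codes {1..n} k)) = ?N n * (?p * (\<Prod>i<3 * k. real (n - 3 - i)))"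
        unfolding card_run_codes[OF N(1)] falling_def by simp
      then show ?thesis using Npos by (simp add: prod_dividef)
    qed
    have "real (card (run_codes {1..n} k)) \<le> real (card (balanced_walks {1..n} k))" using card_balanced_walks(1)[OF N k] by simp
    then have "real (card (run_codes {1..n} k)) / (?N n * real n ^ (3 * k)) \<le> real (card (balanced_walks {1..n} k)) / (?N n * real n ^ (3 * k))"
      by (intro divide_right_mono) auto
    then show "?p * (\<Prod>i<3 * k. real (n - 3 - i) / real n) \<le> real (card (balanced_walks {1..n} k)) / (?N n * real n ^ (3 * k))"
      unfolding r .
    have "card (balanced_walks {1..n} k) \<le> card (run_codes {1..n} k) + (3 * k + 2) ^ (6 * k) * n ^ (3 * k + 2)"
      using card_balanced_walks(2)[OF N k] by simp
    then have "real (card (balanced_walks {1..n} k)) \<le> real (card (run_codes {1..n} k)) + K * real n ^ (3 * k + 2)"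
      unfolding K_def by (metis of_nat_add of_nat_le_iff of_nat_mult of_nat_power)
    then have "real (card (balanced_walks {1..n} k)) / (?N n * real n ^ (3 * k)) \<le> (real (card (run_codes {1..n} k)) + K * real n ^ (3 * k + 2)) / (?N n * real n ^ (3 * k))"
      by (intro divide_right_mono) auto
    also have "\<dots> = ?p * (\<Prod>i<3 * k. real (n - 3 - i) / real n) + K * real n ^ 2 / ?N n"
      unfolding add_divide_distrib r using np by (simp add: power_add power2_eq_square)
    also have "K * real n ^ 2 / ?N n \<le> K * real n ^ 2 / (real n / 3) ^ 3"
      using card_triples_ge[OF n] np by (intro divide_left_mono mult_pos_pos Npos) (auto simp: K_def)
    also have "K * real n ^ 2 / (real n / 3) ^ 3 = 27 * K / real n" using np by (simp add: field_simps power3_eq_cube power2_eq_square)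
    finally show "real (card (balanced_walks {1..n} k)) / (?N n * real n ^ (3 * k)) \<le> ?p * (\<Prod>i<3 * k. real (n - 3 - i) / real n) + 27 * K / real n" by simp
  qed
  have "(\<lambda>n. ?p * (\<Prod>i<3 * k. real (n - 3 - i) / real n) + 27 * K / real n) \<longlonglongrightarrow> ?p * (\<Prod>i<3 * k. 1) + 0"
    by (intro tendsto_add fl lim_const_over_n)
  then have up: "(\<lambda>n. ?p * (\<Prod>i<3 * k. real (n - 3 - i) / real n) + 27 * K / real n) \<longlonglongrightarrow> ?p" by simp
  have lo: "(\<lambda>n. ?p * (\<Prod>i<3 * k. real (n - 3 - i) / real n)) \<longlonglongrightarrow> ?p" using fl by simp
  show ?thesis
    by (rule tendsto_sandwich[OF _ _ lo up]) (use lower upper in \<open>auto intro: eventually_sequentiallyI[of 3]\<close>)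
qed

definition scaled_deviation :: "nat \<Rightarrow> nat \<Rightarrow> nat set set \<Rightarrow> real" where
  "scaled_deviation k n E = ((sign_trace n k E - real (card (balanced_walks {1..n} k))) / (real (card (triples_of {1..n})) * real n ^ (3 * k)))^2"

text \<open>There are at most of order \<open>n ^ (6 k + 4)\<close> linked pairs, two powers below the square of the mean.\<close>

lemma mean_scaled_deviation:
  assumes k: "0 < k"
  obtains C where "\<And>n. 3 \<le> n \<Longrightarrow> (\<Sum>E\<in>graphs_on n. scaled_deviation k n E) / real (card (graphs_on n)) \<le> C / real n ^ 2"
proof -
  define K where "K = real ((6 * k + 4) ^ (12 * k))"
  have "(\<Sum>E\<in>graphs_on n. scaled_deviation k n E) / real (card (graphs_on n)) \<le> (729 * K) / real n ^ 2" if n: "3 \<le> n" for n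
  proof -
    let ?d = "real (card (triples_of {1..n})) * real n ^ (3 * k)"
    have np: "0 < real n" using n by simp
    have N: "finite {1..n}" "{1..n} \<noteq> {}" using n by auto
    have "(\<Sum>E\<in>graphs_on n. scaled_deviation k n E) = real (card (graphs_on n)) * real (card (linked_pairs {1..n} k)) / ?d^2"
      unfolding scaled_deviation_def power_divide sum_divide_distrib[symmetric] sum_sign_trace_deviation[OF k] ..
    then have "(\<Sum>E\<in>graphs_on n. scaled_deviation k n E) / real (card (graphs_on n)) = real (card (linked_pairs {1..n} k)) / ?d^2"
      using card_graphs_on_pos[of n] by simp
    also have "\<dots> \<le> (K * real n ^ (6 * k + 4)) / ?d^2"
    proof (rule divide_right_mono)
      have "card (linked_pairs {1..n} k) \<le> (6 * k + 4) ^ (12 * k) * n ^ (6 * k + 4)" using card_linked_pairs[OF N k] by simp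
      then show "real (card (linked_pairs {1..n} k)) \<le> K * real n ^ (6 * k + 4)" unfolding K_def by (metis of_nat_le_iff of_nat_mult of_nat_power)
    qed simp
    also have "\<dots> \<le> (K * real n ^ (6 * k + 4)) / ((real n / 3) ^ 3 * real n ^ (3 * k))^2"
    proof (rule divide_left_mono)
      show "((real n / 3) ^ 3 * real n ^ (3 * k))^2 \<le> ?d^2"
        using card_triples_ge[OF n] np by (intro power_mono mult_right_mono) auto
      show "0 < ?d^2 * ((real n / 3) ^ 3 * real n ^ (3 * k))^2" using np card_triples_of[OF n] n by simp
    qed (use np in \<open>simp add: K_def\<close>)
    also have "\<dots> = (729 * K) / real n ^ 2"
    proof -
      have "((real n / 3) ^ 3 * real n ^ (3 * k))^2 = real n ^ (6 * k + 4) * real n ^ 2 / 729"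
        by (simp add: power_divide power_mult_distrib power_add power_mult[symmetric] mult.commute flip: power_add)
      moreover have "K * A / (A * B / 729) = 729 * K / B" if "0 < A" "0 < B" for A B :: real
        using that by (simp add: field_simps)
      ultimately show ?thesis using np by (simp only: zero_less_power)
    qed
    finally show ?thesis .
  qed
  then show thesis using that by blast
qed

lemma nn_integral_uniform_random_graph:
  assumes G: "uniform_random_graph P n X"
  shows "(\<integral>\<^sup>+\<omega>. ennreal (h (X \<omega>)) \<partial>P) = (\<Sum>E\<in>graphs_on n. ennreal (h E) / of_nat (card (graphs_on n)))"
proof -
  have m: "X \<in> measurable P (count_space (graphs_on n))" and d: "distr P (count_space (graphs_on n)) X = uniform_count_measure (graphs_on n)"
    using G by (auto simp: uniform_random_graph_def)
  have "(\<integral>\<^sup>+\<omega>. ennreal (h (X \<omega>)) \<partial>P) = (\<integral>\<^sup>+E. ennreal (h E) \<partial>distr P (count_space (graphs_on n)) X)"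
    by (subst nn_integral_distr[OF m]) auto
  also have "\<dots> = (\<Sum>E\<in>graphs_on n. ennreal (1 / real (card (graphs_on n))) * ennreal (h E))"
    unfolding d uniform_count_measure_def by (rule nn_integral_point_measure_finite[OF finite_graphs_on])
  also have "\<dots> = (\<Sum>E\<in>graphs_on n. ennreal (h E) / of_nat (card (graphs_on n)))"
  proof (rule sum.cong)
    fix E
    have "ennreal (1 / real (card (graphs_on n))) = 1 / of_nat (card (graphs_on n))"
      using card_graphs_on_pos[of n] by (simp add: divide_ennreal[symmetric] ennreal_of_nat_eq_real_of_nat flip: ennreal_1)
    then show "ennreal (1 / real (card (graphs_on n))) * ennreal (h E) = ennreal (h E) / of_nat (card (graphs_on n))"
      by (simp add: ennreal_divide_times divide_ennreal_def mult.commute)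
  qed simp
  finally show ?thesis .
qed

text \<open>The second moments are summable, so almost surely the squared deviations are summable as well.\<close>

lemma deviation_tendsto_AE:
  fixes P :: "'w measure"
  assumes P: "prob_space P" and G: "\<And>n. uniform_random_graph P n (G n)" and k: "0 < k"
  shows "AE \<omega> in P. (\<lambda>n. scaled_deviation k n (G n \<omega>)) \<longlonglongrightarrow> 0"
proof -
  obtain C where C: "\<And>n. 3 \<le> n \<Longrightarrow> (\<Sum>E\<in>graphs_on n. scaled_deviation k n E) / real (card (graphs_on n)) \<le> C / real n ^ 2"
    using mean_scaled_deviation[OF k] by blast
  \<comment> \<open>There are no triples, hence nothing to scale by, for fewer than three vertices.\<close>
  define Y where "Y n \<omega> = scaled_deviation k (n + 3) (G (n + 3) \<omega>)" for n \<omega>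
  have nn: "0 \<le> scaled_deviation k n E" for n E by (simp add: scaled_deviation_def)
  have meas: "(\<lambda>\<omega>. ennreal (Y n \<omega>)) \<in> borel_measurable P" for n
  proof -
    have "G (n + 3) \<in> measurable P (count_space (graphs_on (n + 3)))" using G[of "n + 3"] by (simp add: uniform_random_graph_def)
    then have "(\<lambda>\<omega>. ennreal (scaled_deviation k (n + 3) (G (n + 3) \<omega>))) \<in> borel_measurable P"
      by (rule measurable_compose) simp
    then show ?thesis by (simp add: Y_def)
  qed
  have mean: "(\<integral>\<^sup>+\<omega>. ennreal (Y n \<omega>) \<partial>P) \<le> ennreal (C / real (n + 3) ^ 2)" for n
  proof -
    let ?g = "card (graphs_on (n + 3))"
    have "(\<integral>\<^sup>+\<omega>. ennreal (Y n \<omega>) \<partial>P) = (\<Sum>E\<in>graphs_on (n + 3). ennreal (scaled_deviation k (n + 3) E) / of_nat ?g)"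
      unfolding Y_def by (rule nn_integral_uniform_random_graph[OF G])
    also have "\<dots> = (\<Sum>E\<in>graphs_on (n + 3). ennreal (scaled_deviation k (n + 3) E / real ?g))"
      using card_graphs_on_pos[of "n + 3"] nn by (intro sum.cong) (auto simp: ennreal_of_nat_eq_real_of_nat divide_ennreal)
    also have "\<dots> = ennreal ((\<Sum>E\<in>graphs_on (n + 3). scaled_deviation k (n + 3) E) / real ?g)"
      using nn by (simp add: sum_ennreal sum_divide_distrib)
    also have "\<dots> \<le> ennreal (C / real (n + 3) ^ 2)" by (intro ennreal_leI C) simp
    finally show ?thesis .
  qed
  have C0: "0 \<le> C"
  proof -
    have "0 \<le> (\<Sum>E\<in>graphs_on 3. scaled_deviation k 3 E) / real (card (graphs_on 3))" by (intro divide_nonneg_nonneg sum_nonneg nn) auto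
    also have "\<dots> \<le> C / real 3 ^ 2" by (rule C) simp
    finally show ?thesis by simp
  qed
  have sum: "summable (\<lambda>n. C / real (n + 3) ^ 2)"
  proof -
    have "summable (\<lambda>n. inverse ((real n) ^ 2))" by (rule inverse_power_summable) simp
    then have "summable (\<lambda>n. C * inverse ((real (n + 3)) ^ 2))" by (intro summable_mult summable_ignore_initial_segment)
    then show ?thesis by (simp add: divide_inverse)
  qed
  have "(\<integral>\<^sup>+\<omega>. (\<Sum>n. ennreal (Y n \<omega>)) \<partial>P) = (\<Sum>n. \<integral>\<^sup>+\<omega>. ennreal (Y n \<omega>) \<partial>P)"
    by (rule nn_integral_suminf) (rule meas)
  also have "\<dots> \<le> (\<Sum>n. ennreal (C / real (n + 3) ^ 2))" by (intro suminf_le mean) auto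
  also have "\<dots> = ennreal (\<Sum>n. C / real (n + 3) ^ 2)" using sum C0 by (intro suminf_ennreal2) auto
  finally have "(\<integral>\<^sup>+\<omega>. (\<Sum>n. ennreal (Y n \<omega>)) \<partial>P) \<noteq> \<infinity>" by (auto simp: top_unique)
  then have "AE \<omega> in P. (\<Sum>n. ennreal (Y n \<omega>)) \<noteq> \<infinity>"
    by (intro nn_integral_PInf_AE borel_measurable_suminf_order meas) auto
  then show ?thesis
  proof eventually_elim
    case (elim \<omega>)
    have "summable (\<lambda>n. Y n \<omega>)"
      by (rule summable_suminf_not_top) (use elim nn in \<open>auto simp: Y_def\<close>)
    then have "(\<lambda>n. Y n \<omega>) \<longlonglongrightarrow> 0" by (rule summable_LIMSEQ_zero)
    then show ?case unfolding Y_def by (rule LIMSEQ_offset)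
  qed
qed

lemma moment_tendsto_AE:
  fixes P :: "'w measure"
  assumes P: "prob_space P" and G: "\<And>n. uniform_random_graph P n (G n)"
  shows "AE \<omega> in P. \<forall>k. (\<lambda>n. \<integral>x. x ^ (2 * k) \<partial>singular_value_distribution ((1 / real (n + 3) powr (3 / 2)) \<cdot>\<^sub>m Z3_matrix (n + 3) (G (n + 3) \<omega>)))
    \<longlonglongrightarrow> real (pairings (zigzag_word k) [])"
proof -
  have "AE \<omega> in P. \<forall>k. 0 < k \<longrightarrow> (\<lambda>n. scaled_deviation k n (G n \<omega>)) \<longlonglongrightarrow> 0"
    unfolding AE_all_countable
  proof
    fix k :: nat
    show "AE \<omega> in P. 0 < k \<longrightarrow> (\<lambda>n. scaled_deviation k n (G n \<omega>)) \<longlonglongrightarrow> 0"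
      using deviation_tendsto_AE[OF P G, of k] by (cases "0 < k") auto
  qed
  then show ?thesis
  proof eventually_elim
    case (elim \<omega>)
    show ?case
    proof
      fix k
      let ?M = "\<lambda>n. (1 / real n powr (3 / 2)) \<cdot>\<^sub>m Z3_matrix n (G n \<omega>)"
      let ?N = "\<lambda>n. real (card (triples_of {1..n}))"
      have carrier: "?M n \<in> carrier_mat (length (triples n)) (length (triples n))" for n by (simp add: Z3_matrix_def)
      have pos: "0 < length (triples n)" if "3 \<le> n" for n using that card_triples_of[OF that] by (simp add: length_triples)
      show "(\<lambda>n. \<integral>x. x ^ (2 * k) \<partial>singular_value_distribution (?M (n + 3))) \<longlonglongrightarrow> real (pairings (zigzag_word k) [])"
      proof (cases "k = 0")
        case True
        have "(\<integral>x. x ^ (2 * k) \<partial>singular_value_distribution (?M n)) = 1" for n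
        proof -
          interpret D: real_distribution "singular_value_distribution (?M n)" by (rule real_distribution_singular_value)
          show ?thesis using True D.prob_space by simp
        qed
        then have "(\<lambda>n. \<integral>x. x ^ (2 * k) \<partial>singular_value_distribution (?M (n + 3))) = (\<lambda>_. 1)" by blast
        moreover have "real (pairings (zigzag_word k) []) = 1" using True by (simp add: zigzag_word_def)
        ultimately show ?thesis by (simp only: tendsto_const)
      next
        case False
        then have k: "0 < k" by simp
        have mom: "(\<integral>x. x ^ (2 * k) \<partial>singular_value_distribution (?M n)) = sign_trace n k (G n \<omega>) / (?N n * real n ^ (3 * k))" if n: "3 \<le> n" for n
        proof -
          have "(\<integral>x. x ^ (2 * k) \<partial>singular_value_distribution (?M n)) = mtrace ((transpose_mat (?M n) * ?M n) ^\<^sub>m k) / real (length (triples n))"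
            by (rule singular_value_moment[OF carrier pos[OF n]])
          also have "mtrace ((transpose_mat (?M n) * ?M n) ^\<^sub>m k) = (1 / real n powr (3 / 2)) ^ (2 * k) * sign_trace n k (G n \<omega>)"
            by (rule mtrace_scaled_Z3[OF k refl])
          also have "(1 / real n powr (3 / 2)) ^ (2 * k) = 1 / real n ^ (3 * k)"
          proof -
            have "(real n powr (3 / 2)) ^ (2 * k) = real n powr (real (2 * k) * (3 / 2))" using n by (simp add: powr_power mult.commute)
            also have "real (2 * k) * (3 / 2) = real (3 * k)" by simp
            also have "real n powr real (3 * k) = real n ^ (3 * k)" using n by (intro powr_realpow) simp
            finally show ?thesis by (simp add: power_one_over)
          qed
          finally show ?thesis by (simp add: length_triples)
        qed
        have "(\<lambda>n. sqrt (scaled_deviation k n (G n \<omega>))) \<longlonglongrightarrow> sqrt 0" using elim k by (intro tendsto_real_sqrt) auto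
        then have "(\<lambda>n. \<bar>(sign_trace n k (G n \<omega>) - real (card (balanced_walks {1..n} k))) / (?N n * real n ^ (3 * k))\<bar>) \<longlonglongrightarrow> 0"
          by (simp add: scaled_deviation_def)
        then have "(\<lambda>n. (sign_trace n k (G n \<omega>) - real (card (balanced_walks {1..n} k))) / (?N n * real n ^ (3 * k))) \<longlonglongrightarrow> 0"
          by (rule tendsto_rabs_zero_cancel)
        then have "(\<lambda>n. (sign_trace n k (G n \<omega>) - real (card (balanced_walks {1..n} k))) / (?N n * real n ^ (3 * k))
             + real (card (balanced_walks {1..n} k)) / (?N n * real n ^ (3 * k))) \<longlonglongrightarrow> 0 + real (pairings (zigzag_word k) [])"
          by (intro tendsto_add balanced_walks_asymptotics k)
        then have "(\<lambda>n. sign_trace n k (G n \<omega>) / (?N n * real n ^ (3 * k))) \<longlonglongrightarrow> real (pairings (zigzag_word k) [])"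
          by (simp add: diff_divide_distrib)
        then have "(\<lambda>n. sign_trace (n + 3) k (G (n + 3) \<omega>) / (?N (n + 3) * real (n + 3) ^ (3 * k))) \<longlonglongrightarrow> real (pairings (zigzag_word k) [])"
          by (rule LIMSEQ_ignore_initial_segment)
        then show ?thesis using mom[of "_ + 3"] by (subst mom) auto
      qed
    qed
  qed
qed

theorem corollary6p5:
  fixes a :: real
    and f f' f'' f''' g :: "real \<Rightarrow> real"
    and P :: "'w measure"
    and G :: "nat \<Rightarrow> 'w \<Rightarrow> nat set set"
  assumes a: "a = 16 / (3 * sqrt 3)"
    and f': "\<And>x. x \<in> {0<..<a} \<Longrightarrow> (f has_real_derivative f' x) (at x)"
    and f'': "\<And>x. x \<in> {0<..<a} \<Longrightarrow> (f' has_real_derivative f'' x) (at x)"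
    and f''': "\<And>x. x \<in> {0<..<a} \<Longrightarrow> (f'' has_real_derivative f''' x) (at x)"
    and cont: "continuous_on {0<..<a} f'''"
    and ode: "\<And>x. x \<in> {0<..<a} \<Longrightarrow>
      (27 * x ^ 4 - 256 * x ^ 2) * f''' x + (162 * x ^ 3 - 768 * x) * f'' x
        + (177 * x ^ 2 - 192) * f' x + 15 * x * f x = 0"
    and int: "(f has_integral 1) {0<..<a}"
    and lim_a_0: "(f \<longlongrightarrow> 0) (at_left a)"
    and lim_a_1: "((\<lambda>x. (x - a) * f' x) \<longlongrightarrow> 0) (at_left a)"
    and lim_a_2: "((\<lambda>x. 2 * (x - a) * f'' x + f' x) \<longlongrightarrow> 0) (at_left a)"
    and lim_0_0: "((\<lambda>x. x * f x) \<longlongrightarrow> 0) (at_right 0)"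
    and lim_0_1: "((\<lambda>x. x ^ 2 * f' x) \<longlongrightarrow> 0) (at_right 0)"
    and lim_0_2: "((\<lambda>x. x ^ 3 * f'' x) \<longlongrightarrow> 0) (at_right 0)"
    and g_inside: "\<And>x. x \<in> {0<..<a} \<Longrightarrow> g x = f x"
    and g_outside: "\<And>x. x \<ge> a \<Longrightarrow> g x = 0"
    and P: "prob_space P"
    and G: "\<And>n. uniform_random_graph P n (G n)"
  shows "(\<forall>x>0. g x \<ge> 0) \<and>
    (AE \<omega> in P.
       weak_conv_m
         (\<lambda>n. singular_value_distribution
            ((1 / real n powr (3 / 2)) \<cdot>\<^sub>m Z3_matrix n (G n \<omega>)))
         (density lborel (\<lambda>x. ennreal (indicator {0<..} x * g x))))"
proof -
  interpret P: prob_space P by fact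
  obtain F m where F: "continuous_on {0..a} F" "F 0 = 0" "F a = 1"
    and Fd: "\<And>x. x \<in> {0<..<a} \<Longrightarrow> (F has_real_derivative f x) (at x)"
    and Fm: "\<And>k. ((\<lambda>x. 2 * real k * x ^ (2 * k - 1) * F x) has_integral (a ^ (2 * k) - m k)) {0..a}"
    and m0: "m 0 = 1"
    and mS: "\<And>k. (3 * real k + 4) * (3 * real k + 3) * (3 * real k + 2) * m (Suc k) = 4 * ((4 * real k + 3) * (4 * real k + 2) * (4 * real k + 1)) * m k"
    using moments_from_ode[OF a f' f'' f''' ode int lim_a_0 lim_a_1 lim_a_2 lim_0_0 lim_0_1 lim_0_2] by blast
  have m: "m k = real (pairings (zigzag_word k) [])" for k
  proof (induction k)
    case 0 then show ?case using m0 by (simp add: zigzag_word_def)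
  next
    case (Suc k)
    have "real (pairings (zigzag_word (Suc k)) [] * ((3 * k + 4) * (3 * k + 3) * (3 * k + 2))) =
      real (4 * ((4 * k + 3) * (4 * k + 2) * (4 * k + 1)) * pairings (zigzag_word k) [])"
      unfolding pairings_recurrence ..
    then have "real (pairings (zigzag_word (Suc k)) []) * ((3 * real k + 4) * (3 * real k + 3) * (3 * real k + 2)) =
       4 * ((4 * real k + 3) * (4 * real k + 2) * (4 * real k + 1)) * real (pairings (zigzag_word k) [])"
      by (simp only: of_nat_mult of_nat_add of_nat_numeral of_nat_1)
    also have "\<dots> = m (Suc k) * ((3 * real k + 4) * (3 * real k + 3) * (3 * real k + 2))"
      using mS[of k] Suc by (simp add: mult_ac)
    finally show ?case by (simp add: add_nonneg_eq_0_iff)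
  qed
  have a_pos: "0 < a" unfolding a by simp
  have f_cont: "continuous_on {0<..<a} f"
    using f' by (intro continuous_at_imp_continuous_on ballI DERIV_isCont)
  have dens: "(\<lambda>x. ennreal (indicator {0<..} x * g x)) = (\<lambda>x. ennreal (indicator {0<..<a} x * f x))"
  proof
    fix x
    show "ennreal (indicator {0<..} x * g x) = ennreal (indicator {0<..<a} x * f x)"
      using g_inside[of x] g_outside[of x] by (cases "x < a") (auto simp: indicator_def)
  qed
  have "AE \<omega> in P. (\<forall>x\<in>{0<..<a}. 0 \<le> f x) \<and> weak_conv_m
         (\<lambda>n. singular_value_distribution ((1 / real n powr (3 / 2)) \<cdot>\<^sub>m Z3_matrix n (G n \<omega>)))
         (density lborel (\<lambda>x. ennreal (indicator {0<..<a} x * f x)))"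
    using moment_tendsto_AE[OF P G]
  proof eventually_elim
    case (elim \<omega>)
    define \<mu> where "\<mu> n = singular_value_distribution ((1 / real n powr (3 / 2)) \<cdot>\<^sub>m Z3_matrix n (G n \<omega>))" for n
    have carrier: "(1 / real n powr (3 / 2)) \<cdot>\<^sub>m Z3_matrix n (G n \<omega>) \<in> carrier_mat (length (triples n)) (length (triples n))" for n
      by (simp add: Z3_matrix_def)
    have pos: "0 < length (triples (n + 3))" for n using card_triples_of[of "n + 3"] by (simp add: length_triples)
    \<comment> \<open>The distribution of an empty multiset of singular values is unspecified, so the sequence
      starts at three vertices.\<close>
    interpret M: moment_convergence a F m "\<lambda>n. \<mu> (n + 3)"
    proof (rule moment_convergence.intro)
      show "0 < a" by (rule a_pos)
      show "continuous_on {0..a} F" "F 0 = 0" "F a = 1" by (fact F)+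
      show "((\<lambda>x. 2 * real k * x ^ (2 * k - 1) * F x) has_integral (a ^ (2 * k) - m k)) {0..a}" for k by (rule Fm)
      show "real_distribution (\<mu> (n + 3))" for n unfolding \<mu>_def by (rule real_distribution_singular_value)
      show "AE x in \<mu> (n + 3). 0 \<le> x" for n unfolding \<mu>_def by (rule singular_value_nonneg(1)[OF carrier pos])
      show "integrable (\<mu> (n + 3)) (\<lambda>x. x ^ (2 * k))" for n k
        unfolding \<mu>_def by (rule integrable_singular_value_power[OF singular_value_nonneg(2)[OF carrier pos]])
      show "(\<lambda>n. \<integral>x. x ^ (2 * k) \<partial>\<mu> (n + 3)) \<longlonglongrightarrow> m k" for k
        using elim unfolding \<mu>_def m by blast
    qed
    have "weak_conv_m (\<lambda>n. \<mu> (n + 3)) (density lborel (\<lambda>x. ennreal (indicator {0<..<a} x * f x)))"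
      by (rule M.density_limit(2)[OF Fd f_cont])
    then have "weak_conv_m \<mu> (density lborel (\<lambda>x. ennreal (indicator {0<..<a} x * f x)))"
      unfolding weak_conv_m_def weak_conv_def by (auto intro: LIMSEQ_offset[of _ 3])
    then show ?case using M.density_limit(1)[OF Fd f_cont] unfolding \<mu>_def by blast
  qed
  then have "(\<forall>x\<in>{0<..<a}. 0 \<le> f x)" and
    "AE \<omega> in P. weak_conv_m
         (\<lambda>n. singular_value_distribution ((1 / real n powr (3 / 2)) \<cdot>\<^sub>m Z3_matrix n (G n \<omega>)))
         (density lborel (\<lambda>x. ennreal (indicator {0<..<a} x * f x)))"
    by (simp_all add: P.AE_const)
  moreover have "0 \<le> g x" if "0 < x" for x
    using that calculation(1) g_inside[of x] g_outside[of x] by (cases "x < a") auto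
  ultimately show ?thesis unfolding dens by blast
qed

end
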